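(* With notation as in the context, for each integer $i$ the cohomology $\mathrm{H}^i(\mathcal{T})\cong\mathrm{H}^i(\mathcal{E}nd_\Gamma(\mathrm{P}))$ is isomorphic (as a $k$-vector space) to the direct sum of the spaces assigned to degree $i$ in the following list, and is zero if no space is assigned to degree $i$: in degree $-k$ for $1\le k\le n-1$: $\mathrm{Ext}^{n-1-k}_\Gamma(M,M)$; in degree $0$: $\mathrm{Ext}^{n-1}_\Gamma(M,M)$, $\operatorname{Im}(\circ d_0)$ and $\mathrm{Hom}_\Gamma(M,M)$; in degree $k$ for $1\le k\le n-2$: $\mathrm{Ext}^k_\Gamma(M,M)$; in degree $n-1$: $\mathrm{Ext}^{n-1}_\Gamma(M,M)$ and $\operatorname{Im}(\circ d_0)$. Here $\operatorname{Im}(\circ d_0)$ is the image of $\circ d_0\colon\mathrm{Hom}_\Gamma(P_{n-1},M)\to\mathrm{Hom}_\Gamma(P_0,M)$, $f\mapsto f\circ d_0$.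
   Context: $k$ is a field, $\Gamma$ a $k$-algebra (right modules), $M$ a $\Gamma$-module, $n\ge1$. Given a complex of finitely generated projectives $\mathrm{P}=(0\to P_{n-1}\xrightarrow{d_{n-1}}\cdots\xrightarrow{d_1}P_0\to0)$, $P_i$ in degree $-i$, and $\alpha\colon P_0\to M$, $\beta\colon M\to P_{n-1}$ with $0\to M\xrightarrow{\beta}P_{n-1}\to\cdots\to P_0\xrightarrow{\alpha}M\to0$ exact; $d_0=\beta\circ\alpha$. $\mathcal{E}nd_\Gamma(\mathrm{P})$ is the DG endomorphism algebra of $\mathrm{P}$ (product composition, differential $\delta(f)=d\circ f-(-1)^{|f|}f\circ d$). $\mathcal{P}$ is the complex with a copy of $P_i$ (the $\ell$-th copy) in degree $-(\ell n+i)$, $\ell\ge0$, $0\le i\le n-1$, differential $(-1)^{\ell n}d_i$ within the $\ell$-th copy ($i\ge1$) and $(-1)^{\ell n}d_0$ from the $(\ell+1)$-th copy of $P_0$ to the $\ell$-th copy of $P_{n-1}$; $\mathcal{E}=\mathcal{E}nd_\Gamma(\mathcal{P})$. $\sigma\in\mathcal{E}^n$ is the identity from the $\ell$-th copy of $P_i$ to the $(\ell-1)$-th copy ($\ell\ge1$), zero on the $0$-th copy. ${}^{\sigma}\mathcal{E}^i=\{x\in\mathcal{E}^i:\sigma\circ x=(-1)^{n|x|}x\circ\sigma\}$, ${}^{-\sigma}\mathcal{E}^i=\{y\in\mathcal{E}^i:\sigma\circ y=(-1)^{n(|y|+1)}y\circ\sigma\}$. The trivial extension DG-algebra $\mathcal{T}$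 has degree $j$ part $\{(x,y):x\in{}^{\sigma}\mathcal{E}^j,\ y\in{}^{-\sigma}\mathcal{E}^{j-n+1}\}$, product $(x,y)\cdot(a,b)=(x\circ a,\ x\circ b+(-1)^{|a|(n+1)}y\circ a)$ and differential $\xi(x,y)=(\delta(x)-(-1)^{|x|}y\circ\sigma,\ \delta(y))$.
   Formalization: Stated for n ≥ 2 instead of n ≥ 1: for n = 1 degrees 0 and n-1 coincide and the list is wrong, e.g. Γ = M = k, P_0 = k² gives H^0 of dimension 4, while the listed spaces have total dimension 5 (or 3 without repeats). *)

theory Defs
  imports Main "HOL-Library.Function_Algebras" "HOL-Library.Product_Plus"
begin

text \<open>The k-algebra Gamma is a type 'g (a ring with unit) together with a structure
map alg from the field 'k into the centre of 'g.  All Gamma-modules involved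
(M, P_0, ..., P_(n-1), terms of projective resolutions) are submodules of one ambient
right Gamma-module V, given by a type 'm with a right action act.  Homomorphisms are
functions 'm => 'm that are extensional (zero outside their domain).\<close>

definition right_module :: "('m::ab_group_add \<Rightarrow> 'g::ring_1 \<Rightarrow> 'm) \<Rightarrow> bool" where
  "right_module act \<longleftrightarrow>
     (\<forall>x y r. act (x + y) r = act x r + act y r) \<and>
     (\<forall>x r s. act x (r + s) = act x r + act x s) \<and>
     (\<forall>x r s. act x (r * s) = act (act x r) s) \<and>
     (\<forall>x. act x 1 = x)"

definition k_algebra_map :: "('k::field \<Rightarrow> 'g::ring_1) \<Rightarrow> bool" where
  "k_algebra_map alg \<longleftrightarrow>
     (\<forall>a b. alg (a + b) = alg a + alg b) \<and>
     (\<forall>a b. alg (a * b) = alg a * alg b) \<and>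
     alg 1 = 1 \<and>
     (\<forall>a r. alg a * r = r * alg a)"

definition submod :: "('m::ab_group_add \<Rightarrow> 'g \<Rightarrow> 'm) \<Rightarrow> 'm set \<Rightarrow> bool" where
  "submod act A \<longleftrightarrow> 0 \<in> A \<and> (\<forall>x\<in>A. \<forall>y\<in>A. x + y \<in> A) \<and> (\<forall>x\<in>A. - x \<in> A)
      \<and> (\<forall>x\<in>A. \<forall>r. act x r \<in> A)"

definition modhom :: "('m::ab_group_add \<Rightarrow> 'g \<Rightarrow> 'm) \<Rightarrow> 'm set \<Rightarrow> 'm set \<Rightarrow> ('m \<Rightarrow> 'm) \<Rightarrow> bool" where
  "modhom act A B f \<longleftrightarrow> (\<forall>x\<in>A. f x \<in> B) \<and> (\<forall>x\<in>A. \<forall>y\<in>A. f (x + y) = f x + f y)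
      \<and> (\<forall>x\<in>A. \<forall>r. f (act x r) = act (f x) r) \<and> (\<forall>x. x \<notin> A \<longrightarrow> f x = 0)"

definition Hom :: "('m::ab_group_add \<Rightarrow> 'g \<Rightarrow> 'm) \<Rightarrow> 'm set \<Rightarrow> 'm set \<Rightarrow> ('m \<Rightarrow> 'm) set" where
  "Hom act A B = {f. modhom act A B f}"

definition free_mod :: "'i set \<Rightarrow> ('i \<Rightarrow> 'g::ring_1) set" where
  "free_mod I = {v. {j. v j \<noteq> 0} \<subseteq> I \<and> finite {j. v j \<noteq> 0}}"

definition summand_of_free :: "('m::ab_group_add \<Rightarrow> 'g::ring_1 \<Rightarrow> 'm) \<Rightarrow> 'i set \<Rightarrow> 'm set \<Rightarrow> bool" where
  "summand_of_free act I P \<longleftrightarrow> (\<exists>e r.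
      (\<forall>x\<in>P. e x \<in> free_mod I) \<and>
      (\<forall>x\<in>P. \<forall>y\<in>P. e (x + y) = e x + e y) \<and>
      (\<forall>x\<in>P. \<forall>g. e (act x g) = (\<lambda>j. e x j * g)) \<and>
      (\<forall>v\<in>free_mod I. r v \<in> P) \<and>
      (\<forall>v\<in>free_mod I. \<forall>w\<in>free_mod I. r (v + w) = r v + r w) \<and>
      (\<forall>v\<in>free_mod I. \<forall>g. r (\<lambda>j. v j * g) = act (r v) g) \<and>
      (\<forall>x\<in>P. r (e x) = x))"

text \<open>Projective = direct summand of a free module.  (A projective submodule of V is a
summand of the free module on its own underlying set, so index sets in 'm suffice.)\<close>
definition projective :: "('m::ab_group_add \<Rightarrow> 'g::ring_1 \<Rightarrow> 'm) \<Rightarrow> 'm set \<Rightarrow> bool" where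
  "projective act P \<longleftrightarrow> submod act P \<and> (\<exists>I::'m set. summand_of_free act I P)"

definition fg_projective :: "('m::ab_group_add \<Rightarrow> 'g::ring_1 \<Rightarrow> 'm) \<Rightarrow> 'm set \<Rightarrow> bool" where
  "fg_projective act P \<longleftrightarrow> submod act P \<and> (\<exists>I::nat set. finite I \<and> summand_of_free act I P)"

definition ms :: "('m \<Rightarrow> 'g \<Rightarrow> 'm) \<Rightarrow> ('k \<Rightarrow> 'g) \<Rightarrow> 'k \<Rightarrow> 'm \<Rightarrow> 'm" where
  "ms act alg c x = act x (alg c)"

text \<open>Data: n, M, P_0..P_(n-1) (P i for i < n), d_i for 1 <= i <= n-1 (the value d 0 is
irrelevant; d_0 is beta o alpha), alpha : P_0 -> M, beta : M -> P_(n-1), and the sequence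
0 -> M -> P_(n-1) -> ... -> P_0 -> M -> 0 is exact.\<close>
definition exact_setup ::
  "('m::ab_group_add \<Rightarrow> 'g::ring_1 \<Rightarrow> 'm) \<Rightarrow> nat \<Rightarrow> 'm set \<Rightarrow> (nat \<Rightarrow> 'm set) \<Rightarrow>
   (nat \<Rightarrow> 'm \<Rightarrow> 'm) \<Rightarrow> ('m \<Rightarrow> 'm) \<Rightarrow> ('m \<Rightarrow> 'm) \<Rightarrow> bool" where
  "exact_setup act n M P d \<alpha> \<beta> \<longleftrightarrow>
     (let out = (\<lambda>i. if i = 0 then \<alpha> else d i) in
     1 \<le> n \<and> submod act M \<and> (\<forall>i<n. fg_projective act (P i)) \<and>
     (\<forall>i. 1 \<le> i \<and> i < n \<longrightarrow> modhom act (P i) (P (i - 1)) (d i)) \<and>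
     modhom act (P 0) M \<alpha> \<and> modhom act M (P (n - 1)) \<beta> \<and>
     (\<forall>x\<in>M. \<beta> x = 0 \<longrightarrow> x = 0) \<and>
     \<beta> ` M = {x \<in> P (n - 1). out (n - 1) x = 0} \<and>
     (\<forall>i. 1 \<le> i \<and> i < n \<longrightarrow> d i ` P i = {x \<in> P (i - 1). out (i - 1) x = 0}) \<and>
     \<alpha> ` P 0 = M)"

definition d0 :: "('m \<Rightarrow> 'm) \<Rightarrow> ('m \<Rightarrow> 'm) \<Rightarrow> 'm \<Rightarrow> 'm" where
  "d0 \<alpha> \<beta> = \<beta> \<circ> \<alpha>"

section \<open>Complexes indexed by homological degree (int); cohomological degree is its negative\<close>

definition isgn :: "int \<Rightarrow> 'a::ab_group_add \<Rightarrow> 'a" where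
  "isgn e x = (if even e then x else - x)"

text \<open>The finite complex P: P_t in homological degree t (cohomological degree -t).\<close>
definition finC :: "nat \<Rightarrow> (nat \<Rightarrow> 'm::zero set) \<Rightarrow> int \<Rightarrow> 'm set" where
  "finC n P t = (if 0 \<le> t \<and> t < int n then P (nat t) else {0})"

definition finD :: "nat \<Rightarrow> (nat \<Rightarrow> 'm \<Rightarrow> 'm::zero) \<Rightarrow> int \<Rightarrow> 'm \<Rightarrow> 'm" where
  "finD n d t = (if 1 \<le> t \<and> t < int n then d (nat t) else (\<lambda>x. 0))"

text \<open>The periodic complex calP: homological degree t = l*n + i holds the l-th copy of P_i;
the differential out of degree t (t >= 1) is (-1)^(l' n) d_(t mod n) (with d_0 = beta o alpha),
where l' = (t-1) div n is the copy index of the target.\<close>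
definition perC :: "nat \<Rightarrow> (nat \<Rightarrow> 'm::zero set) \<Rightarrow> int \<Rightarrow> 'm set" where
  "perC n P t = (if 0 \<le> t then P (nat t mod n) else {0})"

definition perD :: "nat \<Rightarrow> (nat \<Rightarrow> 'm \<Rightarrow> 'm) \<Rightarrow> ('m \<Rightarrow> 'm) \<Rightarrow> ('m \<Rightarrow> 'm) \<Rightarrow> int \<Rightarrow> 'm \<Rightarrow> 'm::ab_group_add" where
  "perD n d \<alpha> \<beta> t = (if 1 \<le> t then
      (\<lambda>x. isgn (int (((nat t - 1) div n) * n))
             ((if nat t mod n = 0 then d0 \<alpha> \<beta> else d (nat t mod n)) x))
    else (\<lambda>x. 0))"

text \<open>Graded homomorphisms of cohomological degree j: components f t : C t -> C (t - j).\<close>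
definition gHom :: "('m::ab_group_add \<Rightarrow> 'g \<Rightarrow> 'm) \<Rightarrow> (int \<Rightarrow> 'm set) \<Rightarrow> int \<Rightarrow> (int \<Rightarrow> 'm \<Rightarrow> 'm) set" where
  "gHom act C j = {f. \<forall>t. modhom act (C t) (C (t - j)) (f t)}"

definition gcomp :: "(int \<Rightarrow> 'm \<Rightarrow> 'm) \<Rightarrow> int \<Rightarrow> (int \<Rightarrow> 'm \<Rightarrow> 'm) \<Rightarrow> int \<Rightarrow> 'm \<Rightarrow> 'm" where
  "gcomp f jg g = (\<lambda>t. f (t - jg) \<circ> g t)"

definition gdiff :: "(int \<Rightarrow> 'm \<Rightarrow> 'm) \<Rightarrow> int \<Rightarrow> (int \<Rightarrow> 'm \<Rightarrow> 'm) \<Rightarrow> int \<Rightarrow> 'm \<Rightarrow> 'm::ab_group_add" where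
  "gdiff D j f = (\<lambda>t x. D (t - j) (f t x) - isgn j (f (t - 1) (D t x)))"

definition EndZ :: "('m::ab_group_add \<Rightarrow> 'g \<Rightarrow> 'm) \<Rightarrow> (int \<Rightarrow> 'm set) \<Rightarrow> (int \<Rightarrow> 'm \<Rightarrow> 'm) \<Rightarrow> int \<Rightarrow> (int \<Rightarrow> 'm \<Rightarrow> 'm) set" where
  "EndZ act C D j = {f \<in> gHom act C j. gdiff D j f = 0}"

definition EndB :: "('m::ab_group_add \<Rightarrow> 'g \<Rightarrow> 'm) \<Rightarrow> (int \<Rightarrow> 'm set) \<Rightarrow> (int \<Rightarrow> 'm \<Rightarrow> 'm) \<Rightarrow> int \<Rightarrow> (int \<Rightarrow> 'm \<Rightarrow> 'm) set" where
  "EndB act C D j = gdiff D (j - 1) ` gHom act C (j - 1)"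

text \<open>sigma : identity from copy l of P_i to copy l-1 (l >= 1), zero on copy 0; degree n.\<close>
definition sigmaP :: "nat \<Rightarrow> (int \<Rightarrow> 'm::zero set) \<Rightarrow> int \<Rightarrow> 'm \<Rightarrow> 'm" where
  "sigmaP n C t x = (if int n \<le> t \<and> x \<in> C t then x else 0)"

definition sigE :: "('m::ab_group_add \<Rightarrow> 'g \<Rightarrow> 'm) \<Rightarrow> nat \<Rightarrow> (int \<Rightarrow> 'm set) \<Rightarrow> int \<Rightarrow> (int \<Rightarrow> 'm \<Rightarrow> 'm) set" where
  "sigE act n C i = {x \<in> gHom act C i.
      gcomp (sigmaP n C) i x = isgn (int n * i) (gcomp x (int n) (sigmaP n C))}"

definition msigE :: "('m::ab_group_add \<Rightarrow> 'g \<Rightarrow> 'm) \<Rightarrow> nat \<Rightarrow> (int \<Rightarrow> 'm set) \<Rightarrow> int \<Rightarrow> (int \<Rightarrow> 'm \<Rightarrow> 'm) set" where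
  "msigE act n C i = {y \<in> gHom act C i.
      gcomp (sigmaP n C) i y = isgn (int n * (i + 1)) (gcomp y (int n) (sigmaP n C))}"

definition Tdeg :: "('m::ab_group_add \<Rightarrow> 'g \<Rightarrow> 'm) \<Rightarrow> nat \<Rightarrow> (int \<Rightarrow> 'm set) \<Rightarrow> int
     \<Rightarrow> ((int \<Rightarrow> 'm \<Rightarrow> 'm) \<times> (int \<Rightarrow> 'm \<Rightarrow> 'm)) set" where
  "Tdeg act n C j = {(x, y). x \<in> sigE act n C j \<and> y \<in> msigE act n C (j - int n + 1)}"

definition Txi :: "nat \<Rightarrow> (int \<Rightarrow> 'm set) \<Rightarrow> (int \<Rightarrow> 'm \<Rightarrow> 'm) \<Rightarrow> int
     \<Rightarrow> (int \<Rightarrow> 'm \<Rightarrow> 'm) \<times> (int \<Rightarrow> 'm \<Rightarrow> 'm) \<Rightarrow> (int \<Rightarrow> 'm \<Rightarrow> 'm) \<times> (int \<Rightarrow> 'm \<Rightarrow> 'm::ab_group_add)" where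
  "Txi n C D j p = (gdiff D j (fst p) - isgn j (gcomp (snd p) (int n) (sigmaP n C)),
                    gdiff D (j - int n + 1) (snd p))"

definition TZ :: "('m::ab_group_add \<Rightarrow> 'g \<Rightarrow> 'm) \<Rightarrow> nat \<Rightarrow> (int \<Rightarrow> 'm set) \<Rightarrow> (int \<Rightarrow> 'm \<Rightarrow> 'm) \<Rightarrow> int
     \<Rightarrow> ((int \<Rightarrow> 'm \<Rightarrow> 'm) \<times> (int \<Rightarrow> 'm \<Rightarrow> 'm)) set" where
  "TZ act n C D j = {p \<in> Tdeg act n C j. Txi n C D j p = (0, 0)}"

definition TB :: "('m::ab_group_add \<Rightarrow> 'g \<Rightarrow> 'm) \<Rightarrow> nat \<Rightarrow> (int \<Rightarrow> 'm set) \<Rightarrow> (int \<Rightarrow> 'm \<Rightarrow> 'm) \<Rightarrow> int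
     \<Rightarrow> ((int \<Rightarrow> 'm \<Rightarrow> 'm) \<times> (int \<Rightarrow> 'm \<Rightarrow> 'm)) set" where
  "TB act n C D j = Txi n C D (j - 1) ` Tdeg act n C (j - 1)"

definition proj_resolution ::
  "('m::ab_group_add \<Rightarrow> 'g::ring_1 \<Rightarrow> 'm) \<Rightarrow> 'm set \<Rightarrow> (nat \<Rightarrow> 'm set) \<Rightarrow> (nat \<Rightarrow> 'm \<Rightarrow> 'm) \<Rightarrow> ('m \<Rightarrow> 'm) \<Rightarrow> bool" where
  "proj_resolution act M Q dQ eps \<longleftrightarrow>
     (\<forall>t. projective act (Q t)) \<and>
     (\<forall>t\<ge>1. modhom act (Q t) (Q (t - 1)) (dQ t)) \<and>
     modhom act (Q 0) M eps \<and> eps ` Q 0 = M \<and>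
     dQ 1 ` Q 1 = {x \<in> Q 0. eps x = 0} \<and>
     (\<forall>t\<ge>1. dQ (t + 1) ` Q (t + 1) = {x \<in> Q t. dQ t x = 0})"

definition ExtZ :: "('m::ab_group_add \<Rightarrow> 'g \<Rightarrow> 'm) \<Rightarrow> 'm set \<Rightarrow> (nat \<Rightarrow> 'm set) \<Rightarrow> (nat \<Rightarrow> 'm \<Rightarrow> 'm) \<Rightarrow> nat \<Rightarrow> ('m \<Rightarrow> 'm) set" where
  "ExtZ act M Q dQ j = {\<phi> \<in> Hom act (Q j) M. \<phi> \<circ> dQ (j + 1) = (\<lambda>x. 0)}"

definition ExtB :: "('m::ab_group_add \<Rightarrow> 'g \<Rightarrow> 'm) \<Rightarrow> 'm set \<Rightarrow> (nat \<Rightarrow> 'm set) \<Rightarrow> (nat \<Rightarrow> 'm \<Rightarrow> 'm) \<Rightarrow> nat \<Rightarrow> ('m \<Rightarrow> 'm) set" where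
  "ExtB act M Q dQ j = (if j = 0 then {\<lambda>x. 0} else (\<lambda>\<phi>. \<phi> \<circ> dQ j) ` Hom act (Q (j - 1)) M)"

definition ImD0 :: "('m::ab_group_add \<Rightarrow> 'g \<Rightarrow> 'm) \<Rightarrow> nat \<Rightarrow> 'm set \<Rightarrow> (nat \<Rightarrow> 'm set) \<Rightarrow> ('m \<Rightarrow> 'm) \<Rightarrow> ('m \<Rightarrow> 'm) \<Rightarrow> ('m \<Rightarrow> 'm) set" where
  "ImD0 act n M P \<alpha> \<beta> = (\<lambda>f. f \<circ> d0 \<alpha> \<beta>) ` Hom act (P (n - 1)) M"

definition summands ::
  "('m::ab_group_add \<Rightarrow> 'g \<Rightarrow> 'm) \<Rightarrow> nat \<Rightarrow> 'm set \<Rightarrow> (nat \<Rightarrow> 'm set) \<Rightarrow> ('m \<Rightarrow> 'm) \<Rightarrow> ('m \<Rightarrow> 'm)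
    \<Rightarrow> (nat \<Rightarrow> 'm set) \<Rightarrow> (nat \<Rightarrow> 'm \<Rightarrow> 'm) \<Rightarrow> int \<Rightarrow> (('m \<Rightarrow> 'm) set \<times> ('m \<Rightarrow> 'm) set) list" where
  "summands act n M P \<alpha> \<beta> Q dQ i =
     (let E = (\<lambda>j. (ExtZ act M Q dQ j, ExtB act M Q dQ j));
          Im = (ImD0 act n M P \<alpha> \<beta>, {\<lambda>x. 0});
          Hm = (Hom act M M, {\<lambda>x. 0}) in
      if i = 0 then [E (n - 1), Im, Hm]
      else if i = int n - 1 then [E (n - 1), Im]
      else if - (int n - 1) \<le> i \<and> i \<le> -1 then [E (nat (int n - 1 + i))]
      else if 1 \<le> i \<and> i \<le> int n - 2 then [E (nat i)]
      else [])"

definition dsZ :: "('a set \<times> 'a set) list \<Rightarrow> (nat \<Rightarrow> 'a::zero) set" where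
  "dsZ L = {v. (\<forall>j<length L. v j \<in> fst (L ! j)) \<and> (\<forall>j\<ge>length L. v j = 0)}"

definition dsB :: "('a set \<times> 'a set) list \<Rightarrow> (nat \<Rightarrow> 'a::zero) set" where
  "dsB L = {v. (\<forall>j<length L. v j \<in> snd (L ! j)) \<and> (\<forall>j\<ge>length L. v j = 0)}"

section \<open>Isomorphism of subquotients Z1/B1 and Z2/B2 as k-vector spaces\<close>

definition sq_iso :: "('k \<Rightarrow> 'a \<Rightarrow> 'a) \<Rightarrow> ('k \<Rightarrow> 'b \<Rightarrow> 'b) \<Rightarrow> 'a::ab_group_add set \<Rightarrow> 'a set
     \<Rightarrow> 'b::ab_group_add set \<Rightarrow> 'b set \<Rightarrow> bool" where
  "sq_iso s1 s2 Z1 B1 Z2 B2 \<longleftrightarrow> (\<exists>f.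
      (\<forall>x\<in>Z1. f x \<in> Z2) \<and>
      (\<forall>x\<in>Z1. \<forall>y\<in>Z1. f (x + y) = f x + f y) \<and>
      (\<forall>c. \<forall>x\<in>Z1. f (s1 c x) = s2 c (f x)) \<and>
      (\<forall>z\<in>Z2. \<exists>x\<in>Z1. z - f x \<in> B2) \<and>
      (\<forall>x\<in>Z1. f x \<in> B2 \<longleftrightarrow> x \<in> B1))"

definition gsm :: "('m \<Rightarrow> 'g \<Rightarrow> 'm) \<Rightarrow> ('k \<Rightarrow> 'g) \<Rightarrow> 'k \<Rightarrow> (int \<Rightarrow> 'm \<Rightarrow> 'm) \<Rightarrow> int \<Rightarrow> 'm \<Rightarrow> 'm" where
  "gsm act alg c f = (\<lambda>t x. ms act alg c (f t x))"

definition Tsm :: "('m \<Rightarrow> 'g \<Rightarrow> 'm) \<Rightarrow> ('k \<Rightarrow> 'g) \<Rightarrow> 'k \<Rightarrow> (int \<Rightarrow> 'm \<Rightarrow> 'm) \<times> (int \<Rightarrow> 'm \<Rightarrow> 'm)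
     \<Rightarrow> (int \<Rightarrow> 'm \<Rightarrow> 'm) \<times> (int \<Rightarrow> 'm \<Rightarrow> 'm)" where
  "Tsm act alg c p = (gsm act alg c (fst p), gsm act alg c (snd p))"

definition dssm :: "('m \<Rightarrow> 'g \<Rightarrow> 'm) \<Rightarrow> ('k \<Rightarrow> 'g) \<Rightarrow> 'k \<Rightarrow> (nat \<Rightarrow> 'm \<Rightarrow> 'm) \<Rightarrow> nat \<Rightarrow> 'm \<Rightarrow> 'm" where
  "dssm act alg c v = (\<lambda>j x. ms act alg c (v j x))"

end

theory Submission
  imports Defs HOL.Vector_Spaces
begin

text \<open>
  Restricting an element \<open>(x, y)\<close> of the trivial extension algebra to the \<open>0\<close>-th copy of the finite
  complex is a surjective chain map onto its endomorphism complex: an \<open>x\<close> that commutes with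
  \<open>\<sigma>\<close> up to sign and vanishes on the \<open>0\<close>-th copy is uniquely \<open>y' \<circ> \<sigma>\<close>, so the kernel is acyclic.

  For the endomorphism complex, put \<open>R = (0 \<rightarrow> M \<rightarrow> P_(n-1) \<rightarrow> ... \<rightarrow> P_0 \<rightarrow> M \<rightarrow> 0)\<close>, which is exact, so the
  complex of homomorphisms into \<open>R\<close> is acyclic.  This shows that composition with \<open>\<alpha>\<close> maps
  \<open>H^i\<close> onto the cohomology of \<open>Hom(P, M)\<close> in degree \<open>i\<close> with kernel the image, under composition with
  \<open>\<beta>\<close>, of the cohomology of \<open>Hom(P, M)\<close> in degree \<open>n-1+i\<close>, on which that map is injective.  The two
  contributions meet only in degree \<open>0\<close>, where the extension is split over the field.  In degrees below
  \<open>n-1\<close> the cohomology of \<open>Hom(P, M)\<close> is Ext, computed from the periodic resolution; in degree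
  \<open>n-1\<close> it is an extension of the image of composition with \<open>d_0\<close> by Ext.
\<close>

section \<open>Isomorphisms of subquotients\<close>

text \<open>\<open>sq_iso\<close> asks for one linear map on cocycles that induces the isomorphism,
  not merely for a map of quotients. Inverting such a map, or splitting an extension, therefore
  needs representatives chosen linearly; a basis over the field \<open>k\<close> provides them.

  Both halves of the computation for endomorphisms use one mechanism. A family of maps out of P is
  completed by components into the two copies of M in R until it is a cocycle of Hom(P, R).
  Contracting that cocycle and then discarding the components into the copies of M leaves an
  endomorphism of P; the discarded components are the error terms, and they give the cohomology of
  Hom(P, M).

  On the side of the trivial extension, the signs (-1)^(l n) in the periodic differential are
  exactly those that make \<sigma> a cocycle of degree n, so that right multiplication by \<sigma>
  is an injective chain map.

  Homomorphisms are functions on the whole ambient module that vanish off their domain. Equations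
  between them are thus proved at every point, and points off the domain often need a separate,
  trivial case.\<close>

lemma linear_selection:
  fixes s1 :: "'k::field \<Rightarrow> 'a::ab_group_add \<Rightarrow> 'a" and s2 :: "'k \<Rightarrow> 'b::ab_group_add \<Rightarrow> 'b"
  assumes vs: "vector_space s1" "vector_space s2"
    and Z: "module.subspace s1 Z"
    and add: "\<And>x y x' y'. r x y \<Longrightarrow> r x' y' \<Longrightarrow> r (x + x') (y + y')"
    and scale: "\<And>c x y. r x y \<Longrightarrow> r (s1 c x) (s2 c y)"
    and total: "\<And>x. x \<in> Z \<Longrightarrow> \<exists>y. r x y"
  obtains f where "\<And>x y. f (x + y) = f x + f y" "\<And>c x. f (s1 c x) = s2 c (f x)"
    "\<And>x. x \<in> Z \<Longrightarrow> r x (f x)"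
proof -
  interpret vector_space_pair s1 s2
    using vs by (simp add: vector_space_pair_def)
  obtain B where B: "B \<subseteq> Z" "vs1.independent B" "Z \<subseteq> vs1.span B"
    by (rule vs1.maximal_independent_subset)
  obtain b where b: "\<And>x. x \<in> Z \<Longrightarrow> r x (b x)"
    using total by metis
  \<comment> \<open>Only the values on the basis are taken from the relation. Closure of
    \<open>r\<close> under sums and multiples then spreads it along the span, which contains
    \<open>Z\<close>.\<close>
  obtain g where g: "Vector_Spaces.linear s1 s2 g" "\<And>x. x \<in> B \<Longrightarrow> g x = b x"
    using linear_independent_extend[OF B(2)] by blast
  interpret g: Vector_Spaces.linear s1 s2 g by (rule g(1))
  have r0: "r 0 0"
    using scale[OF b[OF vs1.subspace_0[OF Z]], of 0] by simp
  have "r x (g x)" if "x \<in> Z" for x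
  proof -
    have "x \<in> vs1.span B" using that B(3) by blast
    then show ?thesis
    proof (induction rule: vs1.span_induct_alt)
      case base
      then show ?case using r0 by (simp add: g.zero)
    next
      case (step c x y)
      have "r x (g x)" using step(1) b g(2) B(1) by (metis subsetD)
      then show ?case
        using add[OF scale step(2)] by (simp add: g.add g.scale)
    qed
  qed
  then show thesis using that[of g] g.add g.scale by blast
qed

lemma sq_iso_trans:
  assumes f: "sq_iso s1 s2 Z1 B1 Z2 B2" and g: "sq_iso s2 s3 Z2 B2 Z3 B3"
    and B2: "B2 \<subseteq> Z2" and B3: "\<And>x y. x \<in> B3 \<Longrightarrow> y \<in> B3 \<Longrightarrow> x + y \<in> B3"
  shows "sq_iso s1 s3 Z1 B1 Z3 B3"
proof -
  obtain f where f: "\<And>x. x\<in>Z1 \<Longrightarrow> f x \<in> Z2"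
      "\<And>x y. x\<in>Z1 \<Longrightarrow> y\<in>Z1 \<Longrightarrow> f (x + y) = f x + f y"
      "\<And>c x. x\<in>Z1 \<Longrightarrow> f (s1 c x) = s2 c (f x)"
      "\<And>z. z\<in>Z2 \<Longrightarrow> \<exists>x\<in>Z1. z - f x \<in> B2"
      "\<And>x. x\<in>Z1 \<Longrightarrow> f x \<in> B2 \<longleftrightarrow> x \<in> B1"
    using f unfolding sq_iso_def by blast
  obtain g where g: "\<And>x. x\<in>Z2 \<Longrightarrow> g x \<in> Z3"
      "\<And>x y. x\<in>Z2 \<Longrightarrow> y\<in>Z2 \<Longrightarrow> g (x + y) = g x + g y"
      "\<And>c x. x\<in>Z2 \<Longrightarrow> g (s2 c x) = s3 c (g x)"
      "\<And>z. z\<in>Z3 \<Longrightarrow> \<exists>x\<in>Z2. z - g x \<in> B3"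
      "\<And>x. x\<in>Z2 \<Longrightarrow> g x \<in> B3 \<longleftrightarrow> x \<in> B2"
    using g unfolding sq_iso_def by blast
  have "\<exists>x\<in>Z1. z - g (f x) \<in> B3" if z: "z \<in> Z3" for z
  proof -
    obtain y where y: "y \<in> Z2" "z - g y \<in> B3" using g(4)[OF z] by blast
    obtain x where x: "x \<in> Z1" "y - f x \<in> B2" using f(4)[OF y(1)] by blast
    have "g ((y - f x) + f x) = g (y - f x) + g (f x)"
      using x B2 f(1) by (intro g(2)) auto
    moreover have "g (y - f x) \<in> B3" using x B2 g(5) by blast
    ultimately have "z - g (f x) = (z - g y) + g (y - f x)" "g (y - f x) \<in> B3"
      by (simp_all add: algebra_simps)
    then show ?thesis using B3 y(2) x(1) by metis
  qed
  then show ?thesis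
    unfolding sq_iso_def using f g by (intro exI[of _ "\<lambda>x. g (f x)"]) (auto)
qed

text \<open>The inverse exists on quotients; what has to be produced is a linear map on
  \<open>Z2\<close> representing it. The relation "y - f x lies in \<open>B2\<close>" is linear and
  total on \<open>Z2\<close>, so \<open>linear_selection\<close> applies.\<close>

lemma sq_iso_sym:
  fixes s1 :: "'k::field \<Rightarrow> 'a::ab_group_add \<Rightarrow> 'a" and s2 :: "'k \<Rightarrow> 'b::ab_group_add \<Rightarrow> 'b"
  assumes vs: "vector_space s1" "vector_space s2"
    and sub: "module.subspace s1 Z1" "module.subspace s2 Z2" "module.subspace s2 B2"
    and iso: "sq_iso s1 s2 Z1 B1 Z2 B2" and B1: "0 \<in> B1" "\<And>x y. x \<in> B1 \<Longrightarrow> y \<in> B1 \<Longrightarrow> x - y \<in> B1"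
  shows "sq_iso s2 s1 Z2 B2 Z1 B1"
proof -
  interpret v1: vector_space s1 by fact
  interpret v2: vector_space s2 by fact
  obtain f where f: "\<And>x. x\<in>Z1 \<Longrightarrow> f x \<in> Z2"
      "\<And>x y. x\<in>Z1 \<Longrightarrow> y\<in>Z1 \<Longrightarrow> f (x + y) = f x + f y"
      "\<And>c x. x\<in>Z1 \<Longrightarrow> f (s1 c x) = s2 c (f x)"
      "\<And>z. z\<in>Z2 \<Longrightarrow> \<exists>x\<in>Z1. z - f x \<in> B2"
      "\<And>x. x\<in>Z1 \<Longrightarrow> f x \<in> B2 \<longleftrightarrow> x \<in> B1"
    using iso unfolding sq_iso_def by blast
  define r where "r y x \<longleftrightarrow> y \<in> Z2 \<and> x \<in> Z1 \<and> y - f x \<in> B2" for y x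
  have radd: "r (y + y') (x + x')" if "r y x" "r y' x'" for x y x' y'
  proof -
    have "(y - f x) + (y' - f x') \<in> B2" using that v2.subspace_add[OF sub(3)] by (simp add: r_def)
    then show ?thesis using that
      by (auto simp: r_def f(2) v1.subspace_add[OF sub(1)] v2.subspace_add[OF sub(2)] algebra_simps)
  qed
  have rsc: "r (s2 c y) (s1 c x)" if "r y x" for c x y
  proof -
    have "s2 c (y - f x) \<in> B2" using that v2.subspace_scale[OF sub(3)] by (simp add: r_def)
    then show ?thesis using that
      by (auto simp: r_def f(3) v1.subspace_scale[OF sub(1)] v2.subspace_scale[OF sub(2)]
            v2.scale_right_diff_distrib)
  qed
  have "\<exists>x. r y x" if "y \<in> Z2" for y
    using f(4)[OF that] that by (auto simp: r_def)
  then obtain g where g: "\<And>x y. g (x + y) = g x + g y" "\<And>c x. g (s2 c x) = s1 c (g x)"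
      "\<And>x. x \<in> Z2 \<Longrightarrow> r x (g x)"
    using linear_selection[of s2 s1 Z2 r, OF vs(2,1) sub(2) radd rsc] by blast
  have rB: "y \<in> B2 \<longleftrightarrow> x \<in> B1" if "r y x" for x y
  proof -
    have "y - f x \<in> B2" using that by (simp add: r_def)
    then have "y \<in> B2 \<longleftrightarrow> f x \<in> B2"
      using v2.subspace_add[OF sub(3), of "y - f x" "f x"] v2.subspace_diff[OF sub(3), of y "y - f x"]
      by auto
    then show ?thesis using f(5) that by (simp add: r_def)
  qed
  have surj: "\<exists>y\<in>Z2. x - g y \<in> B1" if x: "x \<in> Z1" for x
  proof -
    have r1: "r (f x) x" using x f(1) v2.subspace_0[OF sub(3)] by (simp add: r_def)
    have r2: "r (f x) (g (f x))" using g(3) f(1) x by blast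
    have "r (s2 (-1) (f x)) (s1 (-1) (g (f x)))" by (rule rsc[OF r2])
    from radd[OF r1 this] have "r 0 (x - g (f x))" by simp
    then have "x - g (f x) \<in> B1" using rB v2.subspace_0[OF sub(3)] by blast
    then show ?thesis using f(1) x by blast
  qed
  have gZ: "g y \<in> Z1" if "y \<in> Z2" for y using g(3)[OF that] by (simp add: r_def)
  have gB: "g y \<in> B1 \<longleftrightarrow> y \<in> B2" if "y \<in> Z2" for y using rB[OF g(3)[OF that]] by simp
  show ?thesis unfolding sq_iso_def
    by (intro exI[of _ g] conjI ballI allI gZ gB surj g(1,2))
qed

text \<open>An extension of vector spaces splits: a linear section of \<open>p\<close> identifies
  \<open>Z1 / B1\<close> with the direct sum of \<open>ker p / B1\<close> and \<open>Z3\<close>. The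
  quotient becomes a new last summand with zero boundaries because \<open>p\<close> kills
  \<open>B1\<close>.\<close>

lemma sq_iso_dsum_snoc:
  fixes s1 :: "'k::field \<Rightarrow> 'a::ab_group_add \<Rightarrow> 'a" and s2 :: "'k \<Rightarrow> 'b::ab_group_add \<Rightarrow> 'b"
  assumes vs: "vector_space s1" "vector_space s2"
    and sub: "module.subspace s1 Z1" "module.subspace s2 Z3"
    and p: "\<And>x. x \<in> Z1 \<Longrightarrow> p x \<in> Z3" "\<And>x y. x \<in> Z1 \<Longrightarrow> y \<in> Z1 \<Longrightarrow> p (x + y) = p x + p y"
      "\<And>c x. x \<in> Z1 \<Longrightarrow> p (s1 c x) = s2 c (p x)"
      "\<And>z. z \<in> Z3 \<Longrightarrow> \<exists>x\<in>Z1. p x = z"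
    and B1: "\<And>x. x \<in> B1 \<Longrightarrow> x \<in> Z1 \<and> p x = 0"
    and iso: "sq_iso s1 (\<lambda>c v j. s2 c (v j)) {x \<in> Z1. p x = 0} B1 (dsZ L) (dsB L)"
  shows "sq_iso s1 (\<lambda>c v j. s2 c (v j)) Z1 B1 (dsZ (L @ [(Z3, {0})])) (dsB (L @ [(Z3, {0})]))"
proof -
  interpret v1: vector_space s1 by fact
  interpret v2: vector_space s2 by fact
  define K where "K = {x \<in> Z1. p x = 0}"
  obtain q where q: "\<And>x. x\<in>K \<Longrightarrow> q x \<in> dsZ L"
      "\<And>x y. x\<in>K \<Longrightarrow> y\<in>K \<Longrightarrow> q (x + y) = q x + q y"
      "\<And>c x. x\<in>K \<Longrightarrow> q (s1 c x) = (\<lambda>j. s2 c (q x j))"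
      "\<And>z. z\<in>dsZ L \<Longrightarrow> \<exists>x\<in>K. z - q x \<in> dsB L"
      "\<And>x. x\<in>K \<Longrightarrow> q x \<in> dsB L \<longleftrightarrow> x \<in> B1"
    using iso unfolding sq_iso_def K_def by blast
  define r where "r z x \<longleftrightarrow> x \<in> Z1 \<and> p x = z" for z x
  have radd: "r (y + y') (x + x')" if "r y x" "r y' x'" for x y x' y'
    using that by (auto simp: r_def p(2) v1.subspace_add[OF sub(1)])
  have rsc: "r (s2 c y) (s1 c x)" if "r y x" for c x y
    using that by (auto simp: r_def p(3) v1.subspace_scale[OF sub(1)])
  have "\<exists>x. r y x" if "y \<in> Z3" for y
    using p(4)[OF that] that by (auto simp: r_def)
  then obtain s where s: "\<And>x y. s (x + y) = s x + s y" "\<And>c x. s (s2 c x) = s1 c (s x)"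
      "\<And>x. x \<in> Z3 \<Longrightarrow> r x (s x)"
    using linear_selection[of s2 s1 Z3 r, OF vs(2,1) sub(2) radd rsc] by blast
  have s0: "s 0 = 0" using s(1)[of 0 0] by simp
  \<comment> \<open>\<open>e\<close> is the projection of \<open>Z1\<close> onto the kernel of
    \<open>p\<close> along the section \<open>s\<close>.\<close>
  define e where "e x = x - s (p x)" for x
  have pdiff: "p (x - y) = p x - p y" if "x \<in> Z1" "y \<in> Z1" for x y
    using p(2)[of "x - y" y] that v1.subspace_diff[OF sub(1)] by (auto simp: algebra_simps)
  have eK: "e x \<in> K" if "x \<in> Z1" for x
    using s(3)[OF p(1)[OF that]] that by (auto simp: K_def e_def r_def pdiff v1.subspace_diff[OF sub(1)])
  have eadd: "e (x + y) = e x + e y" if "x \<in> Z1" "y \<in> Z1" for x y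
    using that by (simp add: e_def p(2) s(1))
  have esc: "e (s1 c x) = s1 c (e x)" if "x \<in> Z1" for c x
    using that by (simp add: e_def p(3) s(2) v1.scale_right_diff_distrib)
  define l where "l = length L"
  \<comment> \<open>Slot \<open>l\<close> lies just past the summands in \<open>L\<close>, where
    elements of \<open>dsZ L\<close> vanish, so overwriting it loses nothing.\<close>
  define F where "F x = (q (e x))(l := p x)" for x
  have dsZ: "dsZ (L @ [(Z3, {0})]) = {v. v(l := 0) \<in> dsZ L \<and> v l \<in> Z3}"
    unfolding dsZ_def l_def by (auto simp: nth_append less_Suc_eq Suc_le_eq)
  have dsB: "dsB (L @ [(Z3, {0})]) = {v. v(l := 0) \<in> dsB L \<and> v l = 0}"
    unfolding dsB_def l_def by (auto simp: nth_append less_Suc_eq Suc_le_eq)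
  have ql: "q x l = 0" if "x \<in> K" for x using q(1)[OF that] by (simp add: dsZ_def l_def)
  have F0: "(F x)(l := 0) = q (e x)" if "x \<in> Z1" for x
    using ql[OF eK[OF that]] by (auto simp: F_def)
  have Fl: "F x l = p x" for x by (simp add: F_def)
  show ?thesis unfolding sq_iso_def
  proof (intro exI[of _ F] conjI ballI allI)
    fix x assume x: "x \<in> Z1"
    show "F x \<in> dsZ (L @ [(Z3, {0})])"
      unfolding dsZ using x by (simp add: F0 Fl p(1) q(1)[OF eK])
    show "F (x + y) = F x + F y" if y: "y \<in> Z1" for y
      using x y by (auto simp: F_def eadd q(2) eK p(2) fun_eq_iff)
    show "F (s1 c x) = (\<lambda>j. s2 c (F x j))" for c
      using x by (auto simp: F_def esc q(3) eK p(3) fun_eq_iff)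
    show "F x \<in> dsB (L @ [(Z3, {0})]) \<longleftrightarrow> x \<in> B1"
      using x B1 q(5)[OF eK[OF x]] by (auto simp: dsB F0 Fl e_def s0)
  next
    fix v assume v: "v \<in> dsZ (L @ [(Z3, {0})])"
    obtain k where k: "k \<in> K" "v(l := 0) - q k \<in> dsB L"
      using q(4) v by (auto simp: dsZ)
    have sv: "s (v l) \<in> Z1" "p (s (v l)) = v l"
      using v s(3) by (auto simp: dsZ r_def)
    define x where "x = k + s (v l)"
    have x: "x \<in> Z1" "p x = v l" "e x = k"
      using k sv by (auto simp: x_def K_def e_def p(2) v1.subspace_add[OF sub(1)])
    have "(v - F x)(l := 0) = v(l := 0) - q k"
      using x ql[OF k(1)] by (auto simp: F_def fun_eq_iff)
    then show "\<exists>x\<in>Z1. v - F x \<in> dsB (L @ [(Z3, {0})])"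
      using k x by (intro bexI[of _ x]) (auto simp: dsB Fl)
  qed
qed

lemma sq_iso_dsum_singleton:
  assumes "sq_iso s1 s2 Z1 B1 Z2 B2" and "\<And>c. s2 c 0 = 0"
  shows "sq_iso s1 (\<lambda>c v j. s2 c (v j)) Z1 B1 (dsZ [(Z2, B2)]) (dsB [(Z2, B2)])"
proof -
  obtain f where f: "\<And>x. x\<in>Z1 \<Longrightarrow> f x \<in> Z2"
      "\<And>x y. x\<in>Z1 \<Longrightarrow> y\<in>Z1 \<Longrightarrow> f (x + y) = f x + f y"
      "\<And>c x. x\<in>Z1 \<Longrightarrow> f (s1 c x) = s2 c (f x)"
      "\<And>z. z\<in>Z2 \<Longrightarrow> \<exists>x\<in>Z1. z - f x \<in> B2"
      "\<And>x. x\<in>Z1 \<Longrightarrow> f x \<in> B2 \<longleftrightarrow> x \<in> B1"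
    using assms(1) unfolding sq_iso_def by blast
  have "\<exists>x\<in>Z1. z - (\<lambda>j. if j = 0 then f x else 0) \<in> dsB [(Z2, B2)]" if "z \<in> dsZ [(Z2, B2)]" for z
    using f(4)[of "z 0"] that by (auto simp: dsB_def dsZ_def)
  then show ?thesis using f assms(2) unfolding sq_iso_def
    by (intro exI[of _ "\<lambda>x j. if j = 0 then f x else 0"]) (auto simp: dsB_def dsZ_def fun_eq_iff)
qed

section \<open>Module homomorphisms and the lifting property\<close>

lemma isgn_0 [simp]: "isgn e 0 = 0"
  by (simp add: isgn_def)

lemma isgn_even: "even e \<Longrightarrow> isgn e x = x"
  by (simp add: isgn_def)

lemma isgn_isgn: "isgn a (isgn b x) = isgn (a + b) x"
  by (auto simp: isgn_def)

lemma isgn_self [simp]: "isgn a (isgn a x) = x"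
  by (auto simp: isgn_def)

lemma isgn_add: "isgn a (x + y) = isgn a x + isgn a y"
  by (auto simp: isgn_def)

lemma isgn_diff: "isgn a (x - y) = isgn a x - isgn a y"
  by (auto simp: isgn_def)

lemma isgn_plus_1: "isgn (a + 1) x = - isgn a x"
  by (auto simp: isgn_def)

lemma isgn_minus_1: "isgn (a - 1) x = - isgn a x"
  by (auto simp: isgn_def)

lemma isgn_eq_0_iff [simp]: "isgn a x = 0 \<longleftrightarrow> x = 0"
  by (auto simp: isgn_def)

lemma isgn_cong: "even (a - b) \<Longrightarrow> isgn a x = isgn b x"
  by (auto simp: isgn_def)

lemma isgn_apply: "isgn a f x = isgn a (f x)"
  by (simp add: isgn_def)

lemma modhom_0: "modhom act A B f \<Longrightarrow> f (0::'m::ab_group_add) = 0"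
  unfolding modhom_def by (metis add_cancel_left_right)

lemma modhom_add: "modhom act A B f \<Longrightarrow> x \<in> A \<Longrightarrow> y \<in> A \<Longrightarrow> f (x + y) = f x + f y"
  by (simp add: modhom_def)

lemma modhom_in: "modhom act A B f \<Longrightarrow> x \<in> A \<Longrightarrow> f x \<in> B"
  by (simp add: modhom_def)

lemma modhom_out: "modhom act A B f \<Longrightarrow> x \<notin> A \<Longrightarrow> f x = 0"
  by (simp add: modhom_def)

lemma submod_0: "submod act A \<Longrightarrow> 0 \<in> A"
  by (simp add: submod_def)

lemma submod_add: "submod act A \<Longrightarrow> x \<in> A \<Longrightarrow> y \<in> A \<Longrightarrow> x + y \<in> A"
  by (simp add: submod_def)

lemma submod_minus: "submod act A \<Longrightarrow> x \<in> A \<Longrightarrow> - x \<in> A"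
  by (simp add: submod_def)

lemma submod_diff: "submod act A \<Longrightarrow> x \<in> A \<Longrightarrow> y \<in> A \<Longrightarrow> x - y \<in> A"
  using submod_add[of act A x "- y"] submod_minus by auto

lemma submod_isgn: "submod act A \<Longrightarrow> x \<in> A \<Longrightarrow> isgn e x \<in> A"
  by (simp add: isgn_def submod_minus)

lemma submod_minus_iff: "submod act A \<Longrightarrow> - x \<in> A \<longleftrightarrow> x \<in> A"
  using submod_minus[of act A x] submod_minus[of act A "- x"] by auto

lemma modhom_in_submod: "modhom act A B f \<Longrightarrow> submod act B \<Longrightarrow> f x \<in> B"
  by (metis modhom_in modhom_out submod_0)

lemma modhom_minus:
  assumes "modhom act A B f" "submod act A" shows "f (- x) = - f x"
proof (cases "x \<in> A")
  case True
  then have "f (x + - x) = f x + f (- x)" using assms by (intro modhom_add) (auto simp: submod_minus)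
  then show ?thesis using modhom_0[OF assms(1)] by (simp add: minus_unique)
next
  case False
  then show ?thesis using assms by (metis modhom_out neg_equal_0_iff_equal submod_minus_iff)
qed

lemma modhom_diff:
  assumes "modhom act A B f" "submod act A" "x \<in> A" "y \<in> A" shows "f (x - y) = f x - f y"
  using modhom_add[OF assms(1,3), of "- y"] modhom_minus[OF assms(1,2)] submod_minus[OF assms(2,4)] by simp

lemma modhom_isgn:
  assumes "modhom act A B f" "submod act A" shows "f (isgn e x) = isgn e (f x)"
  using modhom_minus[OF assms] by (auto simp: isgn_def)

lemma modhom_into_zero: "modhom act A {0} f \<Longrightarrow> f x = 0"
  by (cases "x \<in> A") (auto simp: modhom_def)

lemma modhom_from_zero: "modhom act {0} B f \<Longrightarrow> f x = 0"
  using modhom_0[of act "{0}" B f] modhom_out[of act "{0}" B f x] by (cases "x = 0") auto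

lemma modhom_comp:
  assumes "modhom act A B f" "modhom act B C g" shows "modhom act A C (\<lambda>x. g (f x))"
  using assms modhom_0[OF assms(2)] by (auto simp: modhom_def)

lemma modhom_subset: "modhom act A B f \<Longrightarrow> (\<And>x. x \<in> A \<Longrightarrow> f x \<in> B') \<Longrightarrow> modhom act A B' f"
  by (auto simp: modhom_def)

locale right_mod =
  fixes act :: "'m::ab_group_add \<Rightarrow> 'g::ring_1 \<Rightarrow> 'm"
  assumes right_module: "right_module act"
begin

lemma act_add: "act (x + y) r = act x r + act y r"
  using right_module by (auto simp: right_module_def)

lemma act_add_right: "act x (r + s) = act x r + act x s"
  using right_module by (auto simp: right_module_def)

lemma act_act: "act (act x r) s = act x (r * s)"
  using right_module by (auto simp: right_module_def)

lemma act_1 [simp]: "act x 1 = x"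
  using right_module by (auto simp: right_module_def)

lemma act_0 [simp]: "act 0 r = 0"
  using act_add[of 0 0 r] by simp

lemma act_0_right [simp]: "act x 0 = 0"
  using act_add_right[of x 0 0] by simp

lemma act_minus: "act (- x) r = - act x r"
  using act_add[of x "- x" r] by (simp add: minus_unique)

lemma act_diff: "act (x - y) r = act x r - act y r"
  using act_add[of x "- y" r] by (simp add: act_minus)

lemma act_isgn: "act (isgn e x) r = isgn e (act x r)"
  by (simp add: isgn_def act_minus)

lemma submod_zero: "submod act {0}"
  by (simp add: submod_def)

lemma modhom_zero: "submod act B \<Longrightarrow> modhom act A B (\<lambda>x. 0)"
  by (simp add: modhom_def submod_0)

lemma modhom_plus:
  assumes "modhom act A B f" "modhom act A B g" "submod act B"
  shows "modhom act A B (\<lambda>x. f x + g x)"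
  using assms by (auto simp: modhom_def submod_add act_add)

lemma modhom_sub:
  assumes "modhom act A B f" "modhom act A B g" "submod act B"
  shows "modhom act A B (\<lambda>x. f x - g x)"
  using assms by (auto simp: modhom_def submod_diff act_diff)

lemma modhom_isgn_comp:
  assumes "modhom act A B f" "submod act B"
  shows "modhom act A B (\<lambda>x. isgn e (f x))"
  using assms by (auto simp: modhom_def submod_isgn isgn_add act_isgn)

lemma modhom_uminus:
  assumes "modhom act A B f" "submod act B"
  shows "modhom act A B (\<lambda>x. - f x)"
  using modhom_isgn_comp[OF assms, of 1] by (simp add: isgn_def)

lemma submod_kernel:
  assumes "modhom act A B f" "submod act A"
  shows "submod act {x \<in> A. f x = 0}"
  using assms modhom_minus[OF assms] modhom_0[OF assms(1)]
  by (auto simp: submod_def modhom_def)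

end

text \<open>The common consequence of both notions of projectivity. Submodules of the one ambient
  module suffice as test objects, since all targets below are terms of complexes or kernels inside
  it.\<close>

definition lifting :: "('m::ab_group_add \<Rightarrow> 'g::ring_1 \<Rightarrow> 'm) \<Rightarrow> 'm set \<Rightarrow> bool" where
  "lifting act P \<longleftrightarrow> submod act P \<and> (\<forall>A B g f. submod act A \<longrightarrow> submod act B \<longrightarrow> modhom act A B g \<longrightarrow>
     g ` A = B \<longrightarrow> modhom act P B f \<longrightarrow> (\<exists>h. modhom act P A h \<and> (\<forall>x. g (h x) = f x)))"

section \<open>Summands of free modules have the lifting property\<close>

context right_mod
begin

lemma submod_sum: "submod act A \<Longrightarrow> (\<And>i. i \<in> S \<Longrightarrow> f i \<in> A) \<Longrightarrow> sum f S \<in> A"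
  by (induction S rule: infinite_finite_induct) (auto simp: submod_0 submod_add)

lemma modhom_sum:
  assumes "modhom act A B g" "submod act A" "\<And>i. i \<in> S \<Longrightarrow> f i \<in> A"
  shows "g (sum f S) = (\<Sum>i\<in>S. g (f i))"
  using assms(3)
  by (induction S rule: infinite_finite_induct)
     (auto simp: modhom_0[OF assms(1)] modhom_add[OF assms(1)] submod_sum[OF assms(2)])

text \<open>Peeling off one coordinate at a time shows that a linear map on a free module is
  determined by its values on unit vectors.\<close>

lemma free_mod_sum:
  fixes v :: "'i \<Rightarrow> 'g"
  assumes radd: "\<And>v w. v \<in> free_mod I \<Longrightarrow> w \<in> free_mod I \<Longrightarrow> r (v + w) = r v + (r w :: 'm)"
    and rsc: "\<And>v g. v \<in> free_mod I \<Longrightarrow> r (\<lambda>j. v j * g) = act (r v) g"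
    and S: "finite S" "S \<subseteq> I" and v: "{j. v j \<noteq> 0} \<subseteq> S"
  shows "r v = (\<Sum>i\<in>S. act (r (\<lambda>j. if j = i then 1 else 0)) (v i))"
  using S v
proof (induction S arbitrary: v rule: finite_induct)
  case empty
  have "(0 :: 'i \<Rightarrow> 'g) \<in> free_mod I" by (simp add: free_mod_def)
  from radd[OF this this] have "r 0 = 0" by simp
  moreover have "v = 0" using empty by auto
  ultimately show ?case by (simp add: zero_fun_def)
next
  case (insert a S)
  define b where "b = (\<lambda>j. if j = a then 1 else (0::'g))"
  have b: "b \<in> free_mod I" using insert by (auto simp: free_mod_def b_def)
  have "{j. (if j = a then v a else 0) \<noteq> 0} \<subseteq> {a}" by auto
  then have bv: "(\<lambda>j. b j * v a) \<in> free_mod I"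
    using insert by (auto simp: free_mod_def b_def if_distrib cong: if_cong intro: finite_subset)
  have v': "{j. (v(a := 0)) j \<noteq> 0} \<subseteq> S" using insert by auto
  then have "v(a := 0) \<in> free_mod I" using insert
    by (auto simp: free_mod_def split: if_splits intro: finite_subset)
  then have "r ((\<lambda>j. b j * v a) + v(a := 0)) = act (r b) (v a) + r (v(a := 0))"
    by (simp add: radd bv rsc[OF b])
  moreover have "(\<lambda>j. b j * v a) + v(a := 0) = v" by (auto simp: b_def)
  moreover have "r (v(a := 0)) = (\<Sum>i\<in>S. act (r (\<lambda>j. if j = i then 1 else 0)) ((v(a := 0)) i))"
    using insert.prems by (intro insert.IH[OF _ v']) auto
  moreover have "\<dots> = (\<Sum>i\<in>S. act (r (\<lambda>j. if j = i then 1 else 0)) (v i))"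
    using insert.hyps by (intro sum.cong) auto
  ultimately show ?case using insert by (simp add: b_def)
qed

text \<open>Preimages \<open>a i\<close> of the images of the unit vectors extend linearly to a map
  \<open>H\<close> on the free module with \<open>g (H v) = f (r v)\<close>. Precomposing with the
  embedding \<open>e\<close> gives the lift, because \<open>r (e x) = x\<close>.\<close>

lemma summand_of_free_lifting:
  assumes sm: "submod act P" and "summand_of_free act (I :: 'i set) P"
  shows "lifting act P"
  unfolding lifting_def
proof (intro conjI allI impI sm)
  fix A B g f
  assume A: "submod act A" and B: "submod act B" and g: "modhom act A B g" and gA: "g ` A = B"
    and f: "modhom act P B f"
  obtain e r where er: "\<forall>x\<in>P. e x \<in> free_mod I"
      "\<forall>x\<in>P. \<forall>y\<in>P. e (x + y) = e x + e y"
      "\<forall>x\<in>P. \<forall>g. e (act x g) = (\<lambda>j. e x j * g)"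
      "\<forall>v\<in>free_mod I. r v \<in> P"
      "\<forall>v\<in>free_mod I. \<forall>w\<in>free_mod I. r (v + w) = r v + r w"
      "\<forall>v\<in>free_mod I. \<forall>g. r (\<lambda>j. v j * g) = act (r v) g"
      "\<forall>x\<in>P. r (e x) = x"
    using assms(2) unfolding summand_of_free_def by (elim exE conjE) (rule that)
  note e = er(1)[rule_format] er(2)[rule_format] er(3)[rule_format]
    and r = er(4)[rule_format] er(5)[rule_format] er(6)[rule_format] and re = er(7)[rule_format]
  define u where "u i = (\<lambda>j. if j = i then 1 else (0::'g))" for i :: 'i
  have u: "u i \<in> free_mod I" if "i \<in> I" for i using that by (auto simp: u_def free_mod_def)
  have "\<exists>a\<in>A. g a = f (r (u i))" if "i \<in> I" for i
    using modhom_in[OF f r(1)[OF u[OF that]]] gA by (auto simp: image_iff)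
  then obtain a where a: "\<And>i. i \<in> I \<Longrightarrow> a i \<in> A" "\<And>i. i \<in> I \<Longrightarrow> g (a i) = f (r (u i))"
    by metis
  define H where "H v = (\<Sum>i | v i \<noteq> 0. act (a i) (v i))" for v
  have HS: "H v = (\<Sum>i\<in>S. act (a i) (v i))" if "finite S" "{j. v j \<noteq> 0} \<subseteq> S" for v S
    unfolding H_def using that by (intro sum.mono_neutral_left) auto
  have Hadd: "H (v + w) = H v + H w" if "v \<in> free_mod I" "w \<in> free_mod I" for v w
  proof -
    define S where "S = {j. v j \<noteq> 0} \<union> {j. w j \<noteq> 0}"
    have "finite S" "{j. v j \<noteq> 0} \<subseteq> S" "{j. w j \<noteq> 0} \<subseteq> S" "{j. (v + w) j \<noteq> 0} \<subseteq> S"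
      using that by (auto simp: S_def free_mod_def)
    then show ?thesis by (simp add: HS act_add_right sum.distrib)
  qed
  have Hsc: "H (\<lambda>j. v j * c) = act (H v) c" if "v \<in> free_mod I" for v c
  proof -
    define S where "S = {j. v j \<noteq> 0}"
    have S: "finite S" "{j. v j \<noteq> 0} \<subseteq> S" "{j. v j * c \<noteq> 0} \<subseteq> S"
      using that by (auto simp: S_def free_mod_def)
    have "act (sum h S) c = (\<Sum>i\<in>S. act (h i) c)" for h
      using S(1) by (induction S rule: finite_induct) (auto simp: act_add)
    then show ?thesis using S by (simp add: HS act_act)
  qed
  have HA: "H v \<in> A" if "v \<in> free_mod I" for v
    unfolding H_def using that a A by (intro submod_sum[OF A]) (auto simp: free_mod_def submod_def)
  have gH: "g (H v) = f (r v)" if v: "v \<in> free_mod I" for v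
  proof -
    define S where "S = {j. v j \<noteq> 0}"
    have S: "finite S" "S \<subseteq> I" "{j. v j \<noteq> 0} \<subseteq> S" using v by (auto simp: S_def free_mod_def)
    have "g (H v) = (\<Sum>i\<in>S. g (act (a i) (v i)))"
      unfolding HS[OF S(1,3)] using S a A
      by (intro modhom_sum[OF g A]) (auto simp: submod_def)
    also have "\<dots> = (\<Sum>i\<in>S. f (act (r (u i)) (v i)))"
      using S a g f r(1)[OF u] by (intro sum.cong) (auto simp: modhom_def subset_iff)
    also have "\<dots> = f (\<Sum>i\<in>S. act (r (u i)) (v i))"
      using S sm r(1)[OF u] by (intro modhom_sum[OF f sm, symmetric]) (auto simp: submod_def)
    also have "(\<Sum>i\<in>S. act (r (u i)) (v i)) = r v"
      unfolding u_def by (rule free_mod_sum[symmetric, OF r(2,3) S]) auto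
    finally show ?thesis .
  qed
  define h where "h x = (if x \<in> P then H (e x) else 0)" for x
  have "modhom act P A h"
    unfolding modhom_def using sm
    by (auto simp: h_def HA e Hadd Hsc submod_def)
  moreover have "g (h x) = f x" for x
    using modhom_0[OF g] modhom_out[OF f] by (auto simp: h_def gH e re)
  ultimately show "\<exists>h. modhom act P A h \<and> (\<forall>x. g (h x) = f x)" by blast
qed

lemma projective_lifting: "projective act P \<Longrightarrow> lifting act P"
  unfolding projective_def using summand_of_free_lifting by blast

lemma fg_projective_lifting: "fg_projective act P \<Longrightarrow> lifting act P"
  unfolding fg_projective_def using summand_of_free_lifting by blast

end

section \<open>Projective resolutions and Ext\<close>

text \<open>\<open>gHom\<close> with separate source and target: the argument needs maps from a
  complex of projectives into an augmented, exact one.\<close>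

definition grHom :: "('m::ab_group_add \<Rightarrow> 'g \<Rightarrow> 'm) \<Rightarrow> (int \<Rightarrow> 'm set) \<Rightarrow> (int \<Rightarrow> 'm set) \<Rightarrow> int \<Rightarrow> (int \<Rightarrow> 'm \<Rightarrow> 'm) set" where
  "grHom act C R j = {f. \<forall>t. modhom act (C t) (R (t - j)) (f t)}"

definition hdiff :: "(int \<Rightarrow> 'm \<Rightarrow> 'm) \<Rightarrow> (int \<Rightarrow> 'm \<Rightarrow> 'm) \<Rightarrow> int \<Rightarrow> (int \<Rightarrow> 'm \<Rightarrow> 'm) \<Rightarrow> int \<Rightarrow> 'm \<Rightarrow> 'm::ab_group_add" where
  "hdiff DR DC j f = (\<lambda>t x. DR (t - j) (f t x) - isgn j (f (t - 1) (DC t x)))"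

definition cplx :: "('m::ab_group_add \<Rightarrow> 'g \<Rightarrow> 'm) \<Rightarrow> (int \<Rightarrow> 'm set) \<Rightarrow> (int \<Rightarrow> 'm \<Rightarrow> 'm) \<Rightarrow> bool" where
  "cplx act C D \<longleftrightarrow> (\<forall>t. submod act (C t) \<and> modhom act (C t) (C (t - 1)) (D t) \<and> (\<forall>x. D (t - 1) (D t x) = 0))"

definition exact_cplx :: "('m::ab_group_add \<Rightarrow> 'g \<Rightarrow> 'm) \<Rightarrow> (int \<Rightarrow> 'm set) \<Rightarrow> (int \<Rightarrow> 'm \<Rightarrow> 'm) \<Rightarrow> bool" where
  "exact_cplx act R D \<longleftrightarrow> (\<forall>t. submod act (R t) \<and> modhom act (R t) (R (t - 1)) (D t) \<and>
      D (t + 1) ` R (t + 1) = {x \<in> R t. D t x = 0})"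

text \<open>The augmented complex is obtained by two function updates: the resolved module goes into
  degree -1, and the augmentation becomes the differential leaving degree 0.\<close>

definition resolves :: "('m::ab_group_add \<Rightarrow> 'g::ring_1 \<Rightarrow> 'm) \<Rightarrow> (int \<Rightarrow> 'm set) \<Rightarrow> (int \<Rightarrow> 'm \<Rightarrow> 'm) \<Rightarrow> 'm set \<Rightarrow> ('m \<Rightarrow> 'm) \<Rightarrow> bool" where
  "resolves act C D M eps \<longleftrightarrow> cplx act C D \<and> (\<forall>t<0. C t = {0}) \<and> (\<forall>t\<ge>0. lifting act (C t)) \<and>
     exact_cplx act (C(-1 := M)) (D(0 := eps))"

definition HZ :: "('m::ab_group_add \<Rightarrow> 'g \<Rightarrow> 'm) \<Rightarrow> (int \<Rightarrow> 'm set) \<Rightarrow> (int \<Rightarrow> 'm \<Rightarrow> 'm) \<Rightarrow> 'm set \<Rightarrow> int \<Rightarrow> ('m \<Rightarrow> 'm) set" where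
  "HZ act C D M t = {\<phi> \<in> Hom act (C t) M. \<forall>x. \<phi> (D (t + 1) x) = 0}"

text \<open>No case distinction in degree 0 is made, in contrast to \<open>ExtB\<close>: for
  complexes that vanish in degree -1 the source of the image is already zero.\<close>

definition HB :: "('m::ab_group_add \<Rightarrow> 'g \<Rightarrow> 'm) \<Rightarrow> (int \<Rightarrow> 'm set) \<Rightarrow> (int \<Rightarrow> 'm \<Rightarrow> 'm) \<Rightarrow> 'm set \<Rightarrow> int \<Rightarrow> ('m \<Rightarrow> 'm) set" where
  "HB act C D M t = (\<lambda>\<phi> x. \<phi> (D t x)) ` Hom act (C (t - 1)) M"

lemma gHom_eq_grHom: "gHom act C j = grHom act C C j"
  by (simp add: gHom_def grHom_def)

lemma grHomD: "f \<in> grHom act C R j \<Longrightarrow> modhom act (C t) (R (t - j)) (f t)"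
  by (simp add: grHom_def)

lemma exact_cplx_square:
  assumes "exact_cplx act R D" shows "D (t - 1) (D t x) = 0"
proof (cases "x \<in> R t")
  case True
  have "D (t - 1 + 1) ` R (t - 1 + 1) = {x \<in> R (t - 1). D (t - 1) x = 0}"
    using assms unfolding exact_cplx_def by blast
  then show ?thesis using True by auto
next
  case False
  then show ?thesis using assms unfolding exact_cplx_def
    by (metis modhom_0 modhom_out)
qed

section \<open>Maps into exact complexes and the comparison of resolutions\<close>

context right_mod
begin

lemma lifting_exact:
  assumes R: "exact_cplx act R DR" and P: "lifting act P"
    and f: "modhom act P (R s) f" "\<And>x. DR s (f x) = 0"
  shows "\<exists>h. modhom act P (R (s + 1)) h \<and> (\<forall>x. DR (s + 1) (h x) = f x)"
proof -
  have R': "submod act (R s)" "submod act (R (s + 1))" "modhom act (R s) (R (s - 1)) (DR s)"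
      "modhom act (R (s + 1)) (R (s + 1 - 1)) (DR (s + 1))"
      "DR (s + 1) ` R (s + 1) = {x \<in> R s. DR s x = 0}"
    using R unfolding exact_cplx_def by blast+
  define K where "K = {x \<in> R s. DR s x = 0}"
  have "submod act K" unfolding K_def by (rule submod_kernel[OF R'(3,1)])
  moreover have "modhom act (R (s + 1)) K (DR (s + 1))"
    using R'(5) by (intro modhom_subset[OF R'(4)]) (auto simp: K_def)
  moreover have "modhom act P K f"
    using f modhom_in[OF f(1)] by (intro modhom_subset[OF f(1)]) (auto simp: K_def)
  ultimately show ?thesis
    using P R'(2,5) unfolding lifting_def K_def by blast
qed

text \<open>The homotopy is built upwards from degree 0. At each stage the part of \<open>g\<close>
  not yet accounted for takes values in cycles of \<open>R\<close>, which are boundaries by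
  exactness, and so it lifts along the differential by the lifting property.\<close>

lemma hom_acyclic:
  assumes C: "cplx act C D" "\<And>t. t < 0 \<Longrightarrow> C t = {0}" "\<And>t. t \<ge> 0 \<Longrightarrow> lifting act (C t)"
    and R: "exact_cplx act R DR" and g: "g \<in> grHom act C R j" "hdiff DR D j g = 0"
  obtains h where "h \<in> grHom act C R (j - 1)" "g = hdiff DR D (j - 1) h"
proof -
  have sR: "submod act (R t)" for t using R by (simp add: exact_cplx_def)
  have sC: "submod act (C t)" for t using C by (simp add: cplx_def)
  have mD: "modhom act (C t) (C (t - 1)) (D t)" for t using C(1) by (simp add: cplx_def)
  have mR: "modhom act (R t) (R (t - 1)) (DR t)" for t using R by (simp add: exact_cplx_def)
  have mg: "modhom act (C t) (R (t - j)) (g t)" for t using grHomD[OF g(1)] .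
  have gc: "DR (t - j) (g t x) = isgn j (g (t - 1) (D t x))" for t x
    using fun_cong[OF fun_cong[OF g(2)], of t x] by (simp add: hdiff_def)
  have DD: "D (t - 1) (D t x) = 0" for t x using C(1) by (simp add: cplx_def)
  have lift: "\<exists>h. modhom act (C t) (R (t - j + 1)) h \<and> (\<forall>x. DR (t - j + 1) (h x) = f x)"
    if "t \<ge> 0" "modhom act (C t) (R (t - j)) f" "\<And>x. DR (t - j) (f x) = 0" for t f
    using lifting_exact[OF R C(3)[OF that(1)] that(2,3)] .
  \<comment> \<open>The invariant demands \<open>DR h = g\<close> only on boundaries: off them the
    earlier components of the homotopy contribute a correction. This much makes the next obstruction
    vanish.\<close>
  define Q where "Q t h \<longleftrightarrow> modhom act (C (int t)) (R (int t - j + 1)) h \<and>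
     (\<forall>x. DR (int t - j + 1) (h (D (int t + 1) x)) = g (int t) (D (int t + 1) x))" for t h
  define S where "S t h h' \<longleftrightarrow> (\<forall>x. g (int t + 1) x = DR (int t + 1 - j + 1) (h' x) - isgn (j - 1) (h (D (int t + 1) x)))" for t h h'
  have D0: "D 0 x = 0" for x using mD[of 0] C(2) by (auto intro: modhom_into_zero)
  have "DR (0 - j) (g 0 x) = 0" for x unfolding gc using D0 modhom_0[OF mg] by simp
  then obtain h0 where h0: "modhom act (C 0) (R (0 - j + 1)) h0" "\<And>x. DR (0 - j + 1) (h0 x) = g 0 x"
    using lift[of 0 "g 0"] mg[of 0] by auto
  have "\<exists>f. \<forall>t. (Q t (f t) \<and> (t = 0 \<longrightarrow> f t = h0)) \<and> S t (f t) (f (Suc t))"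
  proof (rule dependent_nat_choice)
    \<comment> \<open>The first component is pinned to \<open>h0\<close> because the homotopy
      equation in degree 0 is stronger than \<open>Q\<close> and is not covered by the relation
      \<open>S\<close>.\<close>
    show "\<exists>h. Q 0 h \<and> (0 = 0 \<longrightarrow> h = h0)" using h0 by (auto simp: Q_def)
  next
    fix h t assume "Q t h \<and> (t = 0 \<longrightarrow> h = h0)"
    then have h: "modhom act (C (int t)) (R (int t - j + 1)) h"
      "\<And>x. DR (int t - j + 1) (h (D (int t + 1) x)) = g (int t) (D (int t + 1) x)"
      by (auto simp: Q_def)
    define s where "s = int t + 1"
    \<comment> \<open>\<open>f\<close> is what the homotopy equation in degree \<open>s\<close>
      leaves for the next component to hit, given \<open>h\<close>.\<close>
    define f where "f x = g s x + isgn (j - 1) (h (D s x))" for x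
    have h': "modhom act (C (s - 1)) (R (s - j)) h" using h(1) by (simp add: s_def algebra_simps)
    have h2: "DR (s - j) (h (D s x)) = g (s - 1) (D s x)" for x
      using h(2)[of x] by (simp add: s_def algebra_simps)
    have mf: "modhom act (C s) (R (s - j)) f"
      unfolding f_def by (intro modhom_plus mg modhom_isgn_comp modhom_comp[OF mD h'] sR)
    have "DR (s - j) (f x) = 0" for x
    proof -
      have "DR (s - j) (f x) = DR (s - j) (g s x) + DR (s - j) (isgn (j - 1) (h (D s x)))"
        unfolding f_def using modhom_in_submod[OF mg sR] modhom_in_submod[OF h' sR]
        by (intro modhom_add[OF mR] submod_isgn[OF sR])
      also have "\<dots> = 0"
        unfolding gc modhom_isgn[OF mR sR] h2 by (simp add: isgn_minus_1)
      finally show ?thesis .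
    qed
    then obtain h' where h': "modhom act (C s) (R (s - j + 1)) h'" "\<And>x. DR (s - j + 1) (h' x) = f x"
      using lift[of s f] mf by (auto simp: s_def)
    have "DR (s - j + 1) (h' (D (s + 1) x)) = g s (D (s + 1) x)" for x
      using DD[of "s + 1" x] modhom_0[OF h(1)] unfolding h'(2) by (simp add: f_def)
    then have "Q (Suc t) h'" using h'(1) by (simp add: Q_def s_def algebra_simps)
    moreover have "S t h h'" using h'(2) by (simp add: S_def s_def[symmetric] f_def)
    ultimately show "\<exists>h'. (Q (Suc t) h' \<and> (Suc t = 0 \<longrightarrow> h' = h0)) \<and> S t h h'" by blast
  qed
  then obtain f where f: "\<And>t. Q t (f t)" "f 0 = h0" "\<And>t. S t (f t) (f (Suc t))" by blast
  define h where "h t = (if 0 \<le> t then f (nat t) else (\<lambda>x. 0))" for t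
  have "modhom act (C t) (R (t - (j - 1))) (h t)" for t
  proof (cases "0 \<le> t")
    case True
    then show ?thesis using f(1)[of "nat t"] by (simp add: Q_def h_def algebra_simps)
  qed (simp add: h_def modhom_zero sR)
  then have "h \<in> grHom act C R (j - 1)" by (simp add: grHom_def)
  moreover have "g t x = hdiff DR D (j - 1) h t x" for t x
  proof -
    consider "t < 0" | "t = 0" | "t > 0" by linarith
    then show ?thesis
    proof cases
      case 1
      then show ?thesis using modhom_0[OF mR] modhom_from_zero[of act _ "g t"] mg[of t] C(2)[of t]
        by (simp add: hdiff_def h_def)
    next
      case 2
      then show ?thesis using h0(2)[of x] f(2) by (simp add: hdiff_def h_def algebra_simps)
    next
      case 3
      define s where "s = nat (t - 1)"
      have t: "t = int s + 1" using 3 by (simp add: s_def)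
      have n: "nat (int s + 1) = Suc s" "nat (int s) = s" by simp_all
      show ?thesis using f(3)[of s, unfolded S_def] unfolding t hdiff_def h_def n
        by (simp add: n algebra_simps)
    qed
  qed
  ultimately show thesis using that by blast
qed

lemma resolves_eps:
  assumes "resolves act C D M eps"
  shows "modhom act (C 0) M eps" "eps ` C 0 = M" "\<And>x. eps (D 1 x) = 0" "submod act M"
proof -
  have e: "exact_cplx act (C(-1 := M)) (D(0 := eps))" and C: "cplx act C D" "\<And>t. t < 0 \<Longrightarrow> C t = {0}"
    using assms by (auto simp: resolves_def)
  show "modhom act (C 0) M eps" using e[unfolded exact_cplx_def, rule_format, of 0] by simp
  show "submod act M" using e[unfolded exact_cplx_def, rule_format, of "-1"] by simp
  show "eps (D 1 x) = 0" for x using exact_cplx_square[OF e, of 1 x] by simp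
  have "modhom act M (C (-2)) (D (-1))" using e[unfolded exact_cplx_def, rule_format, of "-1"] by simp
  then have "D (-1) x = 0" for x using C(2)[of "-2"] by (auto intro: modhom_into_zero)
  then show "eps ` C 0 = M" using e[unfolded exact_cplx_def, rule_format, of "-1"] by simp
qed

text \<open>A map of degree at most 0 does not lower the homological degree, so from degrees at
  least 0 it never reaches the module added in degree -1.\<close>

lemma grHom_augmented:
  assumes "\<And>t. t < 0 \<Longrightarrow> C t = {0}" "u \<in> grHom act C (C'(-1 := M)) j" "j \<le> 0" "\<And>t. submod act (C' t)"
  shows "u \<in> grHom act C C' j"
  unfolding grHom_def
proof (intro CollectI allI)
  fix t
  show "modhom act (C t) (C' (t - j)) (u t)"
  proof (cases "t < 0")
    case True
    have "modhom act {0} ((C'(-1 := M)) (t - j)) (u t)"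
      using grHomD[OF assms(2), of t] assms(1)[OF True] by simp
    then have "u t = (\<lambda>x. 0)" by (simp add: modhom_from_zero fun_eq_iff)
    then show ?thesis using modhom_zero[OF assms(4)] by simp
  next
    case False
    then show ?thesis using grHomD[OF assms(2), of t] assms(3) by (auto split: if_splits)
  qed
qed

text \<open>A case of \<open>hom_acyclic\<close>: the augmentation, placed in degree 0, is a cocycle
  of degree 1 into the augmented target, and a contraction of it is precisely a chain map over the
  identity of \<open>M\<close>.\<close>

lemma resolution_map:
  assumes C: "resolves act C D M eps" and C': "resolves act C' D' M eps'"
  obtains u where "u \<in> grHom act C C' 0" "\<And>t x. D' t (u t x) = u (t - 1) (D t x)"
    "\<And>x. eps' (u 0 x) = eps x"
proof -
  have c: "cplx act C D" "\<And>t. t < 0 \<Longrightarrow> C t = {0}" "\<And>t. t \<ge> 0 \<Longrightarrow> lifting act (C t)"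
    and c': "cplx act C' D'" "\<And>t. t < 0 \<Longrightarrow> C' t = {0}"
    "exact_cplx act (C'(-1 := M)) (D'(0 := eps'))"
    using C C' by (auto simp: resolves_def)
  have sC': "submod act (C' t)" and mD': "modhom act (C' t) (C' (t - 1)) (D' t)" for t
    using c'(1) by (auto simp: cplx_def)
  have mD: "modhom act (C t) (C (t - 1)) (D t)" for t
    using c(1) by (auto simp: cplx_def)
  have D'0: "D' t x = 0" if "t \<le> 0" for x t using mD'[of t] c'(2)[of "t - 1"] that by (auto intro: modhom_into_zero)
  have D0: "D t x = 0" if "t \<le> 0" for x t using mD[of t] c(2)[of "t - 1"] that by (auto intro: modhom_into_zero)
  define g where "g t = (if t = 0 then eps else (\<lambda>x. 0))" for t :: int
  have sR: "submod act ((C'(-1 := M)) t)" for t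
    using c'(3) unfolding exact_cplx_def by blast
  have "modhom act (C t) ((C'(-1 := M)) (t - 1)) (g t)" for t
    using resolves_eps[OF C] modhom_zero[OF sR[of "t - 1"]] by (cases "t = 0") (auto simp: g_def)
  then have g1: "g \<in> grHom act C (C'(-1 := M)) 1" by (simp add: grHom_def)
  have g2: "hdiff (D'(0 := eps')) D 1 g t x = 0" for t x
    using resolves_eps[OF C] modhom_0[OF resolves_eps(1)[OF C']] modhom_0[OF mD'] D'0[of "-1"]
    by (auto simp: hdiff_def g_def)
  obtain u where u: "u \<in> grHom act C (C'(-1 := M)) (1 - 1)" "g = hdiff (D'(0 := eps')) D (1 - 1) u"
    using hom_acyclic[OF c c'(3) g1] g2 by (metis (no_types, lifting) ext zero_fun_apply)
  have u1: "u \<in> grHom act C C' 0" using grHom_augmented[of C u C' M 0] c(2) u(1) sC' by simp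
  have um: "u (-1) x = 0" for x using grHomD[OF u1, of "-1"] c(2)[of "-1"] modhom_from_zero by fastforce
  have gt: "g t x = (D'(0 := eps')) t (u t x) - u (t - 1) (D t x)" for t x
    unfolding u(2) by (simp add: hdiff_def isgn_def)
  have "D' t (u t x) = u (t - 1) (D t x)" for t x
    using gt[of t x] D0[of 0] D'0[of 0] um by (cases "t = 0") (auto simp: g_def)
  moreover have "eps' (u 0 x) = eps x" for x
    using gt[of 0 x] um by (simp add: g_def)
  ultimately show thesis using that u1 by blast
qed

text \<open>A case of \<open>hom_acyclic\<close> again: \<open>u\<close> minus the identity is a
  cocycle of degree 0 into the augmented complex, since \<open>u\<close> commutes with the
  augmentation.\<close>

lemma resolution_homotopy:
  assumes C: "resolves act C D M eps" and u: "u \<in> grHom act C C 0" "\<And>t x. D t (u t x) = u (t - 1) (D t x)"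
    "\<And>x. eps (u 0 x) = eps x"
  obtains h where "h \<in> grHom act C C (-1)"
    "\<And>t x. x \<in> C t \<Longrightarrow> u t x - x = D (t + 1) (h t x) + h (t - 1) (D t x)"
proof -
  have c: "cplx act C D" "\<And>t. t < 0 \<Longrightarrow> C t = {0}" "\<And>t. t \<ge> 0 \<Longrightarrow> lifting act (C t)"
    and c': "exact_cplx act (C(-1 := M)) (D(0 := eps))"
    using C by (auto simp: resolves_def)
  have sC: "submod act (C t)" and mD: "modhom act (C t) (C (t - 1)) (D t)" for t
    using c(1) by (auto simp: cplx_def)
  have D0: "D t x = 0" if "t \<le> 0" for x t using mD[of t] c(2)[of "t - 1"] that by (auto intro: modhom_into_zero)
  have mu: "modhom act (C t) (C t) (u t)" for t using grHomD[OF u(1), of t] by simp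
  \<comment> \<open>The identity has to be cut off outside \<open>C t\<close> to count as a
    homomorphism.\<close>
  define g where "g t x = (if x \<in> C t then u t x - x else 0)" for t x
  have sR: "submod act ((C(-1 := M)) t)" for t
    using c' unfolding exact_cplx_def by blast
  have g0: "g t x = 0" if "t < 0" for t x
    using c(2)[OF that] mu[of t] modhom_0[OF mu[of t]] by (auto simp: g_def)
  have "modhom act (C t) (C t) (\<lambda>x. if x \<in> C t then x else 0)" for t
    using sC[of t] by (auto simp: modhom_def submod_def)
  from modhom_sub[OF mu this sC] have "modhom act (C t) (C t) (\<lambda>x. u t x - (if x \<in> C t then x else 0))" for t .
  moreover have "(\<lambda>x. u t x - (if x \<in> C t then x else 0)) = g t" for t
    using modhom_out[OF mu] by (auto simp: g_def)
  ultimately have mg: "modhom act (C t) (C t) (g t)" for t by simp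
  have "modhom act (C t) ((C(-1 := M)) t) (g t)" for t
  proof (cases "t < 0")
    case True
    then have "g t = (\<lambda>x. 0)" by (simp add: g0 fun_eq_iff)
    then show ?thesis using modhom_zero[OF sR] by simp
  qed (use mg[of t] in auto)
  then have g1: "g \<in> grHom act C (C(-1 := M)) 0" by (simp add: grHom_def)
  have g2: "hdiff (D(0 := eps)) D 0 g t x = 0" for t x
  proof (cases "x \<in> C t")
    case False
    then show ?thesis using modhom_0[OF mg] modhom_0[OF mD] modhom_0[OF resolves_eps(1)[OF C]] modhom_out[OF mD] modhom_out[OF mg]
      by (simp add: hdiff_def isgn_def)
  next
    case True
    then have D: "D t x \<in> C (t - 1)" using mD modhom_in by blast
    show ?thesis
    proof (cases "t = 0")
      case 0: True
      have "eps (u 0 x - x) = eps (u 0 x) - eps x"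
        using True 0 modhom_in[OF mu[of 0]] by (intro modhom_diff[OF resolves_eps(1)[OF C] sC]) auto
      then show ?thesis using u(3)[of x] 0 True D0[of 0] modhom_0[OF mu] by (simp add: hdiff_def isgn_def g_def)
    next
      case False
      have "D t (u t x - x) = D t (u t x) - D t x"
        using True modhom_in[OF mu] by (intro modhom_diff[OF mD sC])
      then show ?thesis using u(2)[of t x] False True D by (simp add: hdiff_def isgn_def g_def)
    qed
  qed
  obtain h where h: "h \<in> grHom act C (C(-1 := M)) (0 - 1)" "g = hdiff (D(0 := eps)) D (0 - 1) h"
    using hom_acyclic[OF c c' g1] g2 by (metis (no_types, lifting) ext zero_fun_apply)
  have h1: "h \<in> grHom act C C (-1)" using grHom_augmented[of C h C M "-1"] c(2) h(1) sC by simp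
  have hm: "h (-1) x = 0" for x using grHomD[OF h1, of "-1"] c(2)[of "-1"] modhom_from_zero by fastforce
  have gt: "g t x = (D(0 := eps)) (t + 1) (h t x) + h (t - 1) (D t x)" for t x
    unfolding h(2) by (simp add: hdiff_def isgn_def)
  have "u t x - x = D (t + 1) (h t x) + h (t - 1) (D t x)" if "x \<in> C t" for t x
    using gt[of t x] D0[of "-1"] D0[of 0] hm modhom_0[OF resolves_eps(1)[OF C]] that by (cases "t = -1") (auto simp: g_def)
  then show thesis using that h1 by blast
qed

end

section \<open>The action of the field and the cohomology of Hom(C, M)\<close>

locale k_mod = right_mod act for act :: "'m::ab_group_add \<Rightarrow> 'g::ring_1 \<Rightarrow> 'm" +
  fixes alg :: "'k::field \<Rightarrow> 'g"
  assumes k_algebra: "k_algebra_map alg"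
begin

abbreviation "smul \<equiv> ms act alg"

definition hsm :: "'k \<Rightarrow> ('m \<Rightarrow> 'm) \<Rightarrow> 'm \<Rightarrow> 'm" where
  "hsm c f = (\<lambda>x. smul c (f x))"

lemma alg_central: "alg c * r = r * alg c"
  using k_algebra unfolding k_algebra_map_def by blast

lemma smul_add: "smul c (x + y) = smul c x + smul c y"
  by (simp add: ms_def act_add)

lemma smul_add_left: "smul (a + b) x = smul a x + smul b x"
proof -
  have "alg (a + b) = alg a + alg b" using k_algebra unfolding k_algebra_map_def by blast
  then show ?thesis by (simp add: ms_def act_add_right)
qed

lemma smul_smul: "smul a (smul b x) = smul (a * b) x"
proof -
  have "alg (a * b) = alg a * alg b" using k_algebra unfolding k_algebra_map_def by blast
  then show ?thesis unfolding ms_def act_act by (metis alg_central)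
qed

lemma smul_act: "act (smul c x) r = smul c (act x r)"
  unfolding ms_def act_act by (metis alg_central)

lemma smul_1: "smul 1 x = x"
proof -
  have "alg 1 = 1" using k_algebra unfolding k_algebra_map_def by blast
  then show ?thesis by (simp add: ms_def)
qed

lemma smul_0 [simp]: "smul c 0 = 0"
  by (simp add: ms_def)

lemma smul_diff: "smul c (x - y) = smul c x - smul c y"
  by (simp add: ms_def act_diff)

lemma smul_isgn: "smul c (isgn e x) = isgn e (smul c x)"
  by (simp add: ms_def act_isgn)

lemma submod_smul: "submod act A \<Longrightarrow> x \<in> A \<Longrightarrow> smul c x \<in> A"
  by (simp add: ms_def submod_def)

lemma modhom_smul: "modhom act A B f \<Longrightarrow> submod act A \<Longrightarrow> f (smul c x) = smul c (f x)"
proof (cases "x \<in> A")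
  case False
  assume f: "modhom act A B f" "submod act A"
  show ?thesis
  proof (cases "c = 0")
    case True
    have "smul 0 y = 0" for y using smul_add_left[of 0 0 y] by simp
    then show ?thesis using True modhom_0[OF f(1)] by simp
  next
    case c: False
    \<comment> \<open>A nonzero scalar is invertible, so it cannot move a point outside
      \<open>A\<close> into \<open>A\<close>; both sides then vanish.\<close>
    then have "smul (inverse c) (smul c x) = x" by (simp add: smul_smul smul_1)
    then have "smul c x \<notin> A" using False submod_smul[OF f(2)] by metis
    then show ?thesis using False modhom_out[OF f(1)] by simp
  qed
qed (simp add: modhom_def ms_def)

lemma modhom_smul_comp:
  assumes "modhom act A B f" "submod act B"
  shows "modhom act A B (\<lambda>x. smul c (f x))"
  using assms by (auto simp: modhom_def submod_smul smul_add smul_act)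

lemma vector_space_hsm: "vector_space hsm"
  by unfold_locales (auto simp: hsm_def smul_add smul_add_left smul_smul smul_1)

lemma vector_space_gsm: "vector_space (gsm act alg)"
  by unfold_locales (auto simp: gsm_def smul_add smul_add_left smul_smul smul_1 fun_eq_iff)

lemma Hom_subspace: "submod act B \<Longrightarrow> module.subspace hsm (Hom act A B)"
proof -
  interpret v: vector_space hsm by (rule vector_space_hsm)
  assume "submod act B"
  then show ?thesis
    unfolding v.subspace_def Hom_def hsm_def zero_fun_def plus_fun_def
    by (auto simp: modhom_zero modhom_plus modhom_smul_comp)
qed

lemma HZ_subspace:
  assumes "submod act M" shows "module.subspace hsm (HZ act C D M t)"
proof -
  interpret v: vector_space hsm by (rule vector_space_hsm)
  show ?thesis using Hom_subspace[OF assms, of "C t"]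
    unfolding v.subspace_def HZ_def by (auto simp: hsm_def)
qed

lemma HB_subspace:
  assumes "submod act M" shows "module.subspace hsm (HB act C D M t)"
proof -
  interpret v: vector_space hsm by (rule vector_space_hsm)
  note H = Hom_subspace[OF assms, of "C (t - 1)"]
  show ?thesis
  proof (rule v.subspaceI)
    show "0 \<in> HB act C D M t"
      using v.subspace_0[OF H] unfolding HB_def by (intro image_eqI[of _ _ 0]) auto
    show "\<phi> + \<psi> \<in> HB act C D M t" if "\<phi> \<in> HB act C D M t" "\<psi> \<in> HB act C D M t" for \<phi> \<psi>
    proof -
      obtain f g where "f \<in> Hom act (C (t - 1)) M" "g \<in> Hom act (C (t - 1)) M"
        "\<phi> = (\<lambda>x. f (D t x))" "\<psi> = (\<lambda>x. g (D t x))" using \<open>\<phi> \<in> _\<close> \<open>\<psi> \<in> _\<close> by (auto simp: HB_def)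
      then show ?thesis using v.subspace_add[OF H, of f g] unfolding HB_def
        by (intro image_eqI[of _ _ "f + g"]) auto
    qed
    show "hsm c \<phi> \<in> HB act C D M t" if \<phi>: "\<phi> \<in> HB act C D M t" for c \<phi>
    proof -
      obtain f where "f \<in> Hom act (C (t - 1)) M" "\<phi> = (\<lambda>x. f (D t x))" using \<phi> by (auto simp: HB_def)
      then show ?thesis using v.subspace_scale[OF H, of f c] unfolding HB_def
        by (intro image_eqI[of _ _ "hsm c f"]) (auto simp: hsm_def)
    qed
  qed
qed

lemma HB_subset_HZ:
  assumes "cplx act C D" shows "HB act C D M t \<subseteq> HZ act C D M t"
proof
  fix \<phi> assume "\<phi> \<in> HB act C D M t"
  then obtain \<chi> where "\<chi> \<in> Hom act (C (t - 1)) M" "\<phi> = (\<lambda>x. \<chi> (D t x))" by (auto simp: HB_def)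
  moreover have "modhom act (C t) (C (t - 1)) (D t)" "D t (D (t + 1) x) = 0" for x
    using assms unfolding cplx_def by (auto) (metis add_diff_cancel_right')
  ultimately show "\<phi> \<in> HZ act C D M t"
    using modhom_comp[of act _ _ "D t" M \<chi>] by (auto simp: HZ_def Hom_def modhom_0)
qed

lemma HZ_precompose:
  assumes C: "cplx act C D" and C': "cplx act C' D'"
    and u: "u \<in> grHom act C C' 0" "\<And>t x. D' t (u t x) = u (t - 1) (D t x)"
  shows "\<phi> \<in> HZ act C' D' M t \<Longrightarrow> (\<lambda>x. \<phi> (u t x)) \<in> HZ act C D M t"
    "\<phi> \<in> HB act C' D' M t \<Longrightarrow> (\<lambda>x. \<phi> (u t x)) \<in> HB act C D M t"
proof -
  have mu: "modhom act (C t) (C' t) (u t)" for t using grHomD[OF u(1), of t] by simp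
  show "(\<lambda>x. \<phi> (u t x)) \<in> HZ act C D M t" if "\<phi> \<in> HZ act C' D' M t"
    using that u(2)[of "t + 1", symmetric] modhom_comp[OF mu[of t], of M \<phi>] by (simp add: HZ_def Hom_def)
  show "(\<lambda>x. \<phi> (u t x)) \<in> HB act C D M t" if \<phi>: "\<phi> \<in> HB act C' D' M t"
  proof -
    obtain \<chi> where "\<chi> \<in> Hom act (C' (t - 1)) M" "\<phi> = (\<lambda>x. \<chi> (D' t x))" using \<phi> by (auto simp: HB_def)
    then have "(\<lambda>x. \<chi> (u (t - 1) x)) \<in> Hom act (C (t - 1)) M" "(\<lambda>x. \<phi> (u t x)) = (\<lambda>x. \<chi> (u (t - 1) (D t x)))"
      using modhom_comp[OF mu[of "t - 1"], of M \<chi>] by (auto simp: Hom_def u(2))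
    then show ?thesis by (auto simp: HB_def)
  qed
qed

text \<open>Of the two terms of the homotopy, the first is killed by the cocycle \<phi> and the
  second factors through \<open>D t\<close>, hence is a boundary.\<close>

lemma HZ_homotopic:
  assumes C: "cplx act C D" and M: "submod act M"
    and h: "h \<in> grHom act C C (-1)" "\<And>t x. x \<in> C t \<Longrightarrow> u t x - x = D (t + 1) (h t x) + h (t - 1) (D t x)"
    and u: "u \<in> grHom act C C 0"
    and \<phi>: "\<phi> \<in> HZ act C D M t"
  shows "(\<lambda>x. \<phi> (u t x)) - \<phi> \<in> HB act C D M t"
proof -
  have s: "submod act (C t)" and mD: "modhom act (C t) (C (t - 1)) (D t)" for t using C by (auto simp: cplx_def)
  have m: "modhom act (C t) M \<phi>" and \<phi>0: "\<And>x. \<phi> (D (t + 1) x) = 0" using \<phi> by (auto simp: HZ_def Hom_def)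
  have mh: "modhom act (C (t - 1)) (C t) (h (t - 1))" using grHomD[OF h(1), of "t - 1"] by simp
  have mu: "modhom act (C t) (C t) (u t)" using grHomD[OF u(1), of t] by simp
  have "\<phi> (u t x) - \<phi> x = \<phi> (h (t - 1) (D t x))" for x
  proof (cases "x \<in> C t")
    case True
    have "\<phi> (u t x) - \<phi> x = \<phi> (u t x - x)"
      using modhom_diff[OF m s modhom_in[OF mu True] True] by simp
    also have "\<dots> = \<phi> (D (t + 1) (h t x)) + \<phi> (h (t - 1) (D t x))"
      unfolding h(2)[OF True] using modhom_in_submod[OF mh s] modhom_in_submod[OF mD[of "t + 1"]] s
      by (intro modhom_add[OF m]) auto
    finally show ?thesis by (simp add: \<phi>0)
  next
    case False
    then show ?thesis using modhom_out[OF m] modhom_out[OF mu] modhom_out[OF mD] modhom_0[OF m] modhom_0[OF mh] by simp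
  qed
  moreover have "(\<lambda>x. \<phi> (h (t - 1) x)) \<in> Hom act (C (t - 1)) M"
    using modhom_comp[OF mh m] by (simp add: Hom_def)
  ultimately show ?thesis by (force simp: HB_def fun_eq_iff)
qed

text \<open>Ext does not depend on the resolution. Pulling back along a comparison map
  \<open>v\<close> is the isomorphism; pulling back along \<open>u\<close> in the other direction
  inverts it, because both composites are homotopic to the identity.\<close>

lemma resolution_sq_iso:
  assumes C: "resolves act C D M eps" and C': "resolves act C' D' M eps'"
  shows "sq_iso hsm hsm (HZ act C D M t) (HB act C D M t) (HZ act C' D' M t) (HB act C' D' M t)"
proof -
  interpret v: vector_space hsm by (rule vector_space_hsm)
  have c: "cplx act C D" "cplx act C' D'" using C C' by (auto simp: resolves_def)
  have M: "submod act M" by (rule resolves_eps(4)[OF C])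
  obtain u where u: "u \<in> grHom act C C' 0" "\<And>t x. D' t (u t x) = u (t - 1) (D t x)"
    "\<And>x. eps' (u 0 x) = eps x" using resolution_map[OF C C'] by blast
  obtain v where v: "v \<in> grHom act C' C 0" "\<And>t x. D t (v t x) = v (t - 1) (D' t x)"
    "\<And>x. eps (v 0 x) = eps' x" using resolution_map[OF C' C] by blast
  have mu: "modhom act (C t) (C' t) (u t)" and mv: "modhom act (C' t) (C t) (v t)" for t
    using grHomD[OF u(1), of t] grHomD[OF v(1), of t] by auto
  define uv where "uv = (\<lambda>t x. u t (v t x))"
  define vu where "vu = (\<lambda>t x. v t (u t x))"
  have uv: "uv \<in> grHom act C' C' 0" "\<And>t x. D' t (uv t x) = uv (t - 1) (D' t x)" "\<And>x. eps' (uv 0 x) = eps' x"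
    using modhom_comp[OF mv mu] by (auto simp: uv_def grHom_def u v)
  have vu: "vu \<in> grHom act C C 0" "\<And>t x. D t (vu t x) = vu (t - 1) (D t x)" "\<And>x. eps (vu 0 x) = eps x"
    using modhom_comp[OF mu mv] by (auto simp: vu_def grHom_def u v)
  obtain h where h: "h \<in> grHom act C C (-1)" "\<And>t x. x \<in> C t \<Longrightarrow> vu t x - x = D (t + 1) (h t x) + h (t - 1) (D t x)"
    using resolution_homotopy[OF C vu] by blast
  obtain h' where h': "h' \<in> grHom act C' C' (-1)" "\<And>t x. x \<in> C' t \<Longrightarrow> uv t x - x = D' (t + 1) (h' t x) + h' (t - 1) (D' t x)"
    using resolution_homotopy[OF C' uv] by blast
  have neg: "a - b \<in> HB act C D M t \<Longrightarrow> b - a \<in> HB act C D M t" for a b C D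
    using v.subspace_neg[OF HB_subspace[OF M], of "a - b" C D t] by simp
  show ?thesis unfolding sq_iso_def
  proof (intro exI[of _ "\<lambda>\<phi> x. \<phi> (v t x)"] conjI ballI allI)
    fix \<phi> assume \<phi>: "\<phi> \<in> HZ act C D M t"
    show "(\<lambda>x. \<phi> (v t x)) \<in> HZ act C' D' M t" by (rule HZ_precompose(1)[OF c(2,1) v(1,2) \<phi>])
    show "(\<lambda>x. \<phi> (v t x)) \<in> HB act C' D' M t \<longleftrightarrow> \<phi> \<in> HB act C D M t"
    proof
      assume "(\<lambda>x. \<phi> (v t x)) \<in> HB act C' D' M t"
      from HZ_precompose(2)[OF c u(1,2) this] have "(\<lambda>x. \<phi> (vu t x)) \<in> HB act C D M t" by (simp add: vu_def)
      from v.subspace_diff[OF HB_subspace[OF M] this HZ_homotopic[OF c(1) M h vu(1) \<phi>]]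
      show "\<phi> \<in> HB act C D M t" by simp
    qed (rule HZ_precompose(2)[OF c(2,1) v(1,2)])
  next
    fix \<psi> assume \<psi>: "\<psi> \<in> HZ act C' D' M t"
    have "\<psi> - (\<lambda>x. \<psi> (uv t x)) \<in> HB act C' D' M t"
      by (rule neg[OF HZ_homotopic[OF c(2) M h' uv(1) \<psi>]])
    then show "\<exists>\<phi>\<in>HZ act C D M t. \<psi> - (\<lambda>x. \<phi> (v t x)) \<in> HB act C' D' M t"
      using HZ_precompose(1)[OF c u(1,2) \<psi>] by (intro bexI[of _ "\<lambda>x. \<psi> (u t x)"]) (auto simp: uv_def)
  qed (auto simp: hsm_def)
qed

end

section \<open>Resolutions indexed by natural numbers as integer graded complexes\<close>

definition natC :: "(nat \<Rightarrow> 'm::zero set) \<Rightarrow> int \<Rightarrow> 'm set" where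
  "natC Q t = (if 0 \<le> t then Q (nat t) else {0})"

definition natD :: "(nat \<Rightarrow> 'm \<Rightarrow> 'm::zero) \<Rightarrow> int \<Rightarrow> 'm \<Rightarrow> 'm" where
  "natD dQ t = (if 1 \<le> t then dQ (nat t) else (\<lambda>x. 0))"

context right_mod
begin

lemma resolves_natI:
  assumes Q: "\<And>t. lifting act (Q t)" and dQ: "\<And>t. t \<ge> 1 \<Longrightarrow> modhom act (Q t) (Q (t - 1)) (dQ t)"
    and eps: "modhom act (Q 0) M eps" "eps ` Q 0 = M" and M: "submod act M"
    and ex: "dQ 1 ` Q 1 = {x \<in> Q 0. eps x = 0}"
      "\<And>t. t \<ge> 1 \<Longrightarrow> dQ (t + 1) ` Q (t + 1) = {x \<in> Q t. dQ t x = 0}"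
  shows "resolves act (natC Q) (natD dQ) M eps"
proof -
  let ?C = "natC Q" and ?D = "natD dQ"
  have sQ: "submod act (Q t)" for t using Q by (simp add: lifting_def)
  have sC: "submod act (?C t)" for t by (simp add: natC_def sQ submod_zero)
  have mD: "modhom act (?C t) (?C (t - 1)) (?D t)" for t
  proof (cases "1 \<le> t")
    case True
    then show ?thesis using dQ[of "nat t"] by (simp add: natC_def natD_def nat_diff_distrib')
  qed (use modhom_zero[OF sC] in \<open>simp add: natD_def\<close>)
  have ex': "(?D(0 := eps)) (t + 1) ` (?C(-1 := M)) (t + 1) = {x \<in> (?C(-1 := M)) t. (?D(0 := eps)) t x = 0}" for t
  proof -
    consider "t < -1" | "t = -1" | "t = 0" | "t \<ge> 1" by linarith
    then show ?thesis
    proof cases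
      case 4
      then show ?thesis using ex(2)[of "nat t"] by (simp add: natC_def natD_def nat_add_distrib)
    qed (use eps ex(1) submod_0[OF M] in \<open>auto simp: natC_def natD_def\<close>)
  qed
  have mD': "modhom act ((?C(-1 := M)) t) ((?C(-1 := M)) (t - 1)) ((?D(0 := eps)) t)" for t
    using mD[of t] eps(1) modhom_zero[OF submod_zero] by (auto simp: natC_def natD_def)
  have sC': "submod act ((?C(-1 := M)) t)" for t
    using sC[of t] M by simp
  have exact: "exact_cplx act (?C(-1 := M)) (?D(0 := eps))"
    unfolding exact_cplx_def using ex' mD' sC' by blast
  have "?D (t - 1) (?D t x) = 0" for t x
  proof (cases "t \<ge> 2")
    case True
    then show ?thesis using exact_cplx_square[OF exact, of t x] by simp
  next
    case False
    then show ?thesis by (simp add: natD_def)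
  qed
  then have "cplx act ?C ?D" using sC mD by (simp add: cplx_def)
  then show ?thesis using exact Q by (simp add: resolves_def natC_def)
qed

lemma proj_resolution_resolves:
  assumes "proj_resolution act M Q dQ eps" "submod act M"
  shows "resolves act (natC Q) (natD dQ) M eps"
  using assms projective_lifting unfolding proj_resolution_def
  by (intro resolves_natI) auto

lemma ExtZ_eq_HZ: "ExtZ act M Q dQ j = HZ act (natC Q) (natD dQ) M (int j)"
  by (auto simp: ExtZ_def HZ_def natC_def natD_def nat_add_distrib fun_eq_iff)

lemma ExtB_eq_HB:
  assumes "submod act M" shows "ExtB act M Q dQ j = HB act (natC Q) (natD dQ) M (int j)"
proof (cases "j = 0")
  case True
  have "(\<lambda>x. 0) \<in> Hom act {0} M" using modhom_zero[OF assms] by (simp add: Hom_def)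
  then show ?thesis using True modhom_0
    by (auto simp: ExtB_def HB_def natC_def natD_def Hom_def image_iff fun_eq_iff)
next
  case False
  then have "nat (int j - 1) = j - 1" by simp
  then show ?thesis using False by (simp add: ExtB_def HB_def natC_def natD_def comp_def)
qed

end

section \<open>The endomorphism complex of the exact sequence\<close>

context right_mod
begin

lemma grHom_diff:
  assumes "f \<in> grHom act C R j" "g \<in> grHom act C R j" "\<And>t. submod act (R t)"
  shows "f - g \<in> grHom act C R j"
  using assms(1,2) unfolding grHom_def fun_diff_def by (auto intro: modhom_sub assms(3))

lemma gdiff_plus:
  assumes C: "cplx act C D" and f: "f \<in> gHom act C j" and g: "g \<in> gHom act C j"
  shows "gdiff D j (f + g) = gdiff D j f + gdiff D j g"
proof -
  have s: "submod act (C t)" and mD: "modhom act (C t) (C (t - 1)) (D t)" for t using C by (auto simp: cplx_def)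
  have "f t x \<in> C (t - j)" "g t x \<in> C (t - j)" for t x
    using f g by (auto simp: gHom_def intro: modhom_in_submod[OF _ s])
  then show ?thesis by (auto simp: gdiff_def fun_eq_iff modhom_add[OF mD] isgn_add)
qed

lemma gdiff_diff:
  assumes C: "cplx act C D" and f: "f \<in> gHom act C j" and g: "g \<in> gHom act C j"
  shows "gdiff D j (f - g) = gdiff D j f - gdiff D j g"
proof -
  have "f - g \<in> gHom act C j" using f g C grHom_diff[of f C C j g] by (simp add: gHom_eq_grHom cplx_def)
  from gdiff_plus[OF C this g] show ?thesis by (simp add: algebra_simps)
qed

lemma gdiff_gHom:
  assumes C: "cplx act C D" and f: "f \<in> gHom act C j"
  shows "gdiff D j f \<in> gHom act C (j + 1)"
proof -
  have s: "submod act (C t)" and mD: "modhom act (C t) (C (t - 1)) (D t)" for t using C by (auto simp: cplx_def)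
  have mf: "modhom act (C t) (C (t - j)) (f t)" for t using f by (simp add: gHom_def)
  have "modhom act (C t) (C (t - j - 1)) (\<lambda>x. f (t - 1) (D t x))" for t
    using modhom_comp[OF mD[of t] mf[of "t - 1"]] by (simp add: algebra_simps)
  then have "modhom act (C t) (C (t - j - 1)) (\<lambda>x. D (t - j) (f t x) - isgn j (f (t - 1) (D t x)))" for t
    using modhom_comp[OF mf[of t] mD[of "t - j"]] s by (intro modhom_sub modhom_isgn_comp)
  then show ?thesis by (simp add: gHom_def gdiff_def algebra_simps)
qed

lemma gdiff_gdiff:
  assumes C: "cplx act C D" and f: "f \<in> gHom act C j"
  shows "gdiff D (j + 1) (gdiff D j f) = 0"
proof -
  have s: "submod act (C t)" and mD: "modhom act (C t) (C (t - 1)) (D t)" and DD: "D (t - 1) (D t x) = 0" for t x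
    using C by (auto simp: cplx_def)
  have mf: "modhom act (C t) (C (t - j)) (f t)" for t using f by (simp add: gHom_def)
  have "gdiff D (j + 1) (gdiff D j f) t x = 0" for t x
  proof -
    have e: "f (t - 1) (D t x) \<in> C (t - j - 1)" using modhom_in_submod[OF mf[of "t - 1"] s] by (simp add: algebra_simps)
    have "D (t - j - 1) (D (t - j) (f t x) - isgn j (f (t - 1) (D t x)))
       = D (t - j - 1) (D (t - j) (f t x)) - D (t - j - 1) (isgn j (f (t - 1) (D t x)))"
      using modhom_in_submod[OF mD[of "t - j"] s] submod_isgn[OF s e] by (intro modhom_diff[OF mD s])
    moreover have "t - (j + 1) = t - j - 1" "t - 1 - j = t - j - 1" by auto
    ultimately show ?thesis
      using DD[of "t - j" "f t x"] DD[of t x] modhom_0[OF mf]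
      unfolding gdiff_def \<open>t - (j + 1) = t - j - 1\<close> \<open>t - 1 - j = t - j - 1\<close>
      by (simp add: modhom_isgn[OF mD s] isgn_diff isgn_plus_1)
  qed
  then show ?thesis by (simp add: fun_eq_iff)
qed

lemma EndB_subset_EndZ:
  assumes C: "cplx act C D" shows "EndB act C D j \<subseteq> EndZ act C D j"
  using gdiff_gHom[OF C, of _ "j - 1"] gdiff_gdiff[OF C, of _ "j - 1"] by (auto simp: EndB_def EndZ_def)

end

context k_mod
begin

lemma gdiff_gsm:
  assumes C: "cplx act C D" and f: "f \<in> gHom act C j"
  shows "gdiff D j (gsm act alg c f) = gsm act alg c (gdiff D j f)"
proof -
  have s: "submod act (C t)" and mD: "modhom act (C t) (C (t - 1)) (D t)" for t using C by (auto simp: cplx_def)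
  show ?thesis by (simp add: gdiff_def gsm_def fun_eq_iff modhom_smul[OF mD s] smul_diff smul_isgn)
qed

lemma gHom_subspace:
  assumes "\<And>t. submod act (C t)" shows "module.subspace (gsm act alg) (gHom act C j)"
proof -
  interpret v: vector_space "gsm act alg" by (rule vector_space_gsm)
  show ?thesis unfolding v.subspace_def using assms
    by (auto simp: gHom_def zero_fun_def plus_fun_def gsm_def intro: modhom_zero modhom_plus modhom_smul_comp)
qed

lemma EndZ_subspace:
  assumes C: "cplx act C D" shows "module.subspace (gsm act alg) (EndZ act C D j)"
proof -
  interpret v: vector_space "gsm act alg" by (rule vector_space_gsm)
  have "v.subspace (gHom act C j)" using C by (intro gHom_subspace) (simp add: cplx_def)
  moreover have "gdiff D j 0 = 0"
    using C modhom_0 unfolding gdiff_def cplx_def by (fastforce simp: fun_eq_iff)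
  ultimately show ?thesis unfolding v.subspace_def EndZ_def
    by (auto simp: gdiff_plus[OF C] gdiff_gsm[OF C])
qed

lemma EndB_subspace:
  assumes C: "cplx act C D" shows "module.subspace (gsm act alg) (EndB act C D j)"
proof -
  interpret v: vector_space "gsm act alg" by (rule vector_space_gsm)
  have H: "v.subspace (gHom act C (j - 1))" using C by (intro gHom_subspace) (simp add: cplx_def)
  show ?thesis
  proof (rule v.subspaceI)
    have "gdiff D (j - 1) 0 = 0"
      using C modhom_0 unfolding gdiff_def cplx_def by (fastforce simp: fun_eq_iff)
    then show "0 \<in> EndB act C D j" using v.subspace_0[OF H] by (force simp: EndB_def)
    show "x + y \<in> EndB act C D j" if "x \<in> EndB act C D j" "y \<in> EndB act C D j" for x y
    proof -
      obtain f g where "f \<in> gHom act C (j - 1)" "g \<in> gHom act C (j - 1)" "x = gdiff D (j - 1) f" "y = gdiff D (j - 1) g"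
        using \<open>x \<in> _\<close> \<open>y \<in> _\<close> by (auto simp: EndB_def)
      then show ?thesis using v.subspace_add[OF H, of f g] gdiff_plus[OF C, of f _ g] by (auto simp: EndB_def image_iff) metis
    qed
    show "gsm act alg c x \<in> EndB act C D j" if x: "x \<in> EndB act C D j" for c x
    proof -
      obtain f where "f \<in> gHom act C (j - 1)" "x = gdiff D (j - 1) f"
        using x by (auto simp: EndB_def)
      then show ?thesis using v.subspace_scale[OF H, of f c] gdiff_gsm[OF C, of f _ c] by (auto simp: EndB_def image_iff) metis
    qed
  qed
qed

end

text \<open>With \<open>2 \<le> n\<close> the top and bottom projectives sit in different degrees:
  the image of \<beta> is the kernel of \<open>d (n - 1)\<close> rather than of \<alpha>, and the
  cohomological degrees 0 and n-1 are distinct.\<close>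

locale periodic_setup = k_mod act alg for act :: "'m::ab_group_add \<Rightarrow> 'g::ring_1 \<Rightarrow> 'm" and alg :: "'k::field \<Rightarrow> 'g" +
  fixes n :: nat and M :: "'m set" and P :: "nat \<Rightarrow> 'm set" and d :: "nat \<Rightarrow> 'm \<Rightarrow> 'm" and \<alpha> \<beta> :: "'m \<Rightarrow> 'm"
  assumes n: "2 \<le> n" and exact_setup: "exact_setup act n M P d \<alpha> \<beta>"
begin

abbreviation "C \<equiv> finC n P"
abbreviation "D \<equiv> finD n d"

text \<open>The exact sequence, with the two copies of \<open>M\<close> placed in degrees \<open>-1\<close> and \<open>n\<close>.\<close>

definition "RC t = (if t = -1 \<or> t = int n then M else C t)"
definition "RD t = (if t = 0 then \<alpha> else if t = int n then \<beta> else D t)"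

lemma setup_facts:
  shows "submod act M" "\<And>i. i < n \<Longrightarrow> lifting act (P i)"
    "\<And>i. 1 \<le> i \<Longrightarrow> i < n \<Longrightarrow> modhom act (P i) (P (i - 1)) (d i)"
    "modhom act (P 0) M \<alpha>" "modhom act M (P (n - 1)) \<beta>"
    "\<And>x. x \<in> M \<Longrightarrow> \<beta> x = 0 \<Longrightarrow> x = 0"
    "\<beta> ` M = {x \<in> P (n - 1). d (n - 1) x = 0}"
    "\<alpha> ` P 0 = M" "d 1 ` P 1 = {x \<in> P 0. \<alpha> x = 0}"
    "\<And>i. 2 \<le> i \<Longrightarrow> i < n \<Longrightarrow> d i ` P i = {x \<in> P (i - 1). d (i - 1) x = 0}"
proof -
  note e = exact_setup[unfolded exact_setup_def Let_def]
  have c: "submod act M" "\<forall>i<n. fg_projective act (P i)"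
    "\<forall>i. 1 \<le> i \<and> i < n \<longrightarrow> modhom act (P i) (P (i - 1)) (d i)"
    "modhom act (P 0) M \<alpha>" "modhom act M (P (n - 1)) \<beta>"
    "\<forall>x\<in>M. \<beta> x = 0 \<longrightarrow> x = 0" "\<alpha> ` P 0 = M"
    by (insert e; elim conjE; assumption)+
  show "submod act M" "modhom act (P 0) M \<alpha>" "modhom act M (P (n - 1)) \<beta>" "\<alpha> ` P 0 = M"
    using c by simp_all
  show "lifting act (P i)" if "i < n" for i using c(2) that fg_projective_lifting by blast
  show "modhom act (P i) (P (i - 1)) (d i)" if "1 \<le> i" "i < n" for i using c(3) that by blast
  show "x = 0" if "x \<in> M" "\<beta> x = 0" for x using c(6) that by blast
  show "\<beta> ` M = {x \<in> P (n - 1). d (n - 1) x = 0}" using e n by simp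
  have i: "1 \<le> i \<and> i < n \<longrightarrow> d i ` P i = {x \<in> P (i - 1). (if i - 1 = 0 then \<alpha> else d (i - 1)) x = 0}" for i
    using e by (elim conjE) (erule allE, assumption)
  show "d 1 ` P 1 = {x \<in> P 0. \<alpha> x = 0}" using i[of 1] n by simp
  show "d i ` P i = {x \<in> P (i - 1). d (i - 1) x = 0}" if "2 \<le> i" "i < n" for i using i[of i] that by simp
qed

lemmas submod_M = setup_facts(1) and mod_\<alpha> = setup_facts(4) and mod_\<beta> = setup_facts(5)

lemma submod_P: "i < n \<Longrightarrow> submod act (P i)"
  using setup_facts(2) by (simp add: lifting_def)

lemma submod_C: "submod act (C t)"
  by (simp add: finC_def submod_P submod_zero nat_less_iff)

lemma C_0: "C 0 = P 0" and C_top: "C (int n - 1) = P (n - 1)"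
  using n by (auto simp: finC_def nat_diff_distrib)

lemma C_out: "t < 0 \<or> int n \<le> t \<Longrightarrow> C t = {0}"
  by (auto simp: finC_def)

lemma mod_D: "modhom act (C t) (C (t - 1)) (D t)"
proof (cases "1 \<le> t \<and> t < int n")
  case True
  then have "1 \<le> nat t" "nat t < n" by auto
  then show ?thesis using setup_facts(3)[of "nat t"] True by (simp add: finC_def finD_def nat_diff_distrib')
next
  case False
  then have "D t = (\<lambda>x. 0)" by (auto simp: finD_def)
  then show ?thesis using modhom_zero[OF submod_C] by simp
qed

lemma D_out: "t \<le> 0 \<or> int n \<le> t \<Longrightarrow> D t = (\<lambda>x. 0)"
  by (auto simp: finD_def)

lemma exact_aug: "exact_cplx act RC RD"
  unfolding exact_cplx_def
proof (intro allI conjI)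
  fix t
  show "submod act (RC t)" by (simp add: RC_def submod_M submod_C)
  show "modhom act (RC t) (RC (t - 1)) (RD t)"
  proof -
    consider "t = 0" | "t = int n" | "t = -1" | "t = int n + 1" | "t \<noteq> 0" "t \<noteq> int n" "t \<noteq> -1" "t \<noteq> int n + 1" by blast
    then show ?thesis
    proof cases
      case 1
      then show ?thesis using mod_\<alpha> n by (simp add: RC_def RD_def C_0)
    next
      case 2
      then show ?thesis using mod_\<beta> n by (simp add: RC_def RD_def C_top)
    next
      case 3
      then show ?thesis using n by (simp add: RC_def RD_def C_out D_out modhom_zero submod_zero)
    next
      case 4
      then show ?thesis using n by (simp add: RC_def RD_def C_out D_out modhom_zero submod_M)
    next
      case 5
      then show ?thesis using mod_D[of t] by (simp add: RC_def RD_def)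
    qed
  qed
  show "RD (t + 1) ` RC (t + 1) = {x \<in> RC t. RD t x = 0}"
  proof -
    consider "t < -1" | "t = -1" | "t = 0" | "1 \<le> t" "t \<le> int n - 2" | "t = int n - 1" | "t = int n" | "t > int n" by linarith
    then show ?thesis
    proof cases
      case 1
      then show ?thesis using n submod_0[OF submod_M] by (auto simp: RC_def RD_def C_out D_out)
    next
      case 2
      then show ?thesis using n setup_facts(8) by (auto simp: RC_def RD_def C_0 D_out)
    next
      case 3
      then show ?thesis using n setup_facts(9) by (auto simp: RC_def RD_def finC_def finD_def)
    next
      case 4
      define i where "i = nat t + 1"
      have "t = int i - 1" "2 \<le> i" "i < n" using 4 n by (auto simp: i_def)
      then show ?thesis using setup_facts(10)[of i] by (auto simp: RC_def RD_def finC_def finD_def nat_diff_distrib)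
    next
      case 5
      then show ?thesis using n setup_facts(7) by (auto simp: RC_def RD_def finC_def finD_def nat_diff_distrib)
    next
      case 6
      then show ?thesis using n setup_facts(6) submod_0[OF submod_M] modhom_0[OF mod_\<beta>] by (auto simp: RC_def RD_def C_out D_out)
    next
      case 7
      then show ?thesis using n by (auto simp: RC_def RD_def C_out D_out)
    qed
  qed
qed

lemma \<alpha>_d1: "\<alpha> (D 1 x) = 0"
  using exact_cplx_square[OF exact_aug, of 1 x] n by (simp add: RD_def)

lemma d_\<beta>: "D (int n - 1) (\<beta> x) = 0"
  using exact_cplx_square[OF exact_aug, of "int n" x] n by (simp add: RD_def)

lemma cplx_C: "cplx act C D"
proof -
  have "D (t - 1) (D t x) = 0" for t x
  proof -
    consider "t \<le> 0 \<or> int n \<le> t" | "t = 1" | "1 < t" "t < int n" by linarith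
    then show ?thesis
    proof cases
      case 1
      then show ?thesis using modhom_0[OF mod_D[of "t - 1"]] by (simp add: D_out)
    next
      case 2
      then show ?thesis by (simp add: D_out)
    next
      case 3
      then show ?thesis using exact_cplx_square[OF exact_aug, of t x] by (simp add: RD_def)
    qed
  qed
  then show ?thesis using submod_C mod_D by (simp add: cplx_def)
qed

lemma lifting_C: "0 \<le> t \<Longrightarrow> lifting act (C t)"
proof (cases "t < int n")
  case False
  then have "C t = {0}" by (simp add: C_out)
  moreover have "lifting act {0}"
    unfolding lifting_def
  proof (intro conjI submod_zero allI impI)
    fix A B g f assume "submod act A" "modhom act A B g" "modhom act {0} B f"
    then show "\<exists>h. modhom act {0} A h \<and> (\<forall>x. g (h x) = f x)"
      by (intro exI[of _ "\<lambda>x. 0"]) (simp add: modhom_zero modhom_0 modhom_from_zero)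
  qed
  ultimately show ?thesis by simp
qed (simp add: finC_def setup_facts(2) nat_less_iff)

lemma hom_into_aug_acyclic:
  assumes "g \<in> grHom act C RC j" "\<And>t x. hdiff RD D j g t x = 0"
  obtains h where "\<And>t. modhom act (C t) (RC (t - j + 1)) (h t)"
    "\<And>t x. g t x = RD (t - j + 1) (h t x) + isgn j (h (t - 1) (D t x))"
proof -
  have "hdiff RD D j g = 0" using assms(2) by (simp add: fun_eq_iff)
  from hom_acyclic[OF cplx_C C_out lifting_C exact_aug assms(1) this]
  obtain h where h: "h \<in> grHom act C RC (j - 1)" "g = hdiff RD D (j - 1) h" by blast
  show thesis
  proof (rule that[of h])
    show "modhom act (C t) (RC (t - j + 1)) (h t)" for t
      using grHomD[OF h(1), of t] by (simp add: algebra_simps)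
    show "g t x = RD (t - j + 1) (h t x) + isgn j (h (t - 1) (D t x))" for t x
      unfolding h(2) by (simp add: hdiff_def isgn_minus_1 algebra_simps)
  qed
qed

section \<open>Comparing endomorphisms of P with homomorphisms from P to M\<close>

lemma End_zero_component:
  assumes "f \<in> gHom act C i" and "t < 0 \<or> t \<ge> int n \<or> t < i \<or> t \<ge> i + int n"
  shows "f t x = 0"
proof -
  have f: "modhom act (C t) (C (t - i)) (f t)" using assms(1) by (simp add: gHom_def)
  have "C t = {0} \<or> C (t - i) = {0}" using assms(2) C_out by auto
  then show ?thesis using f modhom_from_zero[of act _ "f t"] modhom_into_zero[of act _ "f t"] by metis
qed

text \<open>Surjectivity, up to boundaries, of composition with \<alpha>. Regarded as a map into the
  copy of \<open>M\<close> in degree -1, the cocycle \<phi> has degree \<open>i + 1\<close> in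
  Hom(C, R); a contraction of it consists of an endomorphism \<open>f\<close> and one component
  \<open>a\<close> into that copy.\<close>

lemma End_lift:
  assumes i: "0 \<le> i" and \<phi>: "\<phi> \<in> HZ act C D M i"
  obtains f a where "f \<in> EndZ act C D i" "modhom act (C (i - 1)) M a"
    "\<And>x. \<phi> x = \<alpha> (f i x) - isgn i (a (D i x))"
proof -
  have m\<phi>: "modhom act (C i) M \<phi>" and \<phi>0: "\<And>x. \<phi> (D (i + 1) x) = 0" using \<phi> by (auto simp: HZ_def Hom_def)
  have mR: "modhom act (RC t) (RC (t - 1)) (RD t)" for t using exact_aug by (simp add: exact_cplx_def)
  define g where "g t = (if t = i then \<phi> else (\<lambda>x. 0))" for t
  have "modhom act (C t) (RC (t - (i + 1))) (g t)" for t
    using m\<phi> by (auto simp: g_def RC_def modhom_zero submod_C submod_M)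
  then have g1: "g \<in> grHom act C RC (i + 1)" by (simp add: grHom_def)
  have RDm: "RD (-1) x = 0" for x using n by (simp add: RD_def D_out)
  have g2: "hdiff RD D (i + 1) g t x = 0" for t x
    using \<phi>0 modhom_0[OF mR] RDm by (auto simp: hdiff_def g_def)
  obtain h where h: "\<And>t. modhom act (C t) (RC (t - (i + 1) + 1)) (h t)"
    "\<And>t x. g t x = RD (t - (i + 1) + 1) (h t x) + isgn (i + 1) (h (t - 1) (D t x))"
    using hom_into_aug_acyclic[OF g1 g2] by blast
  have mh: "modhom act (C t) (RC (t - i)) (h t)" for t using h(1)[of t] by simp
  have gh: "g t x = RD (t - i) (h t x) - isgn i (h (t - 1) (D t x))" for t x
    using h(2)[of t x] by (simp add: isgn_plus_1)
  \<comment> \<open>The component at \<open>i - 1\<close> has values in the copy of \<open>M\<close>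
    in degree -1; it is removed here and returned as \<open>a\<close>.\<close>
  define f where "f = h(i - 1 := (\<lambda>x. 0))"
  \<comment> \<open>For \<open>0 \<le> i\<close> the component that would reach the upper copy of
    \<open>M\<close> starts at \<open>i + n\<close>, outside the range of \<open>C\<close>.\<close>
  have h0: "h t x = 0" if "t - i = int n" for t x
    using mh[of t] C_out[of t] i that modhom_from_zero by fastforce
  have "modhom act (C t) (C (t - i)) (f t)" for t
  proof (cases "t = i - 1 \<or> t - i = int n")
    case True
    then have "f t = (\<lambda>x. 0)" using h0 by (auto simp: f_def)
    then show ?thesis using modhom_zero[OF submod_C] by simp
  next
    case False
    then show ?thesis using mh[of t] by (simp add: f_def RC_def split: if_splits)
  qed
  then have f: "f \<in> gHom act C i" by (simp add: gHom_def)
  have "gdiff D i f t x = 0" for t x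
  proof (cases "t \<le> i")
    case True
    then show ?thesis using End_zero_component[OF f, of "t - 1"] by (simp add: gdiff_def D_out)
  next
    case False
    have "RD (t - i) (h t x) = D (t - i) (h t x)"
      using h0[of t x] modhom_0[OF mod_\<beta>] False by (simp add: RD_def D_out)
    then show ?thesis using gh[of t x] False by (simp add: gdiff_def f_def g_def)
  qed
  then have "f \<in> EndZ act C D i" using f by (simp add: EndZ_def fun_eq_iff)
  moreover have "modhom act (C (i - 1)) M (h (i - 1))" using mh[of "i - 1"] by (simp add: RC_def)
  moreover have "\<phi> x = \<alpha> (f i x) - isgn i (h (i - 1) (D i x))" for x
    using gh[of i x] by (simp add: g_def f_def RD_def)
  ultimately show thesis using that by blast
qed

text \<open>Composition with \<beta> as a map into the endomorphism complex. The position
  \<open>i - 1 + n\<close> is forced: an endomorphism of degree \<open>i\<close> sends exactly this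
  term to the top one, where \<beta> lands.\<close>

definition bmap :: "int \<Rightarrow> ('m \<Rightarrow> 'm) \<Rightarrow> int \<Rightarrow> 'm \<Rightarrow> 'm" where
  "bmap i b t x = (if t = i - 1 + int n then \<beta> (b x) else 0)"

lemma bmap_EndZ:
  assumes "b \<in> HZ act C D M (i - 1 + int n)"
  shows "bmap i b \<in> EndZ act C D i"
proof -
  have mb: "modhom act (C (i - 1 + int n)) M b" and b0: "\<And>x. b (D (i + int n) x) = 0"
    using assms by (auto simp: HZ_def Hom_def algebra_simps)
  have e: "bmap i b t = (if t = i - 1 + int n then (\<lambda>x. \<beta> (b x)) else (\<lambda>x. 0))" for t
    by (auto simp: bmap_def)
  have "modhom act (C t) (C (t - i)) (bmap i b t)" for t
    using modhom_comp[OF mb mod_\<beta>] C_top by (auto simp: e modhom_zero submod_C)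
  moreover have "gdiff D i (bmap i b) t x = 0" for t x
    using b0 modhom_0[OF mod_\<beta>] modhom_0[OF mod_D] d_\<beta>
    by (auto simp: gdiff_def bmap_def add.commute)
  ultimately show ?thesis by (auto simp: EndZ_def gHom_def fun_eq_iff)
qed

text \<open>The hypothesis on \<open>a\<close> says that adjoining it to \<open>f\<close> gives a
  cocycle of Hom(C, R). A contraction of this cocycle is an endomorphism together with its
  components into the two copies of \<open>M\<close>; the one into the upper copy is
  \<open>b\<close>.\<close>

lemma End_kernel:
  assumes f: "f \<in> EndZ act C D i" and a: "modhom act (C (i - 1)) M a"
    and fa: "\<And>x. \<alpha> (f i x) = isgn i (a (D i x))"
  obtains h b where "h \<in> gHom act C (i - 1)" "b \<in> HZ act C D M (i - 1 + int n)"
    "f = gdiff D (i - 1) h + bmap i b"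
proof -
  have f1: "f \<in> gHom act C i" and f2: "\<And>t x. gdiff D i f t x = 0" using f by (auto simp: EndZ_def)
  have mf: "modhom act (C t) (C (t - i)) (f t)" for t using f1 by (simp add: gHom_def)
  have mR: "modhom act (RC t) (RC (t - 1)) (RD t)" for t using exact_aug by (simp add: exact_cplx_def)
  define g where "g = f(i - 1 := a)"
  have "modhom act (C t) (RC (t - i)) (g t)" for t
  proof (cases "t - i = int n")
    case True
    then have "f t = (\<lambda>x. 0)" using End_zero_component[OF f1, of t] by (simp add: fun_eq_iff)
    then show ?thesis using True n by (simp add: g_def RC_def modhom_zero submod_M)
  next
    case False
    then show ?thesis using mf[of t] a by (auto simp: g_def RC_def)
  qed
  then have g1: "g \<in> grHom act C RC i" by (simp add: grHom_def)
  have g2: "hdiff RD D i g t x = 0" for t x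
  proof -
    consider "t = i" | "t < i" | "t > i" "t \<noteq> i + int n" | "t = i + int n" "t > i" using n by linarith
    then show ?thesis
    proof cases
      case 1
      then show ?thesis using fa[of x] by (simp add: hdiff_def g_def RD_def)
    next
      case 2
      then show ?thesis using End_zero_component[OF f1, of "t - 1"] by (simp add: hdiff_def g_def RD_def D_out)
    next
      case 3
      then show ?thesis using f2[of t x] by (simp add: hdiff_def gdiff_def g_def RD_def)
    next
      case 4
      then show ?thesis using f2[of t x] End_zero_component[OF f1, of t] modhom_0[OF mod_\<beta>]
        by (simp add: hdiff_def gdiff_def g_def RD_def D_out)
    qed
  qed
  obtain h where mh: "\<And>t. modhom act (C t) (RC (t - i + 1)) (h t)"
    and gh: "\<And>t x. g t x = RD (t - i + 1) (h t x) + isgn i (h (t - 1) (D t x))"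
    using hom_into_aug_acyclic[OF g1 g2] by blast
  define b where "b = h (i - 1 + int n)"
  \<comment> \<open>Both components with values in \<open>M\<close> are removed: the one into degree
    -1 starts at \<open>i - 2\<close>, the one into degree \<open>n\<close> at
    \<open>i - 1 + n\<close>.\<close>
  define h' where "h' = (h(i - 2 := (\<lambda>x. 0)))(i - 1 + int n := (\<lambda>x. 0))"
  have mb: "modhom act (C (i - 1 + int n)) M b" using mh[of "i - 1 + int n"] n by (simp add: b_def RC_def)
  have "modhom act (C t) (C (t - (i - 1))) (h' t)" for t
  proof (cases "t = i - 2 \<or> t = i - 1 + int n")
    case True
    then have "h' t = (\<lambda>x. 0)" by (auto simp: h'_def)
    then show ?thesis using modhom_zero[OF submod_C] by simp
  next
    case False
    moreover have "t - (i - 1) = t - i + 1" by simp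
    ultimately show ?thesis using mh[of t] unfolding \<open>t - (i - 1) = t - i + 1\<close>
      by (auto simp: h'_def RC_def)
  qed
  then have h': "h' \<in> gHom act C (i - 1)" by (simp add: gHom_def)
  \<comment> \<open>The equation for \<open>g\<close> just above the top position contains only
    \<open>b\<close> composed with the differential, as \<open>f\<close> has no component
    there.\<close>
  have "b (D (i + int n) x) = 0" for x
  proof -
    have "g (i + int n) x = 0" using End_zero_component[OF f1, of "i + int n" x] n by (simp add: g_def)
    then show ?thesis using gh[of "i + int n" x] n by (simp add: RD_def D_out b_def algebra_simps)
  qed
  then have "b \<in> HZ act C D M (i - 1 + int n)" using mb by (simp add: HZ_def Hom_def algebra_simps)
  moreover have "f t x = gdiff D (i - 1) h' t x + bmap i b t x" for t x
  proof -
    have gd: "gdiff D (i - 1) h' t x = D (t - i + 1) (h' t x) + isgn i (h' (t - 1) (D t x))"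
      by (simp add: gdiff_def isgn_minus_1 algebra_simps)
    consider "t < i" | "t \<ge> i" "t \<noteq> i - 1 + int n" "t \<noteq> i + int n" | "t = i - 1 + int n" | "t = i + int n" by linarith
    then show ?thesis
    proof cases
      case 1
      then show ?thesis
        using End_zero_component[OF gdiff_gHom[OF cplx_C h'], of t x] End_zero_component[OF f1, of t x] n
        by (simp add: bmap_def)
    next
      case 2
      then show ?thesis unfolding gd using gh[of t x] n by (simp add: h'_def bmap_def g_def RD_def)
    next
      case 3
      then show ?thesis unfolding gd using gh[of t x] n modhom_0[OF mod_D] by (simp add: h'_def bmap_def g_def RD_def b_def D_out)
    next
      case 4
      then show ?thesis using End_zero_component[OF f1, of t x] End_zero_component[OF gdiff_gHom[OF cplx_C h'], of t x]
        by (simp add: bmap_def)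
    qed
  qed
  ultimately show thesis using that h' by (metis (no_types, lifting) ext plus_fun_apply)
qed

text \<open>If \<beta> composed with \<open>b\<close> bounds through \<open>h\<close>, then
  \<open>h\<close> and \<open>-b\<close> glue to a cocycle of Hom(C, R). A contraction of the glued
  map exhibits \<open>b\<close> as a boundary.\<close>

lemma bmap_boundary:
  assumes b: "b \<in> HZ act C D M (i - 1 + int n)" and i: "i \<le> 0"
    and h: "h \<in> gHom act C (i - 1)" "bmap i b = gdiff D (i - 1) h"
  shows "b \<in> HB act C D M (i - 1 + int n)"
proof -
  have mb: "modhom act (C (i - 1 + int n)) M b" and b0: "\<And>x. b (D (i + int n) x) = 0"
    using b by (auto simp: HZ_def Hom_def algebra_simps)
  have mh: "modhom act (C t) (C (t - (i - 1))) (h t)" for t using h(1) by (simp add: gHom_def)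
  have bh: "bmap i b t x = D (t - i + 1) (h t x) + isgn i (h (t - 1) (D t x))" for t x
    unfolding h(2) by (simp add: gdiff_def isgn_minus_1 algebra_simps)
  have sR: "submod act (RC t)" for t using exact_aug by (simp add: exact_cplx_def)
  \<comment> \<open>The minus sign turns the equation \<open>bmap i b = gdiff D (i - 1) h\<close>
    into the vanishing of a differential.\<close>
  define g where "g t = (if t = i - 1 + int n then (\<lambda>x. - b x) else h t)" for t
  have "modhom act (C t) (RC (t - (i - 1))) (g t)" for t
  proof -
    consider "t = i - 1 + int n" | "t = i - 2" | "t \<noteq> i - 1 + int n" "t \<noteq> i - 2" by blast
    then show ?thesis
    proof cases
      case 1
      then show ?thesis using modhom_uminus[OF mb submod_M] by (simp add: g_def RC_def)
    next
      case 2
      then have "g t = (\<lambda>x. 0)" using End_zero_component[OF h(1), of t] n by (simp add: g_def fun_eq_iff)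
      then show ?thesis by (simp add: modhom_zero sR)
    next
      case 3
      then show ?thesis using mh[of t] by (simp add: g_def RC_def)
    qed
  qed
  then have g1: "g \<in> grHom act C RC (i - 1)" by (simp add: grHom_def)
  have g2: "hdiff RD D (i - 1) g t x = 0" for t x
  proof -
    have gd: "hdiff RD D (i - 1) g t x = RD (t - i + 1) (g t x) + isgn i (g (t - 1) (D t x))"
      by (simp add: hdiff_def isgn_minus_1 algebra_simps)
    consider "t < i" | "t \<ge> i" "t \<noteq> i - 1 + int n" "t \<noteq> i + int n" | "t = i - 1 + int n" | "t = i + int n" by linarith
    then show ?thesis
    proof cases
      case 1
      \<comment> \<open>At \<open>t = i - 1\<close> the glued map is followed by \<alpha>, about
        which \<open>h\<close> says nothing. The bound \<open>i \<le> 0\<close> puts this position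
        in negative degree, where \<open>C\<close> is zero.\<close>
      then have 0: "t < 0" using i by simp
      then have "g t x = 0" using 1 End_zero_component[OF h(1), of t x] n by (simp add: g_def)
      moreover have "g (t - 1) 0 = 0" using modhom_0[OF grHomD[OF g1]] .
      ultimately show ?thesis using 0 gd modhom_0[OF mod_\<alpha>] modhom_0[OF mod_\<beta>] modhom_0[OF mod_D]
        by (simp add: RD_def D_out)
    next
      case 2
      then show ?thesis using bh[of t x] n by (simp add: gd bmap_def g_def RD_def)
    next
      case 3
      then show ?thesis unfolding gd using bh[of t x] n modhom_minus[OF mod_\<beta> submod_M]
        by (simp add: bmap_def g_def RD_def D_out)
    next
      case 4
      then show ?thesis unfolding gd using b0[of x] n by (simp add: g_def RD_def D_out add.commute)
    qed
  qed
  obtain k where mk: "\<And>t. modhom act (C t) (RC (t - (i - 1) + 1)) (k t)"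
    and gk: "\<And>t x. g t x = RD (t - (i - 1) + 1) (k t x) + isgn (i - 1) (k (t - 1) (D t x))"
    using hom_into_aug_acyclic[OF g1 g2] by blast
  have "modhom act (C (i - 2 + int n)) M (k (i - 2 + int n))"
    using mk[of "i - 2 + int n"] by (simp add: RC_def algebra_simps)
  then have "(\<lambda>x. isgn i (k (i - 2 + int n) x)) \<in> Hom act (C (i - 1 + int n - 1)) M"
    using modhom_isgn_comp[OF _ submod_M] by (simp add: Hom_def algebra_simps)
  moreover have "b x = isgn i (k (i - 2 + int n) (D (i - 1 + int n) x))" for x
    using gk[of "i - 1 + int n" x] n by (simp add: g_def RD_def D_out isgn_minus_1 algebra_simps)
  ultimately show ?thesis by (auto simp: HB_def fun_eq_iff image_iff intro!: bexI)
qed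

lemma EndB_components: "f \<in> EndB act C D i \<Longrightarrow> \<exists>h\<in>gHom act C (i - 1). \<forall>t x. f t x = D (t - i + 1) (h t x) + isgn i (h (t - 1) (D t x))"
  by (auto simp: EndB_def gdiff_def isgn_minus_1 algebra_simps)

lemma \<alpha>_component_HZ:
  assumes "f \<in> EndZ act C D i"
  shows "(\<lambda>x. \<alpha> (f i x)) \<in> HZ act C D M i"
proof -
  have f1: "f \<in> gHom act C i" and f2: "gdiff D i f (i + 1) x = 0" for x using assms by (auto simp: EndZ_def)
  have "modhom act (C i) (P 0) (f i)" using f1 C_0 by (simp add: gHom_def) (metis diff_self)
  moreover have "\<alpha> (f i (D (i + 1) x)) = 0" for x
  proof -
    have "f i (D (i + 1) x) = isgn i (D 1 (f (i + 1) x))" using f2[of x] by (simp add: gdiff_def)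
    then show ?thesis using modhom_isgn[OF mod_\<alpha> submod_P] n by (simp add: \<alpha>_d1)
  qed
  ultimately show ?thesis using modhom_comp[OF _ mod_\<alpha>] by (simp add: HZ_def Hom_def)
qed

lemma EndB_\<alpha>_component:
  assumes "f \<in> EndB act C D i"
  shows "\<exists>a. modhom act (C (i - 1)) M a \<and> (\<forall>x. \<alpha> (f i x) = a (D i x))"
proof -
  obtain h where h: "h \<in> gHom act C (i - 1)" "\<And>x. f i x = D 1 (h i x) + isgn i (h (i - 1) (D i x))"
    using EndB_components[OF assms] by force
  have mh: "modhom act (C (i - 1)) (P 0) (h (i - 1))"
    using h(1) C_0 by (simp add: gHom_def) (metis diff_self)
  have D1: "D 1 y \<in> P 0" for y using modhom_in_submod[OF mod_D[of 1] submod_C] C_0 by simp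
  have sP: "submod act (P 0)" using n by (simp add: submod_P)
  have "\<alpha> (f i x) = \<alpha> (D 1 (h i x)) + \<alpha> (isgn i (h (i - 1) (D i x)))" for x
    unfolding h(2) using D1 submod_isgn[OF sP modhom_in_submod[OF mh sP]] by (intro modhom_add[OF mod_\<alpha>])
  then have "\<alpha> (f i x) = \<alpha> (isgn i (h (i - 1) (D i x)))" for x by (simp add: \<alpha>_d1)
  moreover have "modhom act (C (i - 1)) M (\<lambda>x. \<alpha> (isgn i (h (i - 1) x)))"
    using modhom_comp[OF modhom_isgn_comp[OF mh sP] mod_\<alpha>] .
  ultimately show ?thesis by blast
qed

text \<open>In positive degrees the term \<open>bmap i b\<close> disappears, because
  \<open>C (i - 1 + n)\<close> is zero. So \<open>End_kernel\<close> gives injectivity and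
  \<open>End_lift\<close> surjectivity of composition with \<alpha>.\<close>

lemma EndZ_sq_iso_pos:
  assumes i: "1 \<le> i"
  shows "sq_iso (gsm act alg) hsm (EndZ act C D i) (EndB act C D i) (HZ act C D M i) (HB act C D M i)"
  unfolding sq_iso_def
proof (intro exI[of _ "\<lambda>f x. \<alpha> (f i x)"] conjI ballI allI)
  fix f assume f: "f \<in> EndZ act C D i"
  have in_P0: "g i x \<in> P 0" if "g \<in> EndZ act C D i" for g x
  proof -
    have "modhom act (C i) (C (i - i)) (g i)" using that unfolding EndZ_def gHom_def by blast
    then show ?thesis using modhom_in_submod[OF _ submod_C, of "C i" "i - i" "g i" x] C_0 by simp
  qed
  show "(\<lambda>x. \<alpha> (f i x)) \<in> HZ act C D M i" by (rule \<alpha>_component_HZ[OF f])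
  show "(\<lambda>x. \<alpha> ((f + g) i x)) = (\<lambda>x. \<alpha> (f i x)) + (\<lambda>x. \<alpha> (g i x))" if g: "g \<in> EndZ act C D i" for g
    using modhom_add[OF mod_\<alpha> in_P0[OF f] in_P0[OF g]] by auto
  show "(\<lambda>x. \<alpha> (gsm act alg c f i x)) = hsm c (\<lambda>x. \<alpha> (f i x))" for c
    using modhom_smul[OF mod_\<alpha> submod_P] n by (simp add: gsm_def hsm_def)
  show "(\<lambda>x. \<alpha> (f i x)) \<in> HB act C D M i \<longleftrightarrow> f \<in> EndB act C D i"
  proof
    assume "(\<lambda>x. \<alpha> (f i x)) \<in> HB act C D M i"
    then obtain a where a: "modhom act (C (i - 1)) M a" "\<And>x. \<alpha> (f i x) = a (D i x)"
      by (auto simp: HB_def Hom_def fun_eq_iff)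
    obtain h b where hb: "h \<in> gHom act C (i - 1)" "b \<in> HZ act C D M (i - 1 + int n)"
      "f = gdiff D (i - 1) h + bmap i b"
      using End_kernel[OF f modhom_isgn_comp[OF a(1) submod_M, of i]] a(2) by auto
    have "modhom act {0} M b" using hb(2) i n C_out[of "i - 1 + int n"] by (simp add: HZ_def Hom_def)
    then have "b x = 0" for x using modhom_from_zero by blast
    then have "bmap i b = 0" using modhom_0[OF mod_\<beta>] by (simp add: bmap_def fun_eq_iff)
    then show "f \<in> EndB act C D i" using hb by (simp add: EndB_def)
  next
    assume "f \<in> EndB act C D i"
    from EndB_\<alpha>_component[OF this] show "(\<lambda>x. \<alpha> (f i x)) \<in> HB act C D M i"
      by (auto simp: HB_def Hom_def fun_eq_iff)
  qed
next
  fix \<phi> assume "\<phi> \<in> HZ act C D M i"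
  then obtain f a where f: "f \<in> EndZ act C D i" and a: "modhom act (C (i - 1)) M a"
    "\<And>x. \<phi> x = \<alpha> (f i x) - isgn i (a (D i x))"
    using End_lift[of i \<phi>] i by auto
  have "modhom act (C (i - 1)) M (\<lambda>x. - isgn i (a x))"
    by (intro modhom_uminus modhom_isgn_comp a(1) submod_M)
  moreover have "\<phi> - (\<lambda>x. \<alpha> (f i x)) = (\<lambda>x. - isgn i (a (D i x)))"
    by (simp add: a(2) fun_eq_iff)
  ultimately have "\<phi> - (\<lambda>x. \<alpha> (f i x)) \<in> HB act C D M i"
    unfolding HB_def Hom_def by (intro image_eqI[of _ _ "\<lambda>x. - isgn i (a x)"]) simp_all
  then show "\<exists>f\<in>EndZ act C D i. \<phi> - (\<lambda>x. \<alpha> (f i x)) \<in> HB act C D M i"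
    using f by blast
qed

text \<open>For \<open>i \<le> 0\<close> Hom(C, M) has no boundaries in degree \<open>i\<close>, so
  these are exactly the cocycles whose class dies under composition with \<alpha>.\<close>

definition "EndK i = {f \<in> EndZ act C D i. \<forall>x. \<alpha> (f i x) = 0}"

text \<open>\<open>End_kernel\<close> with \<open>a = 0\<close> shows that \<open>bmap\<close> hits
  every class, and \<open>bmap_boundary\<close> that it reflects boundaries.\<close>

lemma EndK_sq_iso:
  assumes i: "i \<le> 0"
  shows "sq_iso hsm (gsm act alg) (HZ act C D M (i - 1 + int n)) (HB act C D M (i - 1 + int n)) (EndK i) (EndB act C D i)"
  unfolding sq_iso_def
proof (intro exI[of _ "bmap i"] conjI ballI allI)
  fix b assume b: "b \<in> HZ act C D M (i - 1 + int n)"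
  have mb: "modhom act (C (i - 1 + int n)) M b" using b by (simp add: HZ_def Hom_def)
  show "bmap i b \<in> EndK i" using bmap_EndZ[OF b] n modhom_0[OF mod_\<alpha>] by (simp add: EndK_def bmap_def)
  show "bmap i (b + c) = bmap i b + bmap i c" if c: "c \<in> HZ act C D M (i - 1 + int n)" for c
  proof -
    have "modhom act (C (i - 1 + int n)) M c" using c by (simp add: HZ_def Hom_def)
    then show ?thesis
      using modhom_add[OF mod_\<beta> modhom_in_submod[OF mb submod_M] modhom_in_submod[OF _ submod_M]]
      by (auto simp: bmap_def fun_eq_iff)
  qed
  show "bmap i (hsm c b) = gsm act alg c (bmap i b)" for c
    by (auto simp: bmap_def hsm_def gsm_def fun_eq_iff modhom_smul[OF mod_\<beta> submod_M])
  show "bmap i b \<in> EndB act C D i \<longleftrightarrow> b \<in> HB act C D M (i - 1 + int n)"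
  proof
    assume "bmap i b \<in> EndB act C D i"
    then show "b \<in> HB act C D M (i - 1 + int n)" using bmap_boundary[OF b i] by (auto simp: EndB_def)
  next
    assume "b \<in> HB act C D M (i - 1 + int n)"
    then obtain c where c: "modhom act (C (i - 2 + int n)) M c" "\<And>x. b x = c (D (i - 1 + int n) x)"
      by (auto simp: HB_def Hom_def algebra_simps)
    \<comment> \<open>If \<open>b\<close> factors as \<open>c\<close> after \<open>D\<close>, then
      \<beta> composed with \<open>c\<close> is a bounding map one position lower. Its other term
      vanishes because \<open>D (n - 1)\<close> kills the image of \<beta>.\<close>
    define h where "h t = (if t = i - 2 + int n then (\<lambda>x. isgn i (\<beta> (c x))) else (\<lambda>x. 0))" for t
    have "modhom act (C t) (C (t - (i - 1))) (h t)" for t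
      using modhom_isgn_comp[OF modhom_comp[OF c(1) mod_\<beta>], of i] n C_top
      by (auto simp: h_def modhom_zero submod_C submod_P)
    then have "h \<in> gHom act C (i - 1)" by (simp add: gHom_def)
    moreover have "bmap i b t x = gdiff D (i - 1) h t x" for t x
    proof -
      have gd: "gdiff D (i - 1) h t x = D (t - i + 1) (h t x) + isgn i (h (t - 1) (D t x))"
        by (simp add: gdiff_def isgn_minus_1 algebra_simps)
      have c0: "c 0 = 0" by (rule modhom_0[OF c(1)])
      consider "t = i - 1 + int n" | "t = i - 2 + int n" | "t \<noteq> i - 1 + int n" "t \<noteq> i - 2 + int n" by blast
      then show ?thesis
      proof cases
        case 1
        then show ?thesis unfolding gd by (simp add: bmap_def h_def c(2) D_out)
      next
        case 2
        then show ?thesis unfolding gd using n d_\<beta>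
          by (simp add: bmap_def h_def modhom_isgn[OF mod_D submod_C])
      next
        case 3
        then show ?thesis unfolding gd using modhom_0[OF mod_D] by (simp add: bmap_def h_def)
      qed
    qed
    ultimately show "bmap i b \<in> EndB act C D i"
      unfolding EndB_def by (intro image_eqI[of _ _ h]) (auto simp: fun_eq_iff)
  qed
next
  fix f assume f: "f \<in> EndK i"
  then have "f \<in> EndZ act C D i" "\<And>x. \<alpha> (f i x) = isgn i 0" by (auto simp: EndK_def)
  then obtain h b where "h \<in> gHom act C (i - 1)" "b \<in> HZ act C D M (i - 1 + int n)"
      "f = gdiff D (i - 1) h + bmap i b"
    using End_kernel[OF _ modhom_zero[OF submod_M], of f i] by blast
  then show "\<exists>b\<in>HZ act C D M (i - 1 + int n). f - bmap i b \<in> EndB act C D i"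
    by (intro bexI[of _ b]) (auto simp: EndB_def)
qed

lemma EndK_neg:
  assumes "i < 0" shows "EndK i = EndZ act C D i"
proof -
  have "\<alpha> (f i x) = 0" if "f \<in> EndZ act C D i" for f x
    using End_zero_component[of f i i x] that assms modhom_0[OF mod_\<alpha>] by (simp add: EndZ_def)
  then show ?thesis by (auto simp: EndK_def)
qed

lemma EndB_subset_EndK:
  assumes "i \<le> 0" shows "EndB act C D i \<subseteq> EndK i"
proof
  fix f assume f: "f \<in> EndB act C D i"
  then obtain a where "modhom act (C (i - 1)) M a" "\<forall>x. \<alpha> (f i x) = a (D i x)"
    using EndB_\<alpha>_component by blast
  then have "\<alpha> (f i x) = 0" for x using modhom_0[of act _ M a] assms by (simp add: D_out)
  then show "f \<in> EndK i" using EndB_subset_EndZ[OF cplx_C] f by (auto simp: EndK_def)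
qed

lemma EndK_subspace: "module.subspace (gsm act alg) (EndK i)"
proof -
  interpret v: vector_space "gsm act alg" by (rule vector_space_gsm)
  have in_P0: "g i x \<in> P 0" if "g \<in> EndZ act C D i" for g x
  proof -
    have "modhom act (C i) (C (i - i)) (g i)" using that unfolding EndZ_def gHom_def by blast
    then show ?thesis using modhom_in_submod[OF _ submod_C, of "C i" "i - i" "g i" x] C_0 by simp
  qed
  have sc: "\<alpha> (gsm act alg c f i x) = smul c (\<alpha> (f i x))" for c f x
    using modhom_smul[OF mod_\<alpha> submod_P] n by (simp add: gsm_def)
  show ?thesis
    using EndZ_subspace[OF cplx_C, of i] unfolding v.subspace_def EndK_def
    by (auto simp: sc modhom_0[OF mod_\<alpha>] modhom_add[OF mod_\<alpha> in_P0 in_P0])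
qed

text \<open>The chosen preimage does not matter when \<open>f\<close> is a cocycle of degree \<open>0\<close>.\<close>

definition induced :: "(int \<Rightarrow> 'm \<Rightarrow> 'm) \<Rightarrow> 'm \<Rightarrow> 'm" where
  "induced f x = (if x \<in> M then \<alpha> (f 0 (SOME y. y \<in> P 0 \<and> \<alpha> y = x)) else 0)"

text \<open>Two preimages under \<alpha> differ by an element of the image of \<open>d 1\<close>,
  and the cocycle condition makes \<alpha> composed with \<open>f 0\<close> vanish there.\<close>

lemma induced_\<alpha>:
  assumes f: "f \<in> EndZ act C D 0" and y: "y \<in> P 0"
  shows "induced f (\<alpha> y) = \<alpha> (f 0 y)"
proof -
  define z where "z = (SOME z. z \<in> P 0 \<and> \<alpha> z = \<alpha> y)"
  have z: "z \<in> P 0" "\<alpha> z = \<alpha> y" unfolding z_def using someI[of "\<lambda>z. z \<in> P 0 \<and> \<alpha> z = \<alpha> y" y] y by auto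
  have sP: "submod act (P 0)" using n by (simp add: submod_P)
  have "\<alpha> (z - y) = 0" using modhom_diff[OF mod_\<alpha> sP z(1) y] z by simp
  then obtain w where w: "z - y = d 1 w" "w \<in> P 1" using setup_facts(9) submod_diff[OF sP z(1) y] by (auto simp: set_eq_iff image_iff)
  have "D 1 w = d 1 w" using n by (simp add: finD_def)
  have mf: "modhom act (P 0) (P 0) (f 0)" using f C_0 unfolding EndZ_def gHom_def by (auto dest: spec[of _ 0])
  have "\<alpha> (f 0 (D 1 w)) = 0" using \<alpha>_component_HZ[OF f] by (simp add: HZ_def)
  then have "\<alpha> (f 0 (z - y)) = 0" using w \<open>D 1 w = d 1 w\<close> by simp
  then have "\<alpha> (f 0 z) = \<alpha> (f 0 y)"
    using modhom_diff[OF mf sP z(1) y] modhom_diff[OF mod_\<alpha> sP modhom_in[OF mf z(1)] modhom_in[OF mf y]] by simp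
  then show ?thesis using modhom_in[OF mod_\<alpha> y] by (simp add: induced_def z_def)
qed

text \<open>What \<open>sq_iso_dsum_snoc\<close> needs in order to split off Hom(M, M):
  \<open>induced\<close> is linear on cocycles of degree 0 and its kernel is
  \<open>EndK 0\<close>.\<close>

lemma induced_props:
  assumes f: "f \<in> EndZ act C D 0"
  shows "induced f \<in> Hom act M M"
    "g \<in> EndZ act C D 0 \<Longrightarrow> induced (f + g) = induced f + induced g"
    "induced (gsm act alg c f) = hsm c (induced f)"
    "induced f = 0 \<longleftrightarrow> f \<in> EndK 0"
proof -
  interpret v: vector_space "gsm act alg" by (rule vector_space_gsm)
  have sP: "submod act (P 0)" using n by (simp add: submod_P)
  have mf: "modhom act (P 0) (P 0) (f 0)" if "f \<in> EndZ act C D 0" for f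
    using that C_0 unfolding EndZ_def gHom_def by (auto dest: spec[of _ 0])
  have M: "\<exists>y\<in>P 0. x = \<alpha> y" if "x \<in> M" for x using setup_facts(8) that by auto
  have out: "induced f x = 0" if "x \<notin> M" for x f using that by (simp add: induced_def)
  note Mf = modhom_comp[OF mf mod_\<alpha>]
  show "induced f \<in> Hom act M M"
    unfolding Hom_def modhom_def
  proof (intro CollectI conjI ballI allI impI)
    fix x assume "x \<in> M"
    then obtain y where y: "y \<in> P 0" "x = \<alpha> y" using M by blast
    show "induced f x \<in> M" using modhom_in[OF Mf[OF f] y(1)] by (simp add: y(2) induced_\<alpha>[OF f y(1)])
    show "induced f (act x r) = act (induced f x) r" for r
    proof -
      have yr: "act y r \<in> P 0" using sP y(1) by (simp add: submod_def)
      have "act x r = \<alpha> (act y r)" using mod_\<alpha> y by (simp add: modhom_def)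
      then show ?thesis using Mf[OF f] y(1) by (simp add: induced_\<alpha>[OF f] yr y(2) modhom_def)
    qed
    fix x' assume "x' \<in> M"
    then obtain y' where y': "y' \<in> P 0" "x' = \<alpha> y'" using M by blast
    have "x + x' = \<alpha> (y + y')" using modhom_add[OF mod_\<alpha>] y y' by simp
    then show "induced f (x + x') = induced f x + induced f x'"
      using modhom_add[OF Mf[OF f] y(1) y'(1)] submod_add[OF sP y(1) y'(1)]
      by (simp add: induced_\<alpha>[OF f] y y')
  qed (simp add: out)
  show "induced (f + g) = induced f + induced g" if g: "g \<in> EndZ act C D 0"
  proof
    fix x
    have fg: "f + g \<in> EndZ act C D 0" using v.subspace_add[OF EndZ_subspace[OF cplx_C] f g] .
    show "induced (f + g) x = (induced f + induced g) x"
    proof (cases "x \<in> M")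
      case True
      then obtain y where y: "y \<in> P 0" "x = \<alpha> y" using M by blast
      then show ?thesis using modhom_add[OF mod_\<alpha> modhom_in[OF mf[OF f] y(1)] modhom_in[OF mf[OF g] y(1)]]
        by (simp add: induced_\<alpha> f g fg)
    qed (simp add: out)
  qed
  show "induced (gsm act alg c f) = hsm c (induced f)"
  proof
    fix x
    have cf: "gsm act alg c f \<in> EndZ act C D 0" using v.subspace_scale[OF EndZ_subspace[OF cplx_C] f] .
    show "induced (gsm act alg c f) x = hsm c (induced f) x"
    proof (cases "x \<in> M")
      case True
      then obtain y where y: "y \<in> P 0" "x = \<alpha> y" using M by blast
      then show ?thesis unfolding y(2) induced_\<alpha>[OF cf y(1)]
        by (simp add: induced_\<alpha>[OF f] hsm_def gsm_def modhom_smul[OF mod_\<alpha> sP])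
    qed (simp add: out hsm_def)
  qed
  show "induced f = 0 \<longleftrightarrow> f \<in> EndK 0"
  proof
    assume 0: "induced f = 0"
    have "\<alpha> (f 0 y) = 0" for y
    proof (cases "y \<in> P 0")
      case True
      then show ?thesis using induced_\<alpha>[OF f True] 0 by simp
    qed (simp add: modhom_out[OF mf[OF f]] modhom_0[OF mod_\<alpha>])
    then show "f \<in> EndK 0" using f by (simp add: EndK_def)
  qed (auto simp: EndK_def induced_def fun_eq_iff)
qed

text \<open>The map \<psi> composed with \<alpha> is a cocycle of Hom(P, M) in degree 0, so
  \<open>End_lift\<close> applies; the error term disappears because \<open>D 0\<close> is
  zero.\<close>

lemma induced_surj:
  assumes "\<psi> \<in> Hom act M M" shows "\<exists>f\<in>EndZ act C D 0. induced f = \<psi>"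
proof -
  have m: "modhom act M M \<psi>" using assms by (simp add: Hom_def)
  have "(\<lambda>x. \<psi> (\<alpha> x)) \<in> HZ act C D M 0"
    using modhom_comp[OF mod_\<alpha> m] by (simp add: HZ_def Hom_def C_0 \<alpha>_d1 modhom_0[OF m])
  then obtain f a where f: "f \<in> EndZ act C D 0" and a: "modhom act (C (0 - 1)) M a"
    "\<And>x. \<psi> (\<alpha> x) = \<alpha> (f 0 x) - isgn 0 (a (D 0 x))"
    using End_lift[of 0] by blast
  have "induced f x = \<psi> x" for x
  proof (cases "x \<in> M")
    case True
    then obtain y where y: "y \<in> P 0" "x = \<alpha> y" using setup_facts(8) by auto
    then show ?thesis using a(2)[of y] modhom_0[OF a(1)] by (simp add: induced_\<alpha>[OF f] D_out)
  qed (simp add: induced_def modhom_out[OF m])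
  then show ?thesis using f by blast
qed

section \<open>The periodic complex, without signs, as a projective resolution of M\<close>

definition "PP t = P (t mod n)"
definition "dP t = (if t mod n = 0 then d0 \<alpha> \<beta> else d (t mod n))"

lemma d0_mod: "modhom act (P 0) (P (n - 1)) (d0 \<alpha> \<beta>)"
  using modhom_comp[OF mod_\<alpha> mod_\<beta>] by (simp add: d0_def comp_def)

lemma \<beta>_\<alpha>_eq_0: "x \<in> P 0 \<Longrightarrow> \<beta> (\<alpha> x) = 0 \<longleftrightarrow> \<alpha> x = 0"
  using setup_facts(6) modhom_in[OF mod_\<alpha>] modhom_0[OF mod_\<beta>] by auto

text \<open>Copies of the exact sequence are spliced along \<open>M\<close>. Since \<beta> is
  injective on \<open>M\<close> and \<alpha> maps onto it, \<beta> composed with \<alpha> has the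
  kernel of \<alpha> and the image of \<beta>.\<close>

lemma periodic_resolves: "resolves act (natC PP) (natD dP) M \<alpha>"
proof (rule resolves_natI)
  show "lifting act (PP t)" for t using n by (simp add: PP_def setup_facts(2))
  have Suc_mod: "Suc t mod n = (if t mod n = n - 1 then 0 else Suc (t mod n))" for t
    using n by (auto simp: mod_Suc)
  show "modhom act (PP t) (PP (t - 1)) (dP t)" if "1 \<le> t" for t
  proof -
    define s where "s = t - 1"
    have t: "t = Suc s" using that by (simp add: s_def)
    have "s mod n < n" using n by simp
    then show ?thesis using d0_mod setup_facts(3)[of "Suc (s mod n)"]
      by (auto simp: t PP_def dP_def Suc_mod)
  qed
  show "dP 1 ` PP 1 = {x \<in> PP 0. \<alpha> x = 0}" using n setup_facts(9) by (simp add: PP_def dP_def)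
  show "dP (t + 1) ` PP (t + 1) = {x \<in> PP t. dP t x = 0}" if "1 \<le> t" for t
  proof -
    have r: "t mod n < n" using n by simp
    consider "t mod n = n - 1" | "t mod n = 0" | "1 \<le> t mod n" "t mod n \<noteq> n - 1" by linarith
    then show ?thesis
    proof cases
      case 1
      have "d0 \<alpha> \<beta> ` P 0 = \<beta> ` (\<alpha> ` P 0)" by (auto simp: d0_def)
      then show ?thesis using 1 n setup_facts(7,8) by (simp add: PP_def dP_def Suc_mod)
    next
      case 2
      then show ?thesis using n setup_facts(9) \<beta>_\<alpha>_eq_0 by (auto simp: PP_def dP_def Suc_mod d0_def)
    next
      case 3
      then show ?thesis using r setup_facts(10)[of "Suc (t mod n)"] by (simp add: PP_def dP_def Suc_mod)
    qed
  qed
qed (use mod_\<alpha> setup_facts(8) submod_M in \<open>auto simp: PP_def\<close>)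

lemma natC_PP: "0 \<le> t \<Longrightarrow> t < int n \<Longrightarrow> natC PP t = C t"
  by (simp add: natC_def finC_def PP_def nat_less_iff)

lemma natD_dP: "t < int n \<Longrightarrow> natD dP t = D t"
  by (auto simp: natD_def finD_def dP_def nat_less_iff)

lemma HB_periodic:
  assumes "0 \<le> t" "t < int n" shows "HB act (natC PP) (natD dP) M t = HB act C D M t"
proof (cases "t = 0")
  case True
  then show ?thesis using assms by (simp add: HB_def natD_dP natC_def finC_def)
next
  case False
  then show ?thesis using assms by (simp add: HB_def natD_dP natC_PP)
qed

lemma HZ_periodic: "0 \<le> t \<Longrightarrow> t \<le> int n - 2 \<Longrightarrow> HZ act (natC PP) (natD dP) M t = HZ act C D M t"
  by (auto simp: HZ_def natD_dP natC_PP)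

lemma HZ_top: "HZ act C D M (int n - 1) = Hom act (P (n - 1)) M"
  by (auto simp: HZ_def C_top Hom_def D_out modhom_0)

text \<open>In degree n-1 the finite complex imposes no cocycle condition (\<open>HZ_top\<close>),
  while the periodic one continues with \<open>d0\<close>. This gap is the source of the summand
  \<open>ImD0\<close>.\<close>

lemma HZ_periodic_top:
  "HZ act (natC PP) (natD dP) M (int n - 1) = {\<phi> \<in> Hom act (P (n - 1)) M. \<phi> \<circ> d0 \<alpha> \<beta> = 0}"
  using n by (auto simp: HZ_def natC_PP C_top natD_def dP_def fun_eq_iff)

text \<open>Recognising the image as the boundaries one degree higher in the periodic complex makes
  it a subspace by \<open>HB_subspace\<close>.\<close>

lemma ImD0_eq_HB: "ImD0 act n M P \<alpha> \<beta> = HB act (natC PP) (natD dP) M (int n)"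
  using n by (simp add: ImD0_def HB_def natC_PP C_top natD_def dP_def comp_def)

lemma dssm_eq: "dssm act alg c v = (\<lambda>j. hsm c (v j))"
  by (simp add: dssm_def hsm_def)

lemma dsB_add:
  assumes "\<And>Z B x y. (Z, B) \<in> set L \<Longrightarrow> x \<in> B \<Longrightarrow> y \<in> B \<Longrightarrow> x + y \<in> B" "v \<in> dsB L" "w \<in> dsB L"
  shows "v + w \<in> (dsB L :: (nat \<Rightarrow> 'x::ab_group_add) set)"
  using assms(2,3) assms(1)[of "fst (L ! j)" "snd (L ! j)" for j] by (auto simp: dsB_def)

section \<open>Identification of the summands with Ext, degree by degree\<close>

context
  fixes Q :: "nat \<Rightarrow> 'm set" and dQ :: "nat \<Rightarrow> 'm \<Rightarrow> 'm" and eps :: "'m \<Rightarrow> 'm"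
  assumes Q: "proj_resolution act M Q dQ eps"
begin

abbreviation "E j \<equiv> (ExtZ act M Q dQ j, ExtB act M Q dQ j)"
abbreviation "Im \<equiv> (ImD0 act n M P \<alpha> \<beta>, {0})"

lemma HZ_periodic_Ext:
  assumes "0 \<le> t"
  shows "sq_iso hsm hsm (HZ act (natC PP) (natD dP) M t) (HB act (natC PP) (natD dP) M t)
    (ExtZ act M Q dQ (nat t)) (ExtB act M Q dQ (nat t))"
  using resolution_sq_iso[OF periodic_resolves proj_resolution_resolves[OF Q submod_M], of t] assms
  by (simp add: ExtZ_eq_HZ ExtB_eq_HB[OF submod_M])

lemma HZ_Ext:
  assumes "0 \<le> t" "t \<le> int n - 2"
  shows "sq_iso hsm (dssm act alg) (HZ act C D M t) (HB act C D M t) (dsZ [E (nat t)]) (dsB [E (nat t)])"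
  using sq_iso_dsum_singleton[OF HZ_periodic_Ext[OF assms(1)]] assms
  by (simp add: HZ_periodic HB_periodic dssm_eq[abs_def] hsm_def zero_fun_def)

text \<open>Composition with \<open>d0\<close> maps the cocycles in degree n-1 onto
  \<open>ImD0\<close>. Its kernel consists of the cocycles of the periodic resolution, and the
  boundaries of the two complexes agree there, so kernel modulo boundaries is Ext and
  \<open>sq_iso_dsum_snoc\<close> splits off the image.\<close>

lemma HZ_top_Ext:
  "sq_iso hsm (dssm act alg) (HZ act C D M (int n - 1)) (HB act C D M (int n - 1))
     (dsZ [E (n - 1), Im]) (dsB [E (n - 1), Im])"
proof -
  have nn: "nat (int n - 1) = n - 1" by simp
  let ?Z = "HZ act (natC PP) (natD dP) M (int n - 1)" and ?B = "HB act (natC PP) (natD dP) M (int n - 1)"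
  have B: "?B = HB act C D M (int n - 1)" using n by (simp add: HB_periodic)
  have Z: "?Z = {\<phi> \<in> HZ act C D M (int n - 1). \<phi> \<circ> d0 \<alpha> \<beta> = 0}"
    by (simp add: HZ_periodic_top HZ_top)
  have "sq_iso hsm (\<lambda>c v j. hsm c (v j)) ?Z ?B (dsZ [E (n - 1)]) (dsB [E (n - 1)])"
    using sq_iso_dsum_singleton[OF HZ_periodic_Ext[of "int n - 1"]] n by (simp add: hsm_def zero_fun_def nn)
  then have iso: "sq_iso hsm (\<lambda>c v j. hsm c (v j)) {\<phi> \<in> HZ act C D M (int n - 1). \<phi> \<circ> d0 \<alpha> \<beta> = 0}
     (HB act C D M (int n - 1)) (dsZ [E (n - 1)]) (dsB [E (n - 1)])"
    unfolding Z B .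
  have c: "cplx act (natC PP) (natD dP)" using periodic_resolves by (simp add: resolves_def)
  have "sq_iso hsm (\<lambda>c v j. hsm c (v j)) (HZ act C D M (int n - 1)) (HB act C D M (int n - 1))
     (dsZ ([E (n - 1)] @ [Im])) (dsB ([E (n - 1)] @ [Im]))"
  proof (rule sq_iso_dsum_snoc[OF vector_space_hsm vector_space_hsm HZ_subspace[OF submod_M] _ _ _ _ _ _ iso])
    show "module.subspace hsm (ImD0 act n M P \<alpha> \<beta>)" unfolding ImD0_eq_HB by (rule HB_subspace[OF submod_M])
    show "\<phi> \<in> HZ act C D M (int n - 1) \<and> \<phi> \<circ> d0 \<alpha> \<beta> = 0" if "\<phi> \<in> HB act C D M (int n - 1)" for \<phi>
      using HB_subset_HZ[OF c, of M "int n - 1"] that unfolding B[symmetric] Z[symmetric] using Z by blast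
  qed (auto simp: ImD0_def HZ_top hsm_def fun_eq_iff)
  then show ?thesis by (simp add: dssm_eq[abs_def])
qed

lemma Ext_add:
  "x \<in> ExtB act M Q dQ j \<Longrightarrow> y \<in> ExtB act M Q dQ j \<Longrightarrow> x + y \<in> ExtB act M Q dQ j"
proof -
  interpret v: vector_space hsm by (rule vector_space_hsm)
  show "x \<in> ExtB act M Q dQ j \<Longrightarrow> y \<in> ExtB act M Q dQ j \<Longrightarrow> x + y \<in> ExtB act M Q dQ j"
    unfolding ExtB_eq_HB[OF submod_M] using HB_subspace[OF submod_M] by (rule v.subspace_add)
qed

lemma dsB_summands_add:
  assumes "v \<in> dsB (summands act n M P \<alpha> \<beta> Q dQ i)" "w \<in> dsB (summands act n M P \<alpha> \<beta> Q dQ i)"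
  shows "v + w \<in> dsB (summands act n M P \<alpha> \<beta> Q dQ i)"
proof (rule dsB_add[OF _ assms])
  fix Z B x y
  assume "(Z, B) \<in> set (summands act n M P \<alpha> \<beta> Q dQ i)"
  then have "B = {0} \<or> (\<exists>j. B = ExtB act M Q dQ j)"
    by (auto simp: summands_def Let_def zero_fun_def split: if_splits)
  then show "x \<in> B \<Longrightarrow> y \<in> B \<Longrightarrow> x + y \<in> B" using Ext_add by auto
qed

lemma EndK_sq_iso_HZ:
  assumes "i \<le> 0"
  shows "sq_iso (gsm act alg) hsm (EndK i) (EndB act C D i) (HZ act C D M (i - 1 + int n)) (HB act C D M (i - 1 + int n))"
proof -
  interpret v: vector_space hsm by (rule vector_space_hsm)
  show ?thesis
    by (rule sq_iso_sym[OF vector_space_hsm vector_space_gsm HZ_subspace[OF submod_M] EndK_subspace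
       EndB_subspace[OF cplx_C] EndK_sq_iso[OF assms] v.subspace_0 v.subspace_diff])
      (rule HB_subspace[OF submod_M])+
qed

lemma End_sq_iso_summands:
  "sq_iso (gsm act alg) (dssm act alg) (EndZ act C D i) (EndB act C D i)
     (dsZ (summands act n M P \<alpha> \<beta> Q dQ i)) (dsB (summands act n M P \<alpha> \<beta> Q dQ i))"
proof -
  have z: "(\<lambda>x. 0) = (0 :: 'm \<Rightarrow> 'm)" by (simp add: zero_fun_def)
  note S = summands_def[of act n M P \<alpha> \<beta> Q dQ i, unfolded Let_def z]
  have add1: "x + y \<in> dsB [E j]" if "x \<in> dsB [E j]" "y \<in> dsB [E j]" for x y j
    using that Ext_add by (intro dsB_add) auto
  have add2: "x + y \<in> dsB [E j, Im]" if "x \<in> dsB [E j, Im]" "y \<in> dsB [E j, Im]" for x y j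
    using that Ext_add by (intro dsB_add) auto
  note HB_HZ = HB_subset_HZ[OF cplx_C]
  consider "i = 0" | "i = int n - 1" | "- (int n - 1) \<le> i" "i \<le> -1" | "1 \<le> i" "i \<le> int n - 2"
    | "i \<ge> int n \<or> i \<le> - int n" using n by linarith
  then show ?thesis
  proof cases
    case 1
    \<comment> \<open>The kernel of \<open>induced\<close> accounts for the first two summands,
      through \<open>bmap\<close> and the top degree of Hom(P, M); Hom(M, M) is then appended as the
      quotient.\<close>
    have "sq_iso (gsm act alg) (dssm act alg) (EndK 0) (EndB act C D 0) (dsZ [E (n - 1), Im]) (dsB [E (n - 1), Im])"
      using EndK_sq_iso_HZ[of 0] sq_iso_trans[OF _ HZ_top_Ext HB_HZ add2] by simp
    moreover have "EndK 0 = {f \<in> EndZ act C D 0. induced f = 0}"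
      using induced_props(4) by (auto simp: EndK_def)
    ultimately have iso: "sq_iso (gsm act alg) (\<lambda>c v j. hsm c (v j)) {f \<in> EndZ act C D 0. induced f = 0} (EndB act C D 0)
       (dsZ [E (n - 1), Im]) (dsB [E (n - 1), Im])" by (simp add: dssm_eq[abs_def])
    have "sq_iso (gsm act alg) (\<lambda>c v j. hsm c (v j)) (EndZ act C D 0) (EndB act C D 0)
       (dsZ ([E (n - 1), Im] @ [(Hom act M M, {0})])) (dsB ([E (n - 1), Im] @ [(Hom act M M, {0})]))"
    proof (rule sq_iso_dsum_snoc[OF vector_space_gsm vector_space_hsm EndZ_subspace[OF cplx_C] Hom_subspace[OF submod_M]
        _ _ _ _ _ iso])
      show "f \<in> EndZ act C D 0 \<and> induced f = 0" if "f \<in> EndB act C D 0" for f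
        using EndB_subset_EndK[of 0] induced_props(4) that by (auto simp: EndK_def)
    qed (use induced_props induced_surj in auto)
    then show ?thesis unfolding S using 1 by (simp add: dssm_eq[abs_def])
  next
    case 2
    have "sq_iso (gsm act alg) (dssm act alg) (EndZ act C D i) (EndB act C D i) (dsZ [E (n - 1), Im]) (dsB [E (n - 1), Im])"
      using sq_iso_trans[OF EndZ_sq_iso_pos[of i] _ HB_HZ add2] HZ_top_Ext 2 n by simp
    then show ?thesis unfolding S using 2 n by simp
  next
    case 3
    have i: "i - 1 + int n = int n - 1 + i" by simp
    have "sq_iso (gsm act alg) (dssm act alg) (EndK i) (EndB act C D i) (dsZ [E (nat (int n - 1 + i))]) (dsB [E (nat (int n - 1 + i))])"
      using sq_iso_trans[OF EndK_sq_iso_HZ[of i, unfolded i] HZ_Ext[of "int n - 1 + i"] HB_HZ add1] 3 by simp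
    then show ?thesis unfolding S using 3 n by (simp add: EndK_neg)
  next
    case 4
    have "sq_iso (gsm act alg) (dssm act alg) (EndZ act C D i) (EndB act C D i) (dsZ [E (nat i)]) (dsB [E (nat i)])"
      using sq_iso_trans[OF EndZ_sq_iso_pos[of i] HZ_Ext[of i] HB_HZ add1] 4 by simp
    then show ?thesis unfolding S using 4 n by simp
  next
    case 5
    interpret v: vector_space "gsm act alg" by (rule vector_space_gsm)
    \<comment> \<open>When the degree is at least \<open>n\<close> in absolute value, no term of P
      is mapped to another term of P, so there are no nonzero cochains.\<close>
    have z1: "f = 0" if "f \<in> EndZ act C D i" for f
    proof -
      have "f t x = 0" for t x using End_zero_component[of f i t x] 5 that by (fastforce simp: EndZ_def)
      then show ?thesis by (simp add: fun_eq_iff)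
    qed
    have "0 \<in> EndB act C D i" by (rule v.subspace_0[OF EndB_subspace[OF cplx_C]])
    moreover from this have "EndZ act C D i = {0}" using z1 EndB_subset_EndZ[OF cplx_C] by blast
    moreover have "summands act n M P \<alpha> \<beta> Q dQ i = []" using 5 n by (auto simp: S)
    ultimately show ?thesis
      unfolding sq_iso_def by (intro exI[of _ "\<lambda>_. 0"]) (auto simp: dsZ_def dsB_def dssm_eq hsm_def fun_eq_iff)
  qed
qed

end

end

section \<open>The trivial extension algebra\<close>

context periodic_setup
begin

abbreviation "U \<equiv> perC n P"
abbreviation "DU \<equiv> perD n d \<alpha> \<beta>"
abbreviation "\<sigma> \<equiv> sigmaP n U"

text \<open>The sign exponent \<open>e\<close> is kept apart from the degree so that both components
  of the trivial extension are instances; only its parity matters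
  (\<open>twisted_cong\<close>).\<close>

definition "twisted e i = {x \<in> gHom act U i. \<forall>t y. \<sigma> (t - i) (x t y) = isgn e (x (t - int n) (\<sigma> t y))}"

lemma sigE_eq: "sigE act n U i = twisted (int n * i) i"
  unfolding sigE_def twisted_def by (simp add: gcomp_def fun_eq_iff isgn_apply)

lemma msigE_eq: "msigE act n U i = twisted (int n * (i + 1)) i"
  unfolding msigE_def twisted_def by (simp add: gcomp_def fun_eq_iff isgn_apply)

lemma U_eq: "0 \<le> t \<Longrightarrow> U t = C (t mod int n)"
  using n by (simp add: perC_def finC_def nat_mod_distrib nat_less_iff)

lemma U_eq_C: "0 \<le> t \<Longrightarrow> t < int n \<Longrightarrow> U t = C t"
  by (simp add: U_eq)

lemma U_neg: "t < 0 \<Longrightarrow> U t = {0}"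
  by (simp add: perC_def)

lemma U_shift: "int n \<le> t \<Longrightarrow> U (t - int n) = U t"
  by (simp add: U_eq)

lemma U_natC: "U = natC PP"
  by (simp add: perC_def natC_def PP_def fun_eq_iff)

lemma DU_natD: "DU t x = isgn (int (((nat t - 1) div n) * n)) (natD dP t x)"
  by (simp add: perD_def natD_def dP_def)

lemma DU_eq_D:
  assumes "t < int n" shows "DU t = D t"
proof -
  have "nat t - 1 < n" using assms n by linarith
  then have "(nat t - 1) div n = 0" by (rule div_less)
  then have "DU t x = D t x" for x unfolding DU_natD natD_dP[OF assms] by (simp add: isgn_even)
  then show ?thesis by (simp add: fun_eq_iff)
qed

lemma submod_U: "submod act (U t)"
  by (cases "0 \<le> t") (simp_all add: U_eq U_neg submod_C submod_zero)

lemma mod_DU: "modhom act (U t) (U (t - 1)) (DU t)"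
proof -
  have "modhom act (U t) (U (t - 1)) (natD dP t)"
    using periodic_resolves unfolding U_natC by (simp add: resolves_def cplx_def)
  from modhom_isgn_comp[OF this submod_U] show ?thesis by (simp add: DU_natD[abs_def])
qed

lemma DU_0: "t \<le> 0 \<Longrightarrow> DU t x = 0"
  by (simp add: perD_def)

lemma cplx_U: "cplx act U DU"
proof -
  have c: "cplx act U (natD dP)" using periodic_resolves unfolding U_natC by (simp add: resolves_def)
  have "DU (t - 1) (DU t x) = 0" for t x
    using c modhom_isgn[OF mod_DU submod_U] unfolding DU_natD[of t] by (simp add: DU_natD[of "t - 1"] cplx_def)
  then show ?thesis using submod_U mod_DU by (simp add: cplx_def)
qed

lemma mod_\<sigma>: "modhom act (U t) (U (t - int n)) (\<sigma> t)"
proof (cases "int n \<le> t")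
  case True
  then show ?thesis using submod_U[of t] U_shift[OF True]
    by (auto simp: modhom_def sigmaP_def submod_def)
next
  case False
  then have "\<sigma> t = (\<lambda>x. 0)" by (simp add: sigmaP_def fun_eq_iff)
  then show ?thesis using modhom_zero[OF submod_U] by simp
qed

lemma \<sigma>_id: "int n \<le> t \<Longrightarrow> x \<in> U t \<Longrightarrow> \<sigma> t x = x"
  by (simp add: sigmaP_def)

lemma \<sigma>_low: "t < int n \<Longrightarrow> \<sigma> t x = 0"
  by (simp add: sigmaP_def)

text \<open>\<sigma> is a cocycle of degree \<open>n\<close>. Moving down one copy lowers the
  exponent of the sign in the periodic differential by \<open>n\<close>, which is the sign demanded
  by the graded commutator.\<close>

lemma \<sigma>_DU: "\<sigma> (t - 1) (DU t x) = isgn (int n) (DU (t - int n) (\<sigma> t x))"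
proof (cases "int n < t \<and> x \<in> U t")
  case True
  define s where "s = nat (t - int n - 1)"
  have s: "t = int (Suc s + n)" using True by (simp add: s_def)
  have "nat t = Suc s + n" "nat (t - int n) = Suc s" unfolding s by simp_all
  moreover have "(s + n) div n = Suc (s div n)" using n by (subst div_add_self2) auto
  moreover have "natD dP (t - int n) x = natD dP t x"
    using True by (simp add: natD_def dP_def \<open>nat t = _\<close> \<open>nat (t - int n) = _\<close> flip: add_Suc)
  moreover have "DU t x \<in> U (t - 1)" using mod_DU True modhom_in by blast
  ultimately show ?thesis using True
    by (simp add: \<sigma>_id DU_natD isgn_isgn)
next
  case False
  \<comment> \<open>At \<open>t = n\<close> the left side vanishes because \<open>DU\<close> lands
    in the 0-th copy, the right side because \<open>DU 0\<close> is zero.\<close>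
  then have "\<sigma> t x = 0 \<or> t = int n" by (auto simp: sigmaP_def)
  moreover have "x \<notin> U t \<or> t - 1 < int n" using False by auto
  ultimately show ?thesis using modhom_out[OF mod_DU] modhom_0[OF mod_\<sigma>] modhom_0[OF mod_DU] \<sigma>_low DU_0[of 0]
    by auto
qed

text \<open>Each of the two terms of the differential moves \<sigma> past \<open>DU\<close> once, at
  the cost of (-1)^n. Hence the exponent \<open>n j\<close> of degree \<open>j\<close> becomes
  \<open>n (j + 1)\<close>, as degree \<open>j + 1\<close> requires.\<close>

lemma gdiff_twisted:
  assumes x: "x \<in> twisted e i" shows "gdiff DU i x \<in> twisted (e + int n) (i + 1)"
proof -
  have x1: "x \<in> gHom act U i" and x2: "\<And>t y. \<sigma> (t - i) (x t y) = isgn e (x (t - int n) (\<sigma> t y))"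
    using x by (auto simp: twisted_def)
  have mx: "modhom act (U t) (U (t - i)) (x t)" for t using x1 by (simp add: gHom_def)
  have "\<sigma> (t - (i + 1)) (gdiff DU i x t y) = isgn (e + int n) (gdiff DU i x (t - int n) (\<sigma> t y))" for t y
  proof -
    have i: "t - (i + 1) = t - i - 1" "t - (i + 1) = t - 1 - i" "t - i - int n = t - int n - i"
      "t - 1 - int n = t - int n - 1" by simp_all
    have 1: "DU (t - i) (x t y) \<in> U (t - (i + 1))"
      using modhom_in_submod[OF mod_DU submod_U, of "t - i"] by (simp add: i(1))
    have 2: "x (t - 1) (DU t y) \<in> U (t - (i + 1))"
      using modhom_in_submod[OF mx[of "t - 1"] submod_U] by (simp add: i(2))
    have "\<sigma> (t - (i + 1)) (gdiff DU i x t y)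
        = \<sigma> (t - (i + 1)) (DU (t - i) (x t y)) - isgn i (\<sigma> (t - (i + 1)) (x (t - 1) (DU t y)))"
      unfolding gdiff_def modhom_diff[OF mod_\<sigma> submod_U 1 submod_isgn[OF submod_U 2]]
        modhom_isgn[OF mod_\<sigma> submod_U] ..
    also have "\<sigma> (t - (i + 1)) (DU (t - i) (x t y)) = isgn (e + int n) (DU (t - int n - i) (x (t - int n) (\<sigma> t y)))"
      unfolding i(1) \<sigma>_DU x2 modhom_isgn[OF mod_DU submod_U] i(3) isgn_isgn by (simp add: add.commute)
    also have "\<sigma> (t - (i + 1)) (x (t - 1) (DU t y)) = isgn (e + int n) (x (t - int n - 1) (DU (t - int n) (\<sigma> t y)))"
      unfolding i(2) x2 \<sigma>_DU modhom_isgn[OF mx submod_U] isgn_isgn i(4) ..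
    finally show ?thesis unfolding gdiff_def isgn_diff isgn_isgn by (simp add: add.commute)
  qed
  then show ?thesis using gdiff_gHom[OF cplx_U x1] by (simp add: twisted_def)
qed

lemma twisted_cong:
  assumes "even (a - b)" shows "twisted a i = twisted b i"
proof -
  have "isgn a x = isgn b x" for x :: 'm using assms by (rule isgn_cong)
  then show ?thesis by (simp add: twisted_def)
qed

lemma twisted_diff:
  assumes "x \<in> twisted e i" "y \<in> twisted e i" shows "x - y \<in> twisted e i"
proof -
  have x: "modhom act (U t) (U (t - i)) (x t)" and y: "modhom act (U t) (U (t - i)) (y t)" for t
    using assms by (auto simp: twisted_def gHom_def)
  have "\<sigma> (t - i) (x t z - y t z) = isgn e (x (t - int n) (\<sigma> t z) - y (t - int n) (\<sigma> t z))" for t z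
    using modhom_diff[OF mod_\<sigma> submod_U modhom_in_submod[OF x submod_U] modhom_in_submod[OF y submod_U]] assms
    by (simp add: twisted_def isgn_diff)
  then show ?thesis using modhom_sub[OF x y submod_U]
    by (simp add: twisted_def gHom_def fun_diff_def)
qed

lemma twisted_isgn:
  assumes x: "x \<in> twisted e i" shows "isgn c x \<in> twisted e i"
proof -
  have m: "modhom act (U t) (U (t - i)) (x t)" for t
    using x by (auto simp: twisted_def gHom_def)
  have e: "isgn c x = (\<lambda>t y. isgn c (x t y))" by (simp add: isgn_def fun_eq_iff)
  show ?thesis using x modhom_isgn_comp[OF m submod_U] modhom_isgn[OF mod_\<sigma> submod_U]
    unfolding e by (auto simp: twisted_def gHom_def isgn_isgn add.commute)
qed

definition "rmul y = gcomp y (int n) \<sigma>"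

lemma rmul_apply: "rmul y t x = y (t - int n) (\<sigma> t x)"
  by (simp add: rmul_def gcomp_def)

lemma gdiff_rmul:
  assumes "y \<in> gHom act U j"
  shows "gdiff DU (j + int n) (rmul y) = rmul (gdiff DU j y)"
proof -
  have my: "modhom act (U t) (U (t - j)) (y t)" for t using assms by (simp add: gHom_def)
  have "gdiff DU (j + int n) (rmul y) t x = rmul (gdiff DU j y) t x" for t x
  proof -
    have t: "t - (j + int n) = t - int n - j" "t - 1 - int n = t - int n - 1" by simp_all
    have "isgn (j + int n) (isgn (int n) z) = isgn j z" for z :: 'm by (auto simp: isgn_def)
    then show ?thesis
      unfolding gdiff_def rmul_apply \<sigma>_DU modhom_isgn[OF my submod_U] t by simp
  qed
  then show ?thesis by (simp add: fun_eq_iff)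
qed

text \<open>\<sigma> is onto: it maps the term in degree \<open>t + n\<close> identically to the
  term in degree \<open>t\<close>.\<close>

lemma rmul_inj:
  assumes y: "y \<in> gHom act U j" and 0: "rmul y = 0" shows "y = 0"
proof -
  have my: "modhom act (U t) (U (t - j)) (y t)" for t using assms by (simp add: gHom_def)
  have "y t x = 0" for t x
  proof (cases "0 \<le> t \<and> x \<in> U t")
    case True
    then have "\<sigma> (t + int n) x = x" using U_shift[of "t + int n"] by (intro \<sigma>_id) auto
    then show ?thesis using fun_cong[OF fun_cong[OF 0], of "t + int n" x] by (simp add: rmul_apply)
  next
    case False
    then show ?thesis using U_neg[of t] my[of t] modhom_out[OF my] modhom_from_zero[of act _ "y t"] by (metis not_le)
  qed
  then show ?thesis by (simp add: fun_eq_iff)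
qed

lemma rmul_isgn: "rmul (isgn c y) = isgn c (rmul y)"
  by (simp add: rmul_apply fun_eq_iff isgn_apply)

lemma gdiff_isgn:
  assumes "x \<in> gHom act U j" shows "gdiff DU j (isgn c x) = isgn c (gdiff DU j x)"
  by (simp add: gdiff_def fun_eq_iff isgn_apply modhom_isgn[OF mod_DU submod_U] isgn_diff isgn_isgn add.commute)

section \<open>Restriction to the 0-th copy and division by \<sigma>\<close>

definition "res j x = (\<lambda>t y. if 0 \<le> t \<and> t < int n \<and> 0 \<le> t - j \<and> t - j < int n then x t y else (0::'m))"

lemma res_gHom:
  assumes "x \<in> gHom act U j" shows "res j x \<in> gHom act C j"
proof -
  have m: "modhom act (U t) (U (t - j)) (x t)" for t using assms by (simp add: gHom_def)
  have "modhom act (C t) (C (t - j)) (res j x t)" for t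
  proof (cases "0 \<le> t \<and> t < int n \<and> 0 \<le> t - j \<and> t - j < int n")
    case True
    then have "res j x t = x t" by (simp add: res_def fun_eq_iff)
    then show ?thesis using m[of t] True by (simp add: U_eq_C)
  next
    case False
    then have "res j x t = (\<lambda>y. 0)" unfolding res_def by (simp only: if_False)
    then show ?thesis by (simp add: modhom_zero submod_C)
  qed
  then show ?thesis by (simp add: gHom_def)
qed

text \<open>\<sigma> vanishes on the 0-th copy but is injective in degrees at least
  \<open>n\<close>; commutation up to sign thus forbids components from the 0-th copy into higher
  ones.\<close>

lemma twisted_low:
  assumes x: "x \<in> twisted e j" and t: "t < int n" "int n \<le> t - j" shows "x t y = 0"
proof -
  have m: "modhom act (U t) (U (t - j)) (x t)" for t using x by (simp add: twisted_def gHom_def)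
  have "\<sigma> (t - j) (x t y) = isgn e (x (t - int n) (\<sigma> t y))" using x by (simp add: twisted_def)
  then show ?thesis
    using t modhom_0[OF m] modhom_in_submod[OF m submod_U, of t y] by (simp add: \<sigma>_low \<sigma>_id)
qed

lemma res_gdiff:
  assumes x: "x \<in> twisted e j" shows "gdiff D j (res j x) = res (j + 1) (gdiff DU j x)"
proof -
  have x1: "x \<in> gHom act U j" using x by (simp add: twisted_def)
  have m: "modhom act (U t) (U (t - j)) (x t)" for t using x1 by (simp add: gHom_def)
  have "gdiff D j (res j x) t y = res (j + 1) (gdiff DU j x) t y" for t y
  proof (cases "0 \<le> t \<and> t < int n \<and> 0 \<le> t - (j + 1) \<and> t - (j + 1) < int n")
    case True
    have "D (t - j) (res j x t y) = DU (t - j) (x t y)"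
    \<comment> \<open>The one place where the two differentials could disagree: in degree
      \<open>n\<close> the periodic one is \<open>d0\<close> up to sign, the finite one is zero. By
      \<open>twisted_low\<close> nothing arrives there.\<close>
    proof (cases "t - j = int n")
      case n: True
      then show ?thesis using True twisted_low[OF x, of t y] modhom_0[OF mod_DU] by (simp add: D_out)
    next
      case False
      then show ?thesis using True by (simp add: res_def DU_eq_D)
    qed
    moreover have "res j x (t - 1) (D t y) = x (t - 1) (DU t y)"
    proof (cases "t = 0")
      case t: True
      then show ?thesis using modhom_0[OF m] by (simp add: res_def DU_0)
    next
      case False
      then show ?thesis using True by (simp add: res_def DU_eq_D)
    qed
    ultimately show ?thesis using True by (simp add: gdiff_def res_def)
  next
    case False
    then have "gdiff D j (res j x) t y = 0"
      by (intro End_zero_component[OF gdiff_gHom[OF cplx_C res_gHom[OF x1]]]) linarith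
    then show ?thesis using False unfolding res_def by (simp only: if_False)
  qed
  then show ?thesis by (simp add: fun_eq_iff)
qed

lemma res_rmul:
  assumes "y \<in> gHom act U j'" shows "res j (rmul y) = 0"
proof -
  have "y t 0 = 0" for t using assms modhom_0 unfolding gHom_def by blast
  then show ?thesis by (auto simp: res_def rmul_apply \<sigma>_low fun_eq_iff)
qed

lemma res_isgn: "res j (isgn c x) = isgn c (res j x)"
  by (auto simp: res_def isgn_apply fun_eq_iff)

text \<open>The quotient is \<open>x\<close> shifted down by one copy, and it inherits commutation
  with \<sigma> from \<open>x\<close> one copy higher. The vanishing of \<open>res j x\<close>,
  together with \<open>twisted_low\<close>, ensures that the discarded components of
  \<open>x\<close> were zero.\<close>

lemma twisted_divide:
  assumes x: "x \<in> twisted e j" and 0: "res j x = 0"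
  obtains y where "y \<in> twisted e (j - int n)" "x = rmul y"
proof -
  have m: "modhom act (U t) (U (t - j)) (x t)" for t using x by (simp add: twisted_def gHom_def)
  have low: "x t z = 0" if t: "t < int n" for t z
  proof -
    consider "t < 0" | "t - j < 0" | "int n \<le> t - j" | "0 \<le> t" "0 \<le> t - j" "t - j < int n" by linarith
    then show ?thesis
    proof cases
      case 1
      then show ?thesis using m[of t] U_neg[of t] modhom_from_zero[of act _ "x t"] by metis
    next
      case 2
      then show ?thesis using m[of t] U_neg[of "t - j"] modhom_into_zero[of act _ "x t"] by metis
    next
      case 3
      then show ?thesis using twisted_low[OF x t] by simp
    next
      case 4
      then show ?thesis using fun_cong[OF fun_cong[OF 0], of t z] t by (simp add: res_def)
    qed
  qed
  define y where "y t = (if 0 \<le> t then x (t + int n) else (\<lambda>z. 0))" for t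
  have y1: "y \<in> gHom act U (j - int n)"
    unfolding gHom_def
  proof (intro CollectI allI)
    fix t
    have t: "t - (j - int n) = t + int n - j" by simp
    show "modhom act (U t) (U (t - (j - int n))) (y t)"
      unfolding t using m[of "t + int n"] U_shift[of "t + int n"] modhom_zero[OF submod_U] by (simp add: y_def)
  qed
  have xy: "x t z = rmul y t z" for t z
  proof (cases "int n \<le> t \<and> z \<in> U t")
    case True
    then show ?thesis by (simp add: rmul_apply \<sigma>_id y_def)
  next
    case False
    have "y (t - int n) 0 = 0" using modhom_0[OF m] by (simp add: y_def)
    moreover have "\<sigma> t z = 0" using False by (auto simp: sigmaP_def)
    moreover have "x t z = 0" using False low modhom_out[OF m] by (meson not_le)
    ultimately show ?thesis by (simp add: rmul_apply)
  qed
  have "\<sigma> (t - (j - int n)) (y t z) = isgn e (y (t - int n) (\<sigma> t z))" for t z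
  proof (cases "0 \<le> t \<and> z \<in> U t")
    case True
    have "\<sigma> (t + int n - j) (x (t + int n) z) = isgn e (x (t + int n - int n) (\<sigma> (t + int n) z))"
      using x unfolding twisted_def by blast
    moreover have "\<sigma> (t + int n) z = z" using True U_shift[of "t + int n"] by (intro \<sigma>_id) auto
    moreover have "x t z = y (t - int n) (\<sigma> t z)" using xy by (simp add: rmul_apply)
    moreover have "t + int n - j = t - (j - int n)" by simp
    ultimately show ?thesis using True by (simp add: y_def)
  next
    case False
    have "\<sigma> t z = 0" using False n by (auto simp: sigmaP_def)
    moreover have "y (t - int n) 0 = 0" using modhom_0[OF m] by (simp add: y_def)
    moreover have "y t z = 0"
    proof (cases "z \<in> U t")
      case True
      then show ?thesis using False by (simp add: y_def)
    next
      case z: False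
      have "modhom act (U t) (U (t - (j - int n))) (y t)" using y1 by (simp add: gHom_def)
      then show ?thesis using z by (rule modhom_out)
    qed
    ultimately show ?thesis using modhom_0[OF mod_\<sigma>] by simp
  qed
  then have "y \<in> twisted e (j - int n)" using y1 by (simp add: twisted_def)
  moreover have "x = rmul y" using xy by (simp add: fun_eq_iff)
  ultimately show thesis using that by blast
qed

text \<open>The sign is forced by commutation with \<open>\<sigma>\<close> up to \<open>(-1)^(n j)\<close>.\<close>

definition "extend j f = (\<lambda>t y. if 0 \<le> t \<and> t div int n = (t - j) div int n
   then isgn (int n * j * (t div int n)) (f (t mod int n) y) else (0::'m))"

lemma div_eq_cond:
  assumes "0 \<le> t" "t div int n = (t - j) div int n"
  shows "0 \<le> t - j" "(t - j) mod int n = t mod int n - j"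
proof -
  have "0 \<le> t div int n" using assms(1) n by (simp add: pos_imp_zdiv_nonneg_iff)
  then show "0 \<le> t - j" using assms(2) n by (simp add: pos_imp_zdiv_nonneg_iff)
  show "(t - j) mod int n = t mod int n - j"
    using div_mult_mod_eq[of t "int n"] div_mult_mod_eq[of "t - j" "int n"] unfolding assms(2) by linarith
qed

lemma extend_twisted:
  assumes f: "f \<in> gHom act C j" shows "extend j f \<in> twisted (int n * j) j"
proof -
  have m: "modhom act (C t) (C (t - j)) (f t)" for t using f by (simp add: gHom_def)
  have me: "modhom act (U t) (U (t - j)) (extend j f t)" for t
  proof (cases "0 \<le> t \<and> t div int n = (t - j) div int n")
    case True
    then have "U t = C (t mod int n)" "U (t - j) = C (t mod int n - j)"
      using div_eq_cond[of t j] by (simp_all add: U_eq)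
    moreover have "extend j f t = (\<lambda>y. isgn (int n * j * (t div int n)) (f (t mod int n) y))"
      using True by (simp add: extend_def fun_eq_iff)
    ultimately show ?thesis using modhom_isgn_comp[OF m submod_C] by simp
  next
    case False
    then have "extend j f t = (\<lambda>y. 0)" unfolding extend_def by (simp only: if_False)
    then show ?thesis by (simp add: modhom_zero submod_U)
  qed
  have nn: "0 < int n" using n by simp
  have "\<sigma> (t - j) (extend j f t y) = isgn (int n * j) (extend j f (t - int n) (\<sigma> t y))" for t y
  proof (cases "int n \<le> t \<and> y \<in> U t")
    case False
    then have "\<sigma> t y = 0" by (auto simp: sigmaP_def)
    moreover have "\<sigma> (t - j) (extend j f t y) = 0"
    proof (cases "y \<in> U t \<and> 0 \<le> t \<and> t div int n = (t - j) div int n")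
      case True
      then have "t < int n" using False by auto
      \<comment> \<open>A component that starts in the 0-th copy also ends there, so \<sigma> kills
        its value.\<close>
      then have "(t - j) div int n = 0" using True by (metis div_pos_pos_trivial)
      then have "t - j < int n" using nn div_mult_mod_eq[of "t - j" "int n"] pos_mod_bound[of "int n" "t - j"] by simp
      then show ?thesis by (rule \<sigma>_low)
    next
      case False
      have "extend j f t y = 0"
      proof (cases "y \<in> U t")
        case True
        then show ?thesis using False by (auto simp: extend_def)
      qed (rule modhom_out[OF me])
      then show ?thesis using modhom_0[OF mod_\<sigma>] by simp
    qed
    ultimately show ?thesis using modhom_0[OF me] by simp
  next
    case True
    have d: "(s - int n) div int n = s div int n - 1" "(s - int n) mod int n = s mod int n" for s
      using nn div_add_self2[of "int n" "s - int n"] by simp_all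
    have j: "t - int n - j = t - j - int n" by simp
    have cond: "(0 \<le> t - int n \<and> (t - int n) div int n = (t - int n - j) div int n) =
       (0 \<le> t \<and> t div int n = (t - j) div int n)"
      unfolding j d using True by auto
    show ?thesis
    proof (cases "0 \<le> t \<and> t div int n = (t - j) div int n")
      case c: True
      \<comment> \<open>Source and target lie in the same copy, so the target is also outside the
        0-th copy and \<sigma> acts there as the identity.\<close>
      have "1 \<le> t div int n" using True nn pos_imp_zdiv_pos_iff[of "int n" t] by simp
      then have "1 \<le> (t - j) div int n" using c by simp
      then have "int n \<le> t - j" using nn pos_imp_zdiv_pos_iff[of "int n" "t - j"] by simp
      then have "\<sigma> (t - j) (extend j f t y) = extend j f t y"
        using modhom_in_submod[OF me submod_U] by (intro \<sigma>_id)
      moreover have "int n * j + int n * j * (t div int n - 1) = int n * j * (t div int n)" by (simp add: algebra_simps)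
      ultimately show ?thesis using True c cond by (simp add: \<sigma>_id extend_def d isgn_isgn)
    next
      case False
      then have "extend j f t y = 0" "extend j f (t - int n) (\<sigma> t y) = 0"
        using cond unfolding extend_def by (simp_all only: if_False)
      then show ?thesis using modhom_0[OF mod_\<sigma>] by simp
    qed
  qed
  then show ?thesis using me by (simp add: twisted_def gHom_def)
qed

lemma res_extend:
  assumes f: "f \<in> gHom act C j" shows "res j (extend j f) = f"
proof -
  have "res j (extend j f) t y = f t y" for t y
  proof (cases "0 \<le> t \<and> t < int n \<and> 0 \<le> t - j \<and> t - j < int n")
    case True
    then show ?thesis by (simp add: res_def extend_def isgn_even)
  next
    case False
    then have "f t y = 0" by (intro End_zero_component[OF f]) linarith
    then show ?thesis using False unfolding res_def by (simp only: if_False)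
  qed
  then show ?thesis by (simp add: fun_eq_iff)
qed

text \<open>The second component has degree \<open>j - n + 1\<close>, so its exponent is
  \<open>n (j - n + 2)\<close>. This differs from \<open>n (j + 1)\<close> by
  \<open>n (1 - n)\<close>, a product of consecutive integers up to sign, hence even.\<close>

lemma Tdeg_iff:
  "(x, y) \<in> Tdeg act n U j \<longleftrightarrow> x \<in> twisted (int n * j) j \<and> y \<in> twisted (int n * (j + 1)) (j - int n + 1)"
proof -
  have "int n * (j - int n + 1 + 1) - int n * (j + 1) = int n * (1 - int n)"
    by (simp add: algebra_simps)
  then have "even (int n * (j - int n + 1 + 1) - int n * (j + 1))" by simp
  then show ?thesis
    using twisted_cong unfolding Tdeg_def sigE_eq msigE_eq by blast
qed

lemma Txi_eq: "Txi n U DU j (x, y) = (gdiff DU j x - isgn j (rmul y), gdiff DU (j - int n + 1) y)"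
  by (simp add: Txi_def rmul_def)

text \<open>Extending copywise is a section of restriction but not a chain map. The defect restricts
  to zero, hence is divisible by \<sigma>, and the quotient supplies the second component, both when
  a cocycle is lifted and when a boundary is.\<close>

lemma T_sq_iso:
  "sq_iso (Tsm act alg) (gsm act alg) (TZ act n U DU i) (TB act n U DU i) (EndZ act C D i) (EndB act C D i)"
  unfolding sq_iso_def
proof (intro exI[of _ "\<lambda>p. res i (fst p)"] conjI ballI allI)
  have TZ: "x \<in> twisted (int n * i) i \<and> y \<in> twisted (int n * (i + 1)) (i - int n + 1) \<and>
      gdiff DU i x = isgn i (rmul y) \<and> gdiff DU (i - int n + 1) y = 0" if "(x, y) \<in> TZ act n U DU i" for x y
    using that by (auto simp: TZ_def Tdeg_iff Txi_eq)
  show "res i (fst p) \<in> EndZ act C D i" if "p \<in> TZ act n U DU i" for p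
  proof -
    obtain x y where p: "p = (x, y)" by force
    note xy = TZ[OF that[unfolded p]]
    have "gdiff D i (res i x) = isgn i (res (i + 1) (rmul y))"
      using xy by (simp add: res_gdiff[of x "int n * i"] res_isgn)
    also have "\<dots> = 0" using xy by (simp add: res_rmul[of y "i - int n + 1"] twisted_def)
    finally show ?thesis using xy res_gHom[of x i] by (simp add: p EndZ_def twisted_def)
  qed
  show "res i (fst (p + q)) = res i (fst p) + res i (fst q)" for p q :: "(int \<Rightarrow> 'm \<Rightarrow> 'm) \<times> (int \<Rightarrow> 'm \<Rightarrow> 'm)"
    by (auto simp: res_def fun_eq_iff)
  show "res i (fst (Tsm act alg c p)) = gsm act alg c (res i (fst p))" for c p
    by (auto simp: res_def fun_eq_iff Tsm_def gsm_def)
  show "\<exists>p\<in>TZ act n U DU i. z - res i (fst p) \<in> EndB act C D i" if "z \<in> EndZ act C D i" for z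
  proof -
    have z: "z \<in> gHom act C i" "gdiff D i z = 0" using that by (auto simp: EndZ_def)
    define x where "x = extend i z"
    have x: "x \<in> twisted (int n * i) i" "res i x = z"
      using z extend_twisted res_extend by (auto simp: x_def)
    have x1: "x \<in> gHom act U i" using x by (simp add: twisted_def)
    have e: "int n * i + int n = int n * (i + 1)" by (simp add: algebra_simps)
    have "gdiff DU i x \<in> twisted (int n * (i + 1)) (i + 1)" using gdiff_twisted[OF x(1)] unfolding e .
    moreover have "res (i + 1) (gdiff DU i x) = 0" using res_gdiff[OF x(1)] x(2) z(2) by simp
    ultimately obtain y where y: "y \<in> twisted (int n * (i + 1)) (i + 1 - int n)" "gdiff DU i x = rmul y"
      by (rule twisted_divide)
    have y1: "y \<in> gHom act U (i + 1 - int n)" using y by (simp add: twisted_def)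
    \<comment> \<open>The quotient \<open>y\<close> is itself a cocycle: multiplied by \<sigma>, its
      differential is the second differential of \<open>x\<close>, and \<sigma> can be
      cancelled.\<close>
    have "rmul (gdiff DU (i + 1 - int n) y) = gdiff DU (i + 1) (gdiff DU i x)"
      using gdiff_rmul[OF y1] by (simp add: y(2))
    also have "\<dots> = 0" by (rule gdiff_gdiff[OF cplx_U x1])
    finally have dy: "gdiff DU (i + 1 - int n) y = 0" using rmul_inj[OF gdiff_gHom[OF cplx_U y1]] by blast
    have i: "i + 1 - int n = i - int n + 1" by simp
    \<comment> \<open>The factor (-1)^i compensates the sign in front of the mixed term of
      \<open>Txi\<close>.\<close>
    have "isgn i (rmul (isgn i y)) = rmul y" by (simp add: rmul_isgn)
    then have "(x, isgn i y) \<in> TZ act n U DU i"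
      using x(1) twisted_isgn[OF y(1)] dy unfolding TZ_def Tdeg_iff mem_Collect_eq Txi_eq y(2) gdiff_isgn[OF y1[unfolded i]] i
      by simp
    moreover have "0 \<in> EndB act C D i"
    proof -
      interpret v: vector_space "gsm act alg" by (rule vector_space_gsm)
      show ?thesis by (rule v.subspace_0[OF EndB_subspace[OF cplx_C]])
    qed
    ultimately show ?thesis using x(2) by (intro bexI[of _ "(x, isgn i y)"]) simp_all
  qed
  show "res i (fst p) \<in> EndB act C D i \<longleftrightarrow> p \<in> TB act n U DU i" if p: "p \<in> TZ act n U DU i" for p
  proof -
    obtain x y where xy: "p = (x, y)" by force
    have x: "x \<in> twisted (int n * i) i" and y: "y \<in> twisted (int n * (i + 1)) (i - int n + 1)"
      and dx: "gdiff DU i x = isgn i (rmul y)" and dy: "gdiff DU (i - int n + 1) y = 0"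
      using TZ[OF p[unfolded xy]] by auto
    have x1: "x \<in> gHom act U i" and y1: "y \<in> gHom act U (i - int n + 1)" using x y by (auto simp: twisted_def)
    have j: "i - 1 - int n + 1 = i - int n" "int n * (i - 1 + 1) = int n * i" by simp_all
    have "res i x \<in> EndB act C D i" if xyB: "(x, y) \<in> TB act n U DU i"
    proof -
      obtain a b where ab: "a \<in> twisted (int n * (i - 1)) (i - 1)" "b \<in> twisted (int n * i) (i - int n)"
        "x = gdiff DU (i - 1) a - isgn (i - 1) (rmul b)"
        using xyB j unfolding TB_def by (auto simp: Tdeg_iff Txi_eq)
      have b1: "b \<in> gHom act U (i - int n)" using ab by (simp add: twisted_def)
      have "res i (u - v) = res i u - res i v" for u v :: "int \<Rightarrow> 'm \<Rightarrow> 'm" by (auto simp: res_def fun_eq_iff)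
      then have "res i x = gdiff D (i - 1) (res (i - 1) a)"
        using res_gdiff[OF ab(1)] by (simp add: ab(3) res_isgn res_rmul[OF b1])
      moreover have "res (i - 1) a \<in> gHom act C (i - 1)" using ab(1) by (intro res_gHom) (simp add: twisted_def)
      ultimately show ?thesis by (simp add: EndB_def)
    qed
    moreover have "(x, y) \<in> TB act n U DU i" if xB: "res i x \<in> EndB act C D i"
    proof -
      obtain w where w: "w \<in> gHom act C (i - 1)" "res i x = gdiff D (i - 1) w" using xB by (auto simp: EndB_def)
      define a where "a = extend (i - 1) w"
      have a: "a \<in> twisted (int n * (i - 1)) (i - 1)" "res (i - 1) a = w"
        using w extend_twisted res_extend by (auto simp: a_def)
      have a1: "a \<in> gHom act U (i - 1)" using a by (simp add: twisted_def)
      have e: "int n * (i - 1) + int n = int n * i" by (simp add: algebra_simps)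
      have da: "gdiff DU (i - 1) a \<in> twisted (int n * i) i" using gdiff_twisted[OF a(1)] unfolding e by simp
      have "res i (x - gdiff DU (i - 1) a) = res i x - res i (gdiff DU (i - 1) a)" by (auto simp: res_def fun_eq_iff)
      also have "\<dots> = 0" using res_gdiff[OF a(1)] a(2) w(2) by simp
      finally obtain b where b: "b \<in> twisted (int n * i) (i - int n)" "x - gdiff DU (i - 1) a = rmul b"
        using twisted_divide[OF twisted_diff[OF x da]] by blast
      have b1: "b \<in> gHom act U (i - int n)" using b by (simp add: twisted_def)
      have da1: "gdiff DU (i - 1) a \<in> gHom act U i" using da by (simp add: twisted_def)
      have "gdiff DU i (gdiff DU (i - 1) a) = 0" using gdiff_gdiff[OF cplx_U a1] by simp
      then have "gdiff DU i (rmul b) = isgn i (rmul y)"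
        unfolding b(2)[symmetric] gdiff_diff[OF cplx_U x1 da1] dx by simp
      then have "rmul (gdiff DU (i - int n) b) = rmul (isgn i y)"
        using gdiff_rmul[OF b1] by (simp add: rmul_isgn)
      then have "rmul (gdiff DU (i - int n) b - isgn i y) = 0" by (simp add: rmul_apply fun_eq_iff)
      moreover have "gdiff DU (i - int n) b - isgn i y \<in> gHom act U (i - int n + 1)"
      proof -
        have "isgn i y \<in> gHom act U (i - int n + 1)" using twisted_isgn[OF y, of i] by (simp add: twisted_def)
        then show ?thesis using grHom_diff[OF _ _ submod_U] gdiff_gHom[OF cplx_U b1] by (simp add: gHom_eq_grHom)
      qed
      \<comment> \<open>Only the first component was matched by construction; cancelling \<sigma> in
        the cocycle equation for the pair forces the second one to match as well.\<close>
      ultimately have db: "gdiff DU (i - int n) b = isgn i y" using rmul_inj by fastforce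
      have "Txi n U DU (i - 1) (a, isgn i b) = (gdiff DU (i - 1) a + rmul b, y)"
        unfolding Txi_eq j gdiff_isgn[OF b1] db by (simp add: rmul_isgn isgn_minus_1)
      also have "\<dots> = (x, y)" by (simp add: b(2)[symmetric])
      finally have "Txi n U DU (i - 1) (a, isgn i b) = (x, y)" .
      moreover have "(a, isgn i b) \<in> Tdeg act n U (i - 1)"
        unfolding Tdeg_iff j using a(1) twisted_isgn[OF b(1)] by simp
      ultimately show ?thesis unfolding TB_def by (metis imageI)
    qed
    ultimately show ?thesis by (auto simp: xy)
  qed
qed

end

theorem theorem3p8:
  fixes act :: "'m::ab_group_add \<Rightarrow> 'g::ring_1 \<Rightarrow> 'm"
    and alg :: "'k::field \<Rightarrow> 'g"
    and n :: nat and M :: "'m set" and P :: "nat \<Rightarrow> 'm set"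
    and d :: "nat \<Rightarrow> 'm \<Rightarrow> 'm" and \<alpha> \<beta> :: "'m \<Rightarrow> 'm"
    and Q :: "nat \<Rightarrow> 'm set" and dQ :: "nat \<Rightarrow> 'm \<Rightarrow> 'm" and eps :: "'m \<Rightarrow> 'm"
    and i :: int
  assumes "right_module act"
    and "k_algebra_map alg"
    and "2 \<le> n"
    and "exact_setup act n M P d \<alpha> \<beta>"
    and "proj_resolution act M Q dQ eps"
  shows "sq_iso (Tsm act alg) (dssm act alg :: 'k \<Rightarrow> _)
           (TZ act n (perC n P) (perD n d \<alpha> \<beta>) i) (TB act n (perC n P) (perD n d \<alpha> \<beta>) i)
           (dsZ (summands act n M P \<alpha> \<beta> Q dQ i)) (dsB (summands act n M P \<alpha> \<beta> Q dQ i))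
       \<and> sq_iso (gsm act alg) (dssm act alg :: 'k \<Rightarrow> _)
           (EndZ act (finC n P) (finD n d) i) (EndB act (finC n P) (finD n d) i)
           (dsZ (summands act n M P \<alpha> \<beta> Q dQ i)) (dsB (summands act n M P \<alpha> \<beta> Q dQ i))"
proof -
  interpret periodic_setup act alg n M P d \<alpha> \<beta>
    using assms by unfold_locales
  note End = End_sq_iso_summands[OF assms(5), of i]
  have "sq_iso (Tsm act alg) (dssm act alg)
           (TZ act n (perC n P) (perD n d \<alpha> \<beta>) i) (TB act n (perC n P) (perD n d \<alpha> \<beta>) i)
           (dsZ (summands act n M P \<alpha> \<beta> Q dQ i)) (dsB (summands act n M P \<alpha> \<beta> Q dQ i))"
    by (rule sq_iso_trans[OF T_sq_iso End EndB_subset_EndZ[OF cplx_C] dsB_summands_add[OF assms(5)]])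
  with End show ?thesis by blast
qed

end
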